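(* Let $\beta=|\beta|e^{ib}\neq 0$ with $b\in[\tfrac{\pi}{2},\tfrac{3\pi}{2}]$, $|\beta|\le \pi$ and $e^{-\Re\beta}-2\cos(\Im\beta)>0$, and let $\theta\in[-\tfrac\pi2,\tfrac\pi2]$ satisfy $b+\theta=\pi\pmod{2\pi}$. Assume that (1) $F$ has exactly one singularity, an integrable branch point, at $p=1$; (2) $|F(p)|\le C|p|^{-\alpha}$ for large $|p|$, with some $\alpha>1$, and $F$ is $L^1_{\rm loc}$; (3) $F$ is analytic in $\mathbb C\setminus(1+e^{i\theta}[0,\infty))$ and can be analytically continued through both sides of the cut. Consider the dyadic series $$\sum_{m=1}^{\infty}\frac{(m-1)!}{(x/\beta)_m}\,d_{m,0}+\sum_{k=1}^{\infty}\sum_{m=1}^{\infty}\frac{(m-1)!}{(2^kx/\beta)_m}\,d_{m,k}$$ of the function $f(x)=\int_0^{\infty e^{-ib}}e^{-xp}F(p)\,dp$ (for $\arg x\in(b-\frac\pi2,b+\frac\pi2)$, and analytically continued to $\mathbb C\setminus\beta(-\infty,0]$). The poles (in $x$) of the dyadic series all lie on the ray $\beta(-\infty,0]$. The convergence of the series to $f$ is uniform on compact sets contained in the complement of this ray; that is, for every compact $K\subset\mathbb C\setminus\beta(-\infty,0]$, $$f(x)-\sum_{m=1}^{n}\frac{(m-1)!}{(x/\beta)_m}\,d_{m,0}-\sum_{k=1}^{N-1}\sum_{m=1}^{\ell}\frac{(m-1)!}{(2^kx/\beta)_m}\,d_{m,k}\to0\quad\text{uniformly for }x\in K\text{ as 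}n,N,\ell\to\infty.$$
   Context: $(y)_m=y(y+1)\cdots(y+m-1)=\Gamma(y+m)/\Gamma(y)$. With $s=1+te^{i\theta}$ and $\Delta F(1+te^{i\theta})=F(1+te^{i\theta^+})-F(1+te^{i\theta^-})$ the jump of $F$ across the cut (boundary values from the sides of larger ($+$) and smaller ($-$) argument of $p-1$), the coefficients are $$d_{m,0}=\frac{e^{i\theta}}{2\pi i}\int_0^\infty\Delta F(1+te^{i\theta})\frac{e^{\beta s(m-1)}}{(e^{\beta s}-1)^m}\,dt,\qquad d_{m,k}=\frac{e^{i\theta}}{2\pi i}\int_0^\infty\Delta F(1+te^{i\theta})\frac{e^{\beta s(m-1)/2^k}}{(e^{\beta s/2^k}+1)^m}\,dt\quad(k\ge1).$$ *)

theory Defs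
  imports "HOL-Complex_Analysis.Complex_Analysis"
begin

definition cut_ray :: "real \<Rightarrow> complex set" where
  "cut_ray \<theta> = {1 + of_real t * cis \<theta> | t. t \<ge> 0}"

text \<open>
  Boundary values of \<open>F\<close> at the point \<open>1 + t * cis \<theta>\<close> of the cut, taken from the sides of larger
  and of smaller argument of \<open>p - 1\<close>; the values of \<open>F\<close> on the cut itself play no role.
\<close>

definition plus_value :: "(complex \<Rightarrow> complex) \<Rightarrow> real \<Rightarrow> real \<Rightarrow> complex" where
  "plus_value F \<theta> t = Lim (at_right \<theta>) (\<lambda>\<phi>. F (1 + of_real t * cis \<phi>))"

definition minus_value :: "(complex \<Rightarrow> complex) \<Rightarrow> real \<Rightarrow> real \<Rightarrow> complex" where
  "minus_value F \<theta> t = Lim (at_left \<theta>) (\<lambda>\<phi>. F (1 + of_real t * cis \<phi>))"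

definition jump :: "(complex \<Rightarrow> complex) \<Rightarrow> real \<Rightarrow> real \<Rightarrow> complex" where
  "jump F \<theta> t = plus_value F \<theta> t - minus_value F \<theta> t"

text \<open>
  Analytic continuation through both sides: near each point of the cut other than its endpoint,
  the restriction of \<open>F\<close> to either side extends holomorphically to a full disc.
\<close>

definition continuable_through_cut :: "(complex \<Rightarrow> complex) \<Rightarrow> real \<Rightarrow> bool" where
  "continuable_through_cut F \<theta> \<longleftrightarrow>
     (\<forall>t>0. \<exists>r>0. \<exists>G H.
        G holomorphic_on ball (1 + of_real t * cis \<theta>) r \<and>
        H holomorphic_on ball (1 + of_real t * cis \<theta>) r \<and>
        (\<forall>p \<in> ball (1 + of_real t * cis \<theta>) r.
           (Im ((p - 1) * cis (- \<theta>)) > 0 \<longrightarrow> F p = G p) \<and>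
           (Im ((p - 1) * cis (- \<theta>)) < 0 \<longrightarrow> F p = H p)))"

text \<open>
  The first conjunct says that \<open>1\<close> is a branch point: \<open>F\<close> does not come from a single-valued
  analytic function in a punctured neighbourhood of \<open>1\<close> (in particular \<open>F\<close> is singular there).
  The other two say that \<open>F\<close> is integrable at \<open>1\<close> along both sides of the cut.
\<close>

definition integrable_branch_point :: "(complex \<Rightarrow> complex) \<Rightarrow> real \<Rightarrow> bool" where
  "integrable_branch_point F \<theta> \<longleftrightarrow>
     \<not> (\<exists>r>0. \<exists>G. G holomorphic_on (ball 1 r - {1}) \<and>
              (\<forall>p \<in> ball 1 r - cut_ray \<theta>. G p = F p)) \<and>
     (\<exists>\<delta>>0. set_integrable lborel {0<..<\<delta>} (plus_value F \<theta>) \<and>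
            set_integrable lborel {0<..<\<delta>} (minus_value F \<theta>))"

text \<open>The Laplace integral of \<open>F\<close> along the ray \<open>p = \<tau> * cis (- b)\<close>, \<open>\<tau> \<ge> 0\<close>.\<close>

definition laplace_ray :: "(complex \<Rightarrow> complex) \<Rightarrow> real \<Rightarrow> complex \<Rightarrow> complex" where
  "laplace_ray F b x =
     (LINT \<tau>:{0..}|lborel. exp (- x * (of_real \<tau> * cis (- b))) * F (of_real \<tau> * cis (- b)) * cis (- b))"

definition dyadic_coeff ::
  "complex \<Rightarrow> real \<Rightarrow> (complex \<Rightarrow> complex) \<Rightarrow> nat \<Rightarrow> nat \<Rightarrow> complex" where
  "dyadic_coeff \<beta> \<theta> F m k =
     cis \<theta> / (2 * of_real pi * \<i>) *
     (LINT t:{0<..}|lborel. jump F \<theta> t *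
        (let s = 1 + of_real t * cis \<theta> in
           if k = 0 then exp (\<beta> * s * of_nat (m - 1)) / (exp (\<beta> * s) - 1) ^ m
           else exp (\<beta> * s * of_nat (m - 1) / 2 ^ k) / (exp (\<beta> * s / 2 ^ k) + 1) ^ m))"

text \<open>Meaningful for \<open>m \<ge> 1\<close>; the case \<open>k = 0\<close> is the first, single series.\<close>

definition dyadic_term ::
  "complex \<Rightarrow> real \<Rightarrow> (complex \<Rightarrow> complex) \<Rightarrow> nat \<Rightarrow> nat \<Rightarrow> complex \<Rightarrow> complex" where
  "dyadic_term \<beta> \<theta> F m k x =
     fact (m - 1) / pochhammer (2 ^ k * x / \<beta>) m * dyadic_coeff \<beta> \<theta> F m k"

definition dyadic_partial_sum ::
  "complex \<Rightarrow> real \<Rightarrow> (complex \<Rightarrow> complex) \<Rightarrow> nat \<Rightarrow> nat \<Rightarrow> nat \<Rightarrow> complex \<Rightarrow> complex" where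
  "dyadic_partial_sum \<beta> \<theta> F n N l x =
     (\<Sum>m=1..n. dyadic_term \<beta> \<theta> F m 0 x) +
     (\<Sum>k=1..<N. \<Sum>m=1..l. dyadic_term \<beta> \<theta> F m k x)"

definition dyadic_series ::
  "complex \<Rightarrow> real \<Rightarrow> (complex \<Rightarrow> complex) \<Rightarrow> complex \<Rightarrow> complex" where
  "dyadic_series \<beta> \<theta> F x =
     (\<Sum>m. dyadic_term \<beta> \<theta> F (Suc m) 0 x) +
     (\<Sum>k. \<Sum>m. dyadic_term \<beta> \<theta> F (Suc m) (Suc k) x)"

definition pole_ray :: "complex \<Rightarrow> complex set" where
  "pole_ray \<beta> = {\<beta> * of_real t | t. t \<le> 0}"

text \<open>
  \<open>f\<close> is the analytic continuation to the complement of \<open>\<beta>(-\<infinity>,0]\<close> of the Laplace integral, which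
  is given for \<open>arg x \<in> (b - \<pi>/2, b + \<pi>/2)\<close>. It is determined on that complement by the identity
  theorem.
\<close>

definition continues_laplace ::
  "complex \<Rightarrow> real \<Rightarrow> (complex \<Rightarrow> complex) \<Rightarrow> (complex \<Rightarrow> complex) \<Rightarrow> bool" where
  "continues_laplace \<beta> b F f \<longleftrightarrow>
     f holomorphic_on (- pole_ray \<beta>) \<and>
     (\<forall>r \<phi>. r > 0 \<and> b - pi / 2 < \<phi> \<and> \<phi> < b + pi / 2 \<longrightarrow>
        f (rcis r \<phi>) = laplace_ray F b (rcis r \<phi>))"

end

theory Submission
  imports Defs
begin

text \<open>
  The dyadic series is the Cauchy kernel in disguise. Let s run through the cut and \<open>p = \<tau> cis(-b)\<close>
  through the Laplace ray. Since \<open>b + \<theta> = \<pi>\<close> modulo \<open>2\<pi>\<close>, the number \<open>\<beta> p\<close> is nonnegative and \<open>\<beta> s = \<beta> - |\<beta>| t\<close>.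
  Repeated use of \<open>1/(E\<^sup>2 - 1) + 1/(2(E + 1)) = 1/(2(E - 1))\<close> gives, with \<open>v = \<beta> (s - p)\<close>,
  \<open>1/v = 1/(e\<^sup>v - 1) + \<Sum>\<^sub>k 2\<^sup>-\<^sup>k/(exp(v/2\<^sup>k) + 1)\<close> (\<open>dyadic_kernel_sums\<close>). Each summand is a geometric
  series in \<open>1 - exp(-\<beta> p/2\<^sup>k)\<close>, so \<open>1/(s - p)\<close> becomes a double series of products of a function of
  s and a function of p (\<open>dyadic_kernel_has_sum\<close>). Integrating the first factor against the jump of
  F produces the coefficient \<open>d\<^sub>m\<^sub>,\<^sub>k\<close>; the Laplace transform of the second is Euler's integral
  \<open>B(2\<^sup>k x/\<beta>, m) = (m-1)!/(2\<^sup>k x/\<beta>)\<^sub>m\<close> (\<open>beta_ray_integral\<close>). Hence the series equals the Laplace integral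
  on the half plane \<open>Re (x/\<beta>) > 0\<close> (\<open>laplace_ray_eq_dyadic_sum\<close>), and by the identity theorem it is the
  continuation of f wherever it converges locally uniformly.

  The coefficients decay like \<open>R\<^sub>k\<^sup>-\<^sup>m\<close>, where \<open>R\<^sub>0 > 1\<close> restates the gap condition on \<beta> and
  \<open>R\<^sub>k = 2 cos(\<pi>/2\<^sup>k\<^sup>+\<^sup>1) \<ge> \<surd>2\<close> for \<open>k \<ge> 1\<close>. For a fixed k the Beta factor grows more slowly than any
  exponential in m, which settles finitely many k. Uniformity in k is the point where the whole
  slit plane enters: when \<open>x/\<beta>\<close> is close to the negative axis, the Beta factor with \<open>y = 2\<^sup>k x/\<beta>\<close> can be
  exponentially large in m. Turning the path of Euler's integral to a ray in the open right half plane
  bounds it by \<open>const M\<^sup>m/2\<^sup>k\<close> with \<open>M < 2\<close>, because \<open>|1 - e\<^sup>-\<^sup>v| \<le> M\<close> on such a ray (\<open>norm_beta_le\<close>); and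
  \<open>R\<^sub>k \<rightarrow> 2\<close>. So all terms are at most \<open>D 2\<^sup>-\<^sup>k r\<^sup>m\<close> with \<open>r < 1\<close> on a given compact set (\<open>dyadic_term_bound\<close>).

  What remains is Cauchy's formula \<open>F(p) = (1/2\<pi>i) \<integral> \<Delta>F(s)/(s - p) ds\<close> over the cut
  (\<open>cauchy_formula_off_cut\<close>), where the branch point must be shown to contribute nothing. Integrability
  of F in area only gives \<open>|F(p)| \<le> C/dist(p, cut)\<^sup>2\<close> near 1, and on the two sides of the cut F is merely
  integrable. The formula is therefore first proved for F times a weight which vanishes to second
  order where a small circle about 1 meets the cut, is small on that circle, and on the remaining
  part of the cut is bounded by 1 and tends to 1 as the circle shrinks; dominated convergence removes the
  weight (\<open>cauchy_formula_sheet\<close>). In the coordinate \<open>log ((p - 1) cis(-\<theta>))\<close> the plane with its two-sided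
  cut is the closed strip \<open>0 \<le> Im z \<le> 2\<pi>\<close>, circles about 1 are vertical segments, and only rectangles are
  needed as contours.
\<close>

section \<open>Integration on subsets of the line\<close>

lemma set_borel_measurable_continuous_on:
  fixes k :: "real \<Rightarrow> complex"
  assumes "A \<in> sets borel" "continuous_on A k"
  shows "set_borel_measurable lborel A k"
  unfolding set_borel_measurable_def measurable_lborel2
  by (rule borel_measurable_continuous_on_indicator[OF assms])

lemma set_integrable_mult_bounded:
  fixes g k :: "real \<Rightarrow> complex"
  assumes g: "set_integrable lborel A g" and k: "set_borel_measurable lborel A k"
    and B: "\<And>t. t \<in> A \<Longrightarrow> norm (k t) \<le> B"
  shows "set_integrable lborel A (\<lambda>t. g t * k t)"
    and "norm (LINT t:A|lborel. g t * k t) \<le> (LINT t:A|lborel. norm (g t)) * B"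
proof -
  have bd: "norm (g t * k t) \<le> norm (g t) * B" if "t \<in> A" for t
    unfolding norm_mult by (intro mult_left_mono B that) auto
  have I: "set_integrable lborel A (\<lambda>t. norm (g t) * B)"
    by (intro set_integrable_mult_left set_integrable_norm g)
  show J: "set_integrable lborel A (\<lambda>t. g t * k t)"
  proof (rule set_integrable_bound[OF I])
    have "(\<lambda>t. (indicator A t *\<^sub>R g t) * (indicator A t *\<^sub>R k t)) \<in> borel_measurable lborel"
      using borel_measurable_integrable[OF g[unfolded set_integrable_def]] k[unfolded set_borel_measurable_def]
      by (rule borel_measurable_times)
    moreover have "(\<lambda>t. (indicator A t *\<^sub>R g t) * (indicator A t *\<^sub>R k t)) = (\<lambda>t. indicator A t *\<^sub>R (g t * k t))"
      by (auto simp: indicator_def)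
    ultimately show "set_borel_measurable lborel A (\<lambda>t. g t * k t)"
      by (simp add: set_borel_measurable_def)
    show "AE t in lborel. t \<in> A \<longrightarrow> norm (g t * k t) \<le> norm (norm (g t) * B)"
    proof (intro AE_I2 impI)
      fix t assume "t \<in> A"
      from bd[OF this] show "norm (g t * k t) \<le> norm (norm (g t) * B)"
        using abs_ge_self[of "norm (g t) * B"] unfolding real_norm_def by linarith
    qed
  qed
  have "norm (LINT t:A|lborel. g t * k t) \<le> (LINT t:A|lborel. norm (g t) * B)"
    by (intro order_trans[OF set_integral_norm_bound[OF J]] set_integral_mono set_integrable_norm J I bd)
  then show "norm (LINT t:A|lborel. g t * k t) \<le> (LINT t:A|lborel. norm (g t)) * B"
    by (simp only: set_integral_mult_left)
qed

lemma set_integral_norm_nonneg: "(LINT t:A|M. norm (g t)) \<ge> 0"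
  unfolding set_lebesgue_integral_def by (intro integral_nonneg_AE) auto

section \<open>Beta integrals along rays\<close>

lemma integral_exp_ray:
  fixes a :: complex
  assumes "Re a > 0"
  shows "set_integrable lborel {0..} (\<lambda>t. exp (- a * of_real t))"
    and "(LINT t:{0..}|lborel. exp (- a * of_real t)) = 1 / a"
    and "(LINT t:{0..}|lborel. norm (exp (- a * of_real t))) = 1 / Re a"
proof -
  have a0: "a \<noteq> 0" using assms by auto
  have abs: "set_integrable lborel {0..} (\<lambda>t. exp (- (Re a * t)))"
  proof -
    have "(\<lambda>t. exp (- (Re a * t))) integrable_on {0..}"
      using has_integral_exp_minus_to_infinity[OF assms, of 0]
      by (auto simp: integrable_on_def)
    then have "(\<lambda>t. exp (- (Re a * t))) absolutely_integrable_on {0..}"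
      by (intro nonnegative_absolutely_integrable_1) auto
    then show ?thesis
      unfolding set_integrable_def
      by (subst (asm) integrable_completion) auto
  qed
  have "(LINT t:{0..}|lborel. exp (- (Re a * t))) = integral {0..} (\<lambda>t. exp (- (Re a * t)))"
    by (rule set_borel_integral_eq_integral(2)[OF abs])
  also have "\<dots> = 1 / Re a"
    using has_integral_exp_minus_to_infinity[OF assms, of 0] by (simp add: integral_unique)
  finally show "(LINT t:{0..}|lborel. norm (exp (- a * of_real t))) = 1 / Re a"
    by (simp add: norm_exp_eq_Re)
  show int: "set_integrable lborel {0..} (\<lambda>t. exp (- a * of_real t))"
    by (rule set_integrable_bound[OF abs])
       (auto simp: set_borel_measurable_def norm_exp_eq_Re intro!: measurable_If)
  have "(LBINT t=ereal 0..\<infinity>. exp (- a * of_real t)) = 0 - (- 1 / a)"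
  proof (rule interval_integral_FTC_integrable[where F = "\<lambda>t. - exp (- a * of_real t) / a"])
    show "((\<lambda>t. - exp (- a * of_real t) / a) has_vector_derivative exp (- a * of_real t)) (at t)" for t :: real
      by (auto intro!: derivative_eq_intros has_vector_derivative_real_field simp: a0)
    show "set_integrable lborel (einterval (ereal 0) \<infinity>) (\<lambda>t. exp (- a * of_real t))"
      by (rule set_integrable_subset[OF int]) (auto simp: einterval_def)
    show "(((\<lambda>t. - exp (- a * of_real t) / a) \<circ> real_of_ereal) \<longlongrightarrow> - 1 / a) (at_right (ereal 0))"
      by (auto simp: ereal_tendsto_simps a0 intro!: tendsto_eq_intros)
    have "((\<lambda>t. exp (- (Re a * t))) \<longlongrightarrow> 0) at_top"
    proof -
      have "filterlim (\<lambda>t. Re a * t) at_top at_top"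
        by (rule filterlim_tendsto_pos_mult_at_top[OF tendsto_const assms filterlim_ident])
      then have "filterlim (\<lambda>t. - (Re a * t)) at_bot at_top"
        by (simp add: filterlim_uminus_at_bot)
      then show ?thesis by (rule filterlim_compose[OF exp_at_bot])
    qed
    then have "((\<lambda>t. exp (- (Re a * t)) / norm a) \<longlongrightarrow> 0 / norm a) at_top"
      by (rule tendsto_divide[OF _ tendsto_const]) (use a0 in simp)
    moreover have "norm (- exp (- a * of_real t) / a) = exp (- (Re a * t)) / norm a" for t
      by (simp only: norm_divide norm_minus_cancel norm_exp_eq_Re) simp
    ultimately have "((\<lambda>t. norm (- exp (- a * of_real t) / a)) \<longlongrightarrow> 0) at_top"
      by simp
    then have lim: "((\<lambda>t. - exp (- a * of_real t) / a) \<longlongrightarrow> 0) at_top"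
      by (rule tendsto_norm_zero_cancel)
    show "(((\<lambda>t. - exp (- a * of_real t) / a) \<circ> real_of_ereal) \<longlongrightarrow> 0) (at_left \<infinity>)"
      unfolding ereal_tendsto_simps by (rule lim)
  qed (auto intro!: continuous_intros)
  moreover have "(LINT t:{0..}|lborel. exp (- a * of_real t)) = (LINT t:{0<..}|lborel. exp (- a * of_real t))"
    by (rule set_integral_discrete_difference[of "{0}"]) auto
  ultimately show "(LINT t:{0..}|lborel. exp (- a * of_real t)) = 1 / a"
    by (simp add: interval_integral_to_infinity_eq)
qed

text \<open>
  Writing one factor as \<open>1 - e\<^sup>-\<^sup>v\<close> gives \<open>I\<^sub>m\<^sub>+\<^sub>1(y) = I\<^sub>m(y) - I\<^sub>m(y + 1)\<close>, and the right-hand side obeys the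
  same recursion. The induction takes place on one fixed ray, so no rotation of the path has to be
  justified.
\<close>

lemma beta_ray_integral:
  fixes y u :: complex
  assumes "Re u \<ge> 0" and "Re (y * u) > 0"
  shows "set_integrable lborel {0..} (\<lambda>t. exp (- y * (of_real t * u)) * (1 - exp (- (of_real t * u))) ^ m * u) \<and>
    (LINT t:{0..}|lborel. exp (- y * (of_real t * u)) * (1 - exp (- (of_real t * u))) ^ m * u)
      = fact m / pochhammer y (Suc m)"
  using assms(2)
proof (induction m arbitrary: y)
  case 0
  have u: "u \<noteq> 0" using 0 by auto
  note * = integral_exp_ray[OF 0]
  have "set_integrable lborel {0..} (\<lambda>t. exp (- (y * u) * of_real t) * u)"
    by (intro set_integrable_mult_left *)
  moreover have "(LINT t:{0..}|lborel. exp (- (y * u) * of_real t) * u) = 1 / y"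
    using * u by (subst set_integral_mult_left) auto
  ultimately show ?case by (simp add: mult_ac)
next
  case (Suc m)
  let ?g = "\<lambda>y m t. exp (- y * (of_real t * u)) * (1 - exp (- (of_real t * u))) ^ m * u"
  have R: "Re ((y + 1) * u) > 0" using Suc.prems assms(1) by (simp add: algebra_simps)
  have y0: "y + of_nat j \<noteq> 0" for j
  proof
    assume "y + of_nat j = 0"
    then have "Re (y * u) = - (of_nat j * Re u)"
      by (simp add: add_eq_0_iff2)
    moreover have "of_nat j * Re u \<ge> 0" using assms(1) by simp
    ultimately show False using Suc.prems by linarith
  qed
  have eq: "?g y (Suc m) t = ?g y m t - ?g (y + 1) m t" for t :: real
    by (simp add: algebra_simps exp_add[symmetric] exp_diff exp_minus field_simps)
  note I1 = Suc.IH[OF Suc.prems] and I2 = Suc.IH[OF R]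
  have p0: "pochhammer y (Suc m) \<noteq> 0" "pochhammer (y + 1) (Suc m) \<noteq> 0" "pochhammer (y + 1) m \<noteq> 0"
    using y0 y0[of "Suc _"] by (auto simp: pochhammer_eq_0_iff add_ac eq_neg_iff_add_eq_0)
  have pa: "pochhammer y (Suc m) = y * pochhammer (y+1) m"
    by (simp add: pochhammer_rec)
  have pb: "pochhammer (y+1) (Suc m) = pochhammer (y+1) m * (y + 1 + of_nat m)"
    by (simp add: pochhammer_rec' mult_ac)
  have pc: "pochhammer y (Suc (Suc m)) = y * (pochhammer (y+1) m * (y + 1 + of_nat m))"
    by (metis pochhammer_rec pb)
  have "fact m / pochhammer y (Suc m) - fact m / pochhammer (y + 1) (Suc m) = fact (Suc m) / pochhammer y (Suc (Suc m))"
  proof -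
    have frac: "f / (y * P) - f / (P * Q) = f * (Q - y) / (y * (P * Q))"
      if "P \<noteq> 0" "Q \<noteq> 0" "y \<noteq> 0" for f P Q :: complex
      using that by (simp add: field_simps)
    have "y + 1 + of_nat m \<noteq> 0" using y0[of "Suc m"] by (simp add: add_ac)
    from frac[OF p0(3) this, of "fact m"] y0[of 0] show ?thesis
      unfolding pa pb pc by (simp add: mult_ac add_ac)
  qed
  moreover have "set_integrable lborel {0..} (?g y (Suc m))"
    unfolding eq using I1 I2 by (intro set_integral_diff) auto
  moreover have "(LINT t:{0..}|lborel. ?g y (Suc m) t) = fact m / pochhammer y (Suc m) - fact m / pochhammer (y + 1) (Suc m)"
    unfolding eq using I1 I2 by (subst set_integral_diff) auto
  ultimately show ?case by auto
qed


text \<open>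
  For \<open>Re v \<ge> 0\<close> the modulus of \<open>1 - exp (-v)\<close> is close to 2 only near the points \<open>i\<pi>(2n + 1)\<close>. On the
  ray \<open>Im v = \<plusminus>t\<close>, which is too small for that when \<open>t \<le> 1\<close>; when \<open>t \<ge> 1\<close> the exponential is at most
  \<open>exp (-e)\<close>.
\<close>

lemma norm_one_minus_exp_ray_le:
  assumes e: "0 < e" "e \<le> 1" and s: "\<bar>s\<bar> = 1" and t: "t \<ge> 0"
  shows "norm (1 - exp (- (of_real t * Complex e s))) \<le> max (sqrt 2) (1 + exp (- e))"
proof (cases "t \<le> 1")
  case True
  let ?z = "- (of_real t * Complex e s)"
  have "\<bar>t * s\<bar> \<le> 1" using True s t by (simp add: abs_mult)
  then have "\<bar>t * s\<bar> \<le> pi / 2" using pi_ge_two by linarith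
  then have "cos (t * s) \<ge> 0" by (intro cos_ge_zero) auto
  then have r: "Re (exp ?z) \<ge> 0" by (simp add: Re_exp)
  have n: "norm (exp ?z) \<le> 1" using e t by (simp add: norm_exp_eq_Re)
  have "(norm (1 - exp ?z))\<^sup>2 = 1 - 2 * Re (exp ?z) + (norm (exp ?z))\<^sup>2"
    unfolding cmod_power2 by (simp add: power2_eq_square algebra_simps del: Re_exp Im_exp norm_exp_eq_Re)
  also have "\<dots> \<le> 2" using r n power_le_one[of "norm (exp ?z)" 2] by (simp del: norm_exp_eq_Re Re_exp)
  finally have "norm (1 - exp ?z) \<le> sqrt 2" by (rule real_le_rsqrt)
  then show ?thesis by simp
next
  case False
  have "norm (1 - exp (- (of_real t * Complex e s))) \<le> 1 + exp (- (t * e))"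
    by (rule order_trans[OF norm_triangle_ineq4]) (simp add: norm_exp_eq_Re)
  also have "\<dots> \<le> 1 + exp (- e)" using False e by simp
  finally show ?thesis by simp
qed

text \<open>
  The sign of the imaginary part of the ray is chosen opposite to that of y, so that \<open>Re (y u)\<close> stays
  positive although \<open>Re y\<close> may be negative. The bound scales like \<open>1/|y|\<close> and its exponential rate does
  not depend on y; both are used for \<open>y = 2\<^sup>k x/\<beta>\<close> with \<open>k \<rightarrow> \<infinity>\<close>.
\<close>

lemma norm_beta_le:
  assumes e: "0 < e" "e \<le> 1" and c: "c > 0" and y: "e * Re y + \<bar>Im y\<bar> \<ge> c"
  shows "norm (fact m / pochhammer y (Suc m)) \<le> 2 * max (sqrt 2) (1 + exp (- e)) ^ m / c"
proof -
  define s where "s = (if Im y \<ge> 0 then -1 else 1 :: real)"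
  define u where "u = Complex e s"
  let ?M = "max (sqrt 2) (1 + exp (- e))"
  have yu: "Re (y * u) = e * Re y + \<bar>Im y\<bar>" by (auto simp: u_def s_def)
  have s1: "\<bar>s\<bar> = 1" by (simp add: s_def)
  have R: "Re u \<ge> 0" "Re (y * u) > 0" using e c y yu by (simp_all only: u_def complex.sel)
  have "norm u \<le> \<bar>Re u\<bar> + \<bar>Im u\<bar>" by (rule cmod_le)
  then have u2: "norm u \<le> 2" using e s1 by (simp add: u_def)
  let ?k = "\<lambda>t. (1 - exp (- (of_real t * u))) ^ m * u"
  have meas: "set_borel_measurable lborel {0..} ?k"
    by (intro set_borel_measurable_continuous_on continuous_intros) simp
  have "norm (?k t) \<le> 2 * ?M ^ m" if "t \<in> {0..}" for t
  proof -
    have "norm (1 - exp (- (of_real t * u))) \<le> ?M"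
      unfolding u_def using that by (intro norm_one_minus_exp_ray_le e s1) simp
    then have "norm (?k t) \<le> ?M ^ m * 2"
      unfolding norm_mult norm_power using u2 by (intro mult_mono power_mono zero_le_power) (auto simp: le_max_iff_disj)
    then show ?thesis by simp
  qed
  from set_integrable_mult_bounded(2)[OF integral_exp_ray(1)[OF R(2)] meas this]
  have "norm (LINT t:{0..}|lborel. exp (- (y * u) * of_real t) * ?k t) \<le> 1 / Re (y * u) * (2 * ?M ^ m)"
    by (simp only: integral_exp_ray(3)[OF R(2)])
  also have "\<dots> \<le> 1 / c * (2 * ?M ^ m)"
    using c y yu by (intro mult_right_mono divide_left_mono) (auto simp: le_max_iff_disj)
  also have "(\<lambda>t. exp (- (y * u) * of_real t) * ?k t) =
      (\<lambda>t. exp (- y * (of_real t * u)) * (1 - exp (- (of_real t * u))) ^ m * u)"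
    by (simp add: mult_ac)
  finally show ?thesis using beta_ray_integral[OF R, of m] by simp
qed

text \<open>
  Supplies one slope for all points of a compact set, as \<open>norm_beta_le\<close> requires; the inequality is
  homogeneous in y and hence passes to \<open>2\<^sup>k y\<close>.
\<close>

lemma compact_slit_plane_ray:
  fixes K :: "complex set"
  assumes "compact K" and "K \<inter> \<real>\<^sub>\<le>\<^sub>0 = {}"
  obtains e c where "0 < e" "e \<le> 1" "c > 0" "\<And>y. y \<in> K \<Longrightarrow> e * Re y + \<bar>Im y\<bar> \<ge> c"
proof -
  obtain d where d: "d > 0" "\<And>y z. y \<in> K \<Longrightarrow> z \<in> \<real>\<^sub>\<le>\<^sub>0 \<Longrightarrow> d \<le> dist y z"
    using separate_compact_closed[OF assms(1) closed_nonpos_Reals_complex assms(2)] by auto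
  obtain B where B: "B > 0" "\<And>y. y \<in> K \<Longrightarrow> norm y \<le> B"
    using compact_imp_bounded[OF assms(1)] by (meson bounded_pos)
  define e where "e = min 1 (d / (2 * B))"
  have e: "0 < e" "e \<le> 1" "e * B \<le> d / 2"
  proof -
    show "0 < e" "e \<le> 1" using d B by (auto simp: e_def)
    have "e * B \<le> d / (2 * B) * B" using B by (intro mult_right_mono) (auto simp: e_def)
    also have "\<dots> = d / 2" using B by simp
    finally show "e * B \<le> d / 2" .
  qed
  show thesis
  proof (rule that[of e "min (e * d) (d / 2)"])
    fix y assume y: "y \<in> K"
    show "min (e * d) (d / 2) \<le> e * Re y + \<bar>Im y\<bar>"
    proof (cases "Re y \<ge> 0")
      case True
      have "d \<le> norm y" using d(2)[OF y, of 0] by simp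
      also have "\<dots> \<le> Re y + \<bar>Im y\<bar>" using cmod_le[of y] True by simp
      finally have "e * d \<le> e * (Re y + \<bar>Im y\<bar>)" using e by simp
      also have "\<dots> \<le> e * Re y + \<bar>Im y\<bar>" using e mult_right_mono[of e 1 "\<bar>Im y\<bar>"] by (simp add: algebra_simps)
      finally show ?thesis by simp
    next
      case False
      have "d \<le> dist y (of_real (Re y))" using False by (intro d(2) y) auto
      also have "\<dots> = \<bar>Im y\<bar>" by (simp add: dist_norm cmod_def)
      finally have 1: "d \<le> \<bar>Im y\<bar>" .
      have "- Re y \<le> B" using B(2)[OF y] abs_Re_le_cmod[of y] by linarith
      then have "e * (- Re y) \<le> e * B" using e by (intro mult_left_mono) auto
      then show ?thesis using 1 e by simp
    qed
  qed (use e d in auto)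
qed

text \<open>
  The quotient of consecutive terms is \<open>m/(y + m)\<close>, which is at most r in modulus once m is large
  compared with the bound of K; the finitely many earlier terms are bounded by compactness.
\<close>

lemma compact_slit_plane_beta_growth:
  fixes K :: "complex set"
  assumes K: "compact K" "K \<inter> \<real>\<^sub>\<le>\<^sub>0 = {}" and r: "r > 1"
  obtains D where "D > 0" "\<And>y m. y \<in> K \<Longrightarrow> norm (fact m / pochhammer y (Suc m)) \<le> D * r ^ m"
proof -
  have nz: "pochhammer y n \<noteq> 0" if "y \<in> K" for y n
  proof
    assume "pochhammer y n = 0"
    then obtain k where "y = - of_nat k" by (auto simp: pochhammer_eq_0_iff)
    then have "y \<in> \<real>\<^sub>\<le>\<^sub>0" by (simp add: complex_nonpos_Reals_iff)
    with that K(2) show False by auto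
  qed
  obtain B where B: "B > 0" "\<And>y. y \<in> K \<Longrightarrow> norm y \<le> B"
    using compact_imp_bounded[OF K(1)] by (meson bounded_pos)
  have "\<exists>b. \<forall>y\<in>K. norm (fact m / pochhammer y (Suc m)) \<le> b" for m
  proof -
    have "compact ((\<lambda>y. fact m / pochhammer y (Suc m)) ` K)"
      by (intro compact_continuous_image K continuous_intros continuous_on_pochhammer') (use nz in auto)
    then show ?thesis by (meson bounded_iff compact_imp_bounded imageI)
  qed
  then obtain b where b: "\<And>m y. y \<in> K \<Longrightarrow> norm (fact m / pochhammer y (Suc m)) \<le> b m" by metis
  \<comment> \<open>for \<open>n > M\<close> this threshold gives \<open>n \<le> r (n - B) \<le> r |y + n|\<close>\<close>
  obtain M :: nat where M: "real M \<ge> B * r / (r - 1)" using real_arch_simple by blast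
  define D where "D = 1 + (\<Sum>m\<le>M. \<bar>b m\<bar>)"
  show thesis
  proof (rule that[of D])
    show "D > 0" unfolding D_def by (intro add_pos_nonneg sum_nonneg) auto
    have small: "norm (fact m / pochhammer y (Suc m)) \<le> D * r ^ m" if "y \<in> K" "m \<le> M" for y m
    proof -
      have "norm (fact m / pochhammer y (Suc m)) \<le> \<bar>b m\<bar>" using b[OF that(1), of m] by linarith
      also have "\<dots> \<le> (\<Sum>m\<le>M. \<bar>b m\<bar>)" using that by (intro member_le_sum) auto
      also have "\<dots> \<le> D" by (simp add: D_def)
      also have "\<dots> \<le> D * r ^ m" using \<open>D > 0\<close> r by simp
      finally show ?thesis .
    qed
    show "norm (fact m / pochhammer y (Suc m)) \<le> D * r ^ m" if "y \<in> K" for y m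
    proof (induction m)
      case 0 then show ?case by (rule small[OF that]) simp
    next
      case (Suc m)
      show ?case
      proof (cases "Suc m \<le> M")
        case True then show ?thesis by (rule small[OF that])
      next
        case False
        define n where "n = real (Suc m)"
        have n: "n \<ge> B * r / (r - 1)" "n > 0" using M False by (auto simp: n_def)
        then have "n * (r - 1) \<ge> B * r" using r by (simp add: field_simps)
        then have "n \<le> r * (n - B)" by (simp add: algebra_simps)
        also have "\<dots> \<le> r * norm (y + of_real n)"
        proof -
          have "n \<le> norm (y + of_real n) + norm y" using norm_triangle_ineq4[of "y + of_real n" y] n by simp
          then show ?thesis using B(2)[OF that] r by simp
        qed
        finally have nr: "n \<le> r * norm (y + of_real n)" .
        then have pos: "norm (y + of_real n) > 0" using n r by (smt (verit) mult_eq_0_iff norm_ge_zero)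
        have "fact (Suc m) / pochhammer y (Suc (Suc m)) =
            (fact m / pochhammer y (Suc m)) * (of_real n / (y + of_real n))"
          by (simp add: pochhammer_rec'[of y "Suc m"] n_def mult_ac add_ac)
        then have "norm (fact (Suc m) / pochhammer y (Suc (Suc m))) =
            norm (fact m / pochhammer y (Suc m)) * (n / norm (y + of_real n))"
          using n by (simp add: norm_mult norm_divide)
        also have "\<dots> \<le> (D * r ^ m) * r"
          using Suc nr pos \<open>D > 0\<close> n r by (intro mult_mono) (auto simp: field_simps)
        finally show ?thesis by (simp add: mult_ac)
      qed
    qed
  qed
qed

section \<open>The dyadic kernel\<close>

text \<open>
  The kernels \<open>1/(e\<^sup>z - 1)\<close> for \<open>k = 0\<close> and \<open>1/(e\<^sup>z + 1)\<close> for \<open>k \<ge> 1\<close> are treated as one family.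
\<close>

definition dyadic_sign :: "nat \<Rightarrow> complex" where
  "dyadic_sign k = (if k = 0 then - 1 else 1)"

lemma norm_dyadic_sign [simp]: "norm (dyadic_sign k) = 1"
  by (simp add: dyadic_sign_def)

text \<open>
  With \<open>w = e\<^sup>-\<^sup>z\<close> the quotient is \<open>(w/(1 + \<sigma>w)) (1 + \<sigma>w)\<^sup>-\<^sup>m\<close>, and \<open>|w| \<le> |1 + \<sigma>w| + 1 \<le> 2 |1 + \<sigma>w|\<close>.
\<close>

lemma geometric_kernel_bound:
  fixes z \<sigma> :: complex
  assumes s: "norm \<sigma> = 1" and R: "R \<ge> 1" "norm (1 + \<sigma> * exp (- z)) \<ge> R"
  shows "norm (exp (z * of_nat m) / (exp z + \<sigma>) ^ Suc m) \<le> 2 * (1 / R) ^ m"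
proof -
  define w where "w = exp (- z)"
  define d where "d = norm (1 + \<sigma> * w)"
  have d: "d \<ge> R" "d > 0" using R by (auto simp: d_def w_def)
  have e: "exp z + \<sigma> = exp z * (1 + \<sigma> * w)"
    by (simp add: w_def algebra_simps exp_add[symmetric])
  have "exp (z * of_nat m) = exp z ^ m"
    by (simp add: exp_of_nat2_mult)
  then have "exp (z * of_nat m) / (exp z + \<sigma>) ^ Suc m = (w / (1 + \<sigma> * w)) * (1 / (1 + \<sigma> * w)) ^ m"
    unfolding e by (simp add: w_def exp_minus power_mult_distrib power_divide divide_simps)
  then have "norm (exp (z * of_nat m) / (exp z + \<sigma>) ^ Suc m) = (norm w / d) * (1 / d) ^ m"
    by (simp add: d_def norm_mult norm_divide norm_power)
  also have "\<dots> \<le> 2 * (1 / R) ^ m"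
  proof (intro mult_mono power_mono)
    have "norm w = norm (\<sigma> * w)" using s by (simp add: norm_mult)
    also have "\<dots> \<le> d + 1" unfolding d_def by (metis add.commute add_diff_cancel_right' norm_one norm_triangle_ineq4)
    also have "\<dots> \<le> 2 * d" using d R by simp
    finally show "norm w / d \<le> 2" using d by (simp add: divide_simps)
  qed (use d R in \<open>auto simp: frac_le\<close>)
  finally show ?thesis .
qed

lemma norm_one_minus_exp_neg_le_1:
  assumes "h \<ge> 0"
  shows "norm (1 - exp (- of_real h) :: complex) \<le> 1"
proof -
  have "(1 - exp (- of_real h) :: complex) = of_real (1 - exp (- h))" by (simp flip: exp_of_real)
  then have "norm (1 - exp (- of_real h) :: complex) = \<bar>1 - exp (- h)\<bar>" by (metis norm_of_real)
  then show ?thesis using assms by simp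
qed

text \<open>
  Because \<open>exp (z - h) + \<sigma> = (e\<^sup>z + \<sigma>) - e\<^sup>z (1 - e\<^sup>-\<^sup>h)\<close>.
\<close>

lemma geometric_kernel_sums:
  fixes z \<sigma> :: complex
  assumes s: "norm \<sigma> = 1" and R: "norm (1 + \<sigma> * exp (- z)) > 1" and h: "h \<ge> 0"
  shows "(\<lambda>m. exp (z * of_nat m) / (exp z + \<sigma>) ^ Suc m * (1 - exp (- of_real h)) ^ m) sums
    (1 / (exp (z - of_real h) + \<sigma>))"
proof -
  define y where "y = 1 - exp (- of_real h :: complex)"
  define r where "r = exp z * y / (exp z + \<sigma>)"
  have e: "exp z + \<sigma> = exp z * (1 + \<sigma> * exp (- z))"
    by (simp add: algebra_simps exp_add[symmetric])
  have nz: "exp z + \<sigma> \<noteq> 0" unfolding e using R by auto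
  have y: "norm y \<le> 1" unfolding y_def by (rule norm_one_minus_exp_neg_le_1[OF h])
  have "r = y / (1 + \<sigma> * exp (- z))" unfolding r_def e by simp
  then have "norm r = norm y / norm (1 + \<sigma> * exp (- z))" by (simp add: norm_divide)
  also have "\<dots> < 1" using y R by (simp add: divide_simps)
  finally have "(\<lambda>m. r ^ m) sums (1 / (1 - r))" by (rule geometric_sums)
  then have "(\<lambda>m. r ^ m * (1 / (exp z + \<sigma>))) sums (1 / (1 - r) * (1 / (exp z + \<sigma>)))"
    by (rule sums_mult2)
  moreover have "1 / (1 - r) * (1 / (exp z + \<sigma>)) = 1 / (exp (z - of_real h) + \<sigma>)"
  proof -
    have "(1 - r) * (exp z + \<sigma>) = exp (z - of_real h) + \<sigma>"
    proof -
      have "r * (exp z + \<sigma>) = exp z * y" using nz by (simp add: r_def)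
      then have "(1 - r) * (exp z + \<sigma>) = exp z * (1 - y) + \<sigma>" by (simp add: algebra_simps)
      also have "exp z * (1 - y) = exp (z - of_real h)"
        unfolding y_def by (simp flip: exp_add)
      finally show ?thesis .
    qed
    then show ?thesis by (metis divide_divide_eq_left mult.right_neutral times_divide_eq_right)
  qed
  moreover have "r ^ m * (1 / (exp z + \<sigma>)) = exp (z * of_nat m) / (exp z + \<sigma>) ^ Suc m * y ^ m" for m
    by (simp add: r_def power_divide power_mult_distrib exp_of_nat2_mult)
  ultimately show ?thesis by (simp add: y_def)
qed

lemma dyadic_partial_fractions:
  fixes v :: complex
  assumes v: "exp v \<noteq> 1"
  shows "(\<Sum>k\<le>N. 1 / 2 ^ k / (exp (v / 2 ^ k) + dyadic_sign k)) = 1 / 2 ^ N / (exp (v / 2 ^ N) - 1)"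
proof (induction N)
  case 0 then show ?case by (simp add: dyadic_sign_def)
next
  case (Suc N)
  define E where "E = exp (v / 2 ^ Suc N)"
  have EE: "exp (v / 2 ^ N) = E * E" unfolding E_def by (simp flip: exp_add)
  have "E ^ (2 ^ Suc N) = exp v" unfolding E_def by (simp flip: exp_of_nat_mult)
  then have "E \<noteq> 1" "E \<noteq> - 1" using v by (auto simp: power_mult)
  then have "E - 1 \<noteq> 0" "E + 1 \<noteq> 0" by (auto simp: add_eq_0_iff2)
  then have "1 / 2 ^ N / (E * E - 1) + 1 / 2 ^ Suc N / (E + 1) = 1 / 2 ^ Suc N / (E - 1)"
  proof -
    have "E * E - 1 = (E - 1) * (E + 1)" by (simp add: algebra_simps)
    then show ?thesis using \<open>E - 1 \<noteq> 0\<close> \<open>E + 1 \<noteq> 0\<close> by (simp add: divide_simps) (simp add: algebra_simps)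
  qed
  then show ?case using Suc by (simp add: EE E_def[symmetric] dyadic_sign_def del: power_Suc)
qed

lemma dyadic_kernel_sums:
  fixes v :: complex
  assumes v: "exp v \<noteq> 1"
  shows "(\<lambda>k. 1 / 2 ^ k / (exp (v / 2 ^ k) + dyadic_sign k)) sums (1 / v)"
proof -
  have v0: "v \<noteq> 0" using v by auto
  have "((\<lambda>z. exp (v * z)) has_field_derivative v) (at 0)"
    by (auto intro!: derivative_eq_intros)
  then have "((\<lambda>h. (exp (v * h) - 1) / h) \<longlongrightarrow> v) (at 0)"
    by (simp add: DERIV_def)
  then have *: "((\<lambda>h. inverse ((exp (v * h) - 1) / h)) \<longlongrightarrow> inverse v) (at 0)"
    by (rule tendsto_inverse[OF _ v0])
  have "(\<lambda>N. (1 / 2 :: complex) ^ N) \<longlonglongrightarrow> 0"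
    by (rule LIMSEQ_power_zero) (simp add: norm_divide)
  then have "filterlim (\<lambda>N. (1 / 2 :: complex) ^ N) (at 0) sequentially"
    by (simp add: filterlim_at)
  from filterlim_compose[OF * this]
  have "(\<lambda>N. 1 / 2 ^ N / (exp (v / 2 ^ N) - 1)) \<longlonglongrightarrow> 1 / v"
    by (simp add: power_divide inverse_eq_divide mult.commute)
  then show ?thesis
    unfolding sums_def_le dyadic_partial_fractions[OF v] .
qed

text \<open>
  If \<open>|e\<^sup>z| \<ge> 1\<close> and \<open>cos (Im z) \<ge> 0\<close>, then \<open>|1 + e\<^sup>z|\<^sup>2 \<ge> 2 + 2 cos (Im z) = 4 cos\<^sup>2(Im z/2)\<close>.
\<close>

lemma norm_one_plus_exp_ge:
  assumes "Re z \<ge> 0" "\<bar>Im z\<bar> \<le> a" "a \<le> pi / 2"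
  shows "2 * cos (a / 2) \<le> norm (1 + exp z)"
proof -
  have c: "cos (Im z) \<ge> 0" using assms by (intro cos_ge_zero) auto
  have r: "norm (exp z) \<ge> 1" using assms(1) by simp
  have Re: "Re (exp z) \<ge> cos (Im z)"
    using c assms(1) mult_right_mono[of 1 "exp (Re z)" "cos (Im z)"] by (simp add: Re_exp)
  have "(2 * cos (a / 2))\<^sup>2 \<le> (2 * cos (Im z / 2))\<^sup>2"
  proof (intro power_mono mult_left_mono)
    have "cos (a / 2) \<le> cos \<bar>Im z / 2\<bar>" using assms by (intro cos_monotone_0_pi_le) auto
    then show "cos (a / 2) \<le> cos (Im z / 2)" by (simp only: cos_abs_real)
    show "0 \<le> 2 * cos (a / 2)" using assms pi_gt_zero by (intro mult_nonneg_nonneg cos_ge_zero) (auto simp: algebra_simps)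
  qed auto
  also have "\<dots> = 2 + 2 * cos (Im z)"
    using cos_double_cos[of "Im z / 2"] by (simp add: power2_eq_square)
  also have "\<dots> \<le> 1 + 2 * Re (exp z) + (norm (exp z))\<^sup>2"
    using Re one_le_power[OF r, of 2] by (simp del: norm_exp_eq_Re Re_exp)
  also have "\<dots> = (norm (1 + exp z))\<^sup>2"
    unfolding cmod_power2 by (simp add: power2_eq_square algebra_simps del: Re_exp Im_exp norm_exp_eq_Re)
  finally show ?thesis by (rule power2_le_imp_le) simp
qed

lemma norm_one_minus_exp_ge:
  assumes "Re z \<ge> 0" and "exp (Re z) - 2 * cos (Im z) \<ge> \<kappa>" and "\<kappa> \<ge> 0"
  shows "sqrt (1 + \<kappa>) \<le> norm (1 - exp z)"
proof (rule real_le_lsqrt)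
  have "(norm (1 - exp z))\<^sup>2 = 1 - 2 * Re (exp z) + (norm (exp z))\<^sup>2"
    unfolding cmod_power2 by (simp add: power2_eq_square algebra_simps del: Re_exp Im_exp norm_exp_eq_Re)
  also have "\<dots> = 1 + exp (Re z) * (exp (Re z) - 2 * cos (Im z))"
    by (simp add: Re_exp power2_eq_square algebra_simps)
  finally have *: "(norm (1 - exp z))\<^sup>2 = 1 + exp (Re z) * (exp (Re z) - 2 * cos (Im z))" .
  have "1 * \<kappa> \<le> exp (Re z) * (exp (Re z) - 2 * cos (Im z))"
    using assms by (intro mult_mono) auto
  then show "1 + \<kappa> \<le> (norm (1 - exp z))\<^sup>2" unfolding * by simp
qed (use assms in auto)

section \<open>The Cauchy kernel of a cut point\<close>

abbreviation polar_point :: "real \<Rightarrow> real \<Rightarrow> complex" where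
  "polar_point \<phi> t \<equiv> 1 + of_real t * cis \<phi>"

definition kernel_coeff :: "complex \<Rightarrow> real \<Rightarrow> nat \<Rightarrow> nat \<Rightarrow> real \<Rightarrow> complex" where
  "kernel_coeff \<beta> \<theta> m k t =
    (let s = polar_point \<theta> t in
       if k = 0 then exp (\<beta> * s * of_nat (m - 1)) / (exp (\<beta> * s) - 1) ^ m
       else exp (\<beta> * s * of_nat (m - 1) / 2 ^ k) / (exp (\<beta> * s / 2 ^ k) + 1) ^ m)"

text \<open>
  A lower bound for \<open>|1 \<plusminus> exp(-\<beta> s/2\<^sup>k)|\<close> along the whole cut, that is, the rate of the geometric
  expansions.
\<close>

definition kernel_radius :: "complex \<Rightarrow> nat \<Rightarrow> real" where
  "kernel_radius \<beta> k =
    (if k = 0 then sqrt (1 + (exp (- Re \<beta>) - 2 * cos (Im \<beta>))) else 2 * cos (pi / 2 ^ Suc k))"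

locale dyadic_direction =
  fixes \<beta> :: complex and b \<theta> :: real
  assumes beta_nonzero: "\<beta> \<noteq> 0" and beta_polar: "\<beta> = of_real (norm \<beta>) * cis b"
    and b_range: "b \<in> {pi / 2 .. 3 * pi / 2}"
    and norm_beta: "norm \<beta> \<le> pi" and beta_gap: "exp (- Re \<beta>) - 2 * cos (Im \<beta>) > 0"
    and theta_range: "\<theta> \<in> {- pi / 2 .. pi / 2}"
    and angles: "\<exists>j::int. b + \<theta> = pi + 2 * pi * of_int j"
begin

abbreviation ray_point :: "real \<Rightarrow> complex" where
  "ray_point \<tau> \<equiv> of_real \<tau> * cis (- b)"

lemma cis_minus_b: "cis (- b) = - cis \<theta>"
proof -
  obtain j :: int where "b + \<theta> = pi + 2 * pi * of_int j" using angles by auto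
  then have "- b = (\<theta> - pi) - 2 * pi * of_int j" by simp
  then have "cis (- b) = cis (\<theta> - pi) / cis (2 * pi * of_int j)" by (simp only: cis_divide)
  then show ?thesis by (simp add: cis_multiple_2pi flip: cis_divide)
qed

lemma beta_cis_minus_b: "\<beta> * cis (- b) = of_real (norm \<beta>)"
  by (subst beta_polar) (simp add: cis_mult)

lemma beta_on_cut: "\<beta> * polar_point \<theta> t = \<beta> - of_real (norm \<beta> * t)"
proof -
  have "\<beta> * cis \<theta> = - of_real (norm \<beta>)" using beta_cis_minus_b unfolding cis_minus_b by (simp add: minus_equation_iff)
  moreover have "\<beta> * (of_real t * cis \<theta>) = of_real t * (\<beta> * cis \<theta>)" by (simp add: mult_ac)
  ultimately have "\<beta> * (of_real t * cis \<theta>) = - of_real (norm \<beta> * t)" by (simp add: mult.commute)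
  then show ?thesis by (simp add: distrib_left)
qed

lemma Re_beta_nonpos: "Re \<beta> \<le> 0"
proof -
  have "cos b \<le> 0"
  proof -
    have "cos (b - pi) \<ge> 0" using b_range by (intro cos_ge_zero) auto
    then show ?thesis by (simp add: cos_diff)
  qed
  moreover have "Re \<beta> = norm \<beta> * cos b" by (subst beta_polar) simp
  ultimately show ?thesis by (simp add: mult_nonneg_nonpos)
qed

lemma Im_beta_le: "\<bar>Im \<beta>\<bar> \<le> pi"
  using norm_beta abs_Im_le_cmod[of \<beta>] by linarith

lemma kernel_coeff_Suc:
  "kernel_coeff \<beta> \<theta> (Suc m) k t =
     exp ((\<beta> - of_real (norm \<beta> * t)) / 2 ^ k * of_nat m) /
     (exp ((\<beta> - of_real (norm \<beta> * t)) / 2 ^ k) + dyadic_sign k) ^ Suc m"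
  unfolding kernel_coeff_def Let_def beta_on_cut by (simp add: dyadic_sign_def)

lemma kernel_radius_le:
  assumes "t \<ge> 0"
  shows "kernel_radius \<beta> k \<le> norm (1 + dyadic_sign k * exp (- ((\<beta> - of_real (norm \<beta> * t)) / 2 ^ k)))"
proof -
  define z where "z = - ((\<beta> - of_real (norm \<beta> * t)) / 2 ^ k)"
  have "z = of_real (1 / 2 ^ k) * (of_real (norm \<beta> * t) - \<beta>)" by (simp add: z_def field_simps)
  then have Rez: "Re z = (norm \<beta> * t - Re \<beta>) / 2 ^ k" and Imz: "Im z = - Im \<beta> / 2 ^ k"
    by (simp_all only: Re_complex_of_real Im_complex_of_real times_complex.sel minus_complex.sel) auto
  have nn: "norm \<beta> * t \<ge> 0" using assms by simp
  have Re0: "Re z \<ge> 0" unfolding Rez using nn Re_beta_nonpos by (intro divide_nonneg_pos) auto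
  show ?thesis
  proof (cases "k = 0")
    case True
    have "exp (- Re \<beta>) \<le> exp (Re z)" using nn True by (simp add: Rez)
    then have "exp (Re z) - 2 * cos (Im z) \<ge> exp (- Re \<beta>) - 2 * cos (Im \<beta>)"
      using True by (simp add: Imz)
    from norm_one_minus_exp_ge[OF Re0 this] beta_gap show ?thesis
      using True by (simp add: kernel_radius_def dyadic_sign_def z_def)
  next
    case False
    have "\<bar>Im z\<bar> \<le> pi / 2 ^ k" unfolding Imz using Im_beta_le by (simp add: divide_right_mono)
    moreover have "pi / 2 ^ k \<le> pi / 2"
    proof -
      have "(2::real) ^ 1 \<le> 2 ^ k" using False by (intro power_increasing) auto
      then show ?thesis by (intro divide_left_mono) auto
    qed
    ultimately have "2 * cos (pi / 2 ^ k / 2) \<le> norm (1 + exp z)"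
      by (intro norm_one_plus_exp_ge Re0)
    then show ?thesis using False by (simp add: kernel_radius_def dyadic_sign_def z_def mult.commute)
  qed
qed

lemma kernel_radius_ge_sqrt2: "k > 0 \<Longrightarrow> kernel_radius \<beta> k \<ge> sqrt 2"
proof -
  assume k: "k > 0"
  have "(2::real) ^ 2 \<le> 2 ^ Suc k" using k by (intro power_increasing) auto
  then have "pi / 2 ^ Suc k \<le> pi / 4" by (intro divide_left_mono) auto
  then have "cos (pi / 4) \<le> cos (pi / 2 ^ Suc k)" by (intro cos_monotone_0_pi_le) auto
  then show ?thesis using k by (simp add: kernel_radius_def cos_45)
qed

lemma kernel_radius_bounded_below:
  obtains R where "R > 1" "\<And>k. R \<le> kernel_radius \<beta> k"
proof (rule that[of "min (kernel_radius \<beta> 0) (sqrt 2)"])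
  show "min (kernel_radius \<beta> 0) (sqrt 2) > 1" using beta_gap by (simp add: kernel_radius_def)
  show "min (kernel_radius \<beta> 0) (sqrt 2) \<le> kernel_radius \<beta> k" for k
    using kernel_radius_ge_sqrt2[of k] by (cases "k = 0") auto
qed

lemma kernel_radius_gt_1: "kernel_radius \<beta> k > 1"
  using kernel_radius_bounded_below by (metis less_le_trans)

lemma norm_kernel_coeff_le:
  assumes "t \<ge> 0"
  shows "norm (kernel_coeff \<beta> \<theta> (Suc m) k t) \<le> 2 * (1 / kernel_radius \<beta> k) ^ m"
  unfolding kernel_coeff_Suc
  by (intro geometric_kernel_bound kernel_radius_le assms norm_dyadic_sign less_imp_le[OF kernel_radius_gt_1])

lemma kernel_coeff_measurable [measurable]: "kernel_coeff \<beta> \<theta> m k \<in> borel_measurable borel"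
  unfolding kernel_coeff_def Let_def by (cases "k = 0")
    (auto intro!: borel_measurable_divide borel_measurable_power borel_measurable_continuous_onI continuous_intros
      simp del: times_divide_eq_right)

lemma summable_dyadic_geometric:
  fixes r :: real
  assumes "0 \<le> r" "r < 1"
  shows "(\<lambda>(k, m). (1 / 2) ^ k * r ^ m) summable_on (UNIV :: (nat \<times> nat) set)"
proof -
  have r: "((\<lambda>m. r ^ m) has_sum (1 / (1 - r))) UNIV"
    using assms by (intro norm_summable_imp_has_sum geometric_sums) (auto simp: norm_power summable_geometric)
  have h: "((\<lambda>k. (1 / 2) ^ k) has_sum (1 / (1 - 1 / 2 :: real))) UNIV"
    by (intro norm_summable_imp_has_sum geometric_sums) (auto simp: norm_power summable_geometric)
  have "(\<lambda>(k, m). (1 / 2) ^ k * r ^ m) summable_on (UNIV \<times> UNIV :: (nat \<times> nat) set)"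
  proof (rule summable_on_SigmaI[where g = "\<lambda>k. (1 / 2) ^ k * (1 / (1 - r))"])
    show "((\<lambda>m. case (k, m) of (k, m) \<Rightarrow> (1 / 2) ^ k * r ^ m) has_sum (1 / 2) ^ k * (1 / (1 - r))) UNIV" for k
      using has_sum_cmult_right[OF r] by simp
    show "(\<lambda>k. (1 / 2) ^ k * (1 / (1 - r))) summable_on UNIV"
      by (intro summable_on_cmult_left has_sum_imp_summable[OF h])
  qed (use assms in auto)
  then show ?thesis by simp
qed

definition ray_factor :: "nat \<Rightarrow> nat \<Rightarrow> real \<Rightarrow> complex" where
  "ray_factor m k \<tau> = \<beta> / 2 ^ k * (1 - exp (- of_real (norm \<beta> * \<tau> / 2 ^ k))) ^ m"

lemma norm_dyadic_kernel_term_le: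
  assumes R: "R > 1" "\<And>k. R \<le> kernel_radius \<beta> k" and t: "t \<ge> 0" and \<tau>: "\<tau> \<ge> 0"
  shows "norm (kernel_coeff \<beta> \<theta> (Suc m) k t * ray_factor m k \<tau>) \<le> 2 * norm \<beta> * ((1 / 2) ^ k * (1 / R) ^ m)"
proof -
  have y: "norm (1 - exp (- of_real (norm \<beta> * \<tau> / 2 ^ k)) :: complex) \<le> 1"
    using \<tau> by (intro norm_one_minus_exp_neg_le_1) auto
  have "norm (ray_factor m k \<tau>) \<le> norm \<beta> / 2 ^ k * 1"
    unfolding ray_factor_def norm_mult norm_power
    by (intro mult_mono power_le_one y) (auto simp: norm_divide norm_power)
  moreover have "norm (kernel_coeff \<beta> \<theta> (Suc m) k t) \<le> 2 * (1 / R) ^ m"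
  proof (rule order_trans[OF norm_kernel_coeff_le[OF t]])
    show "2 * (1 / kernel_radius \<beta> k) ^ m \<le> 2 * (1 / R) ^ m"
      using R kernel_radius_gt_1[of k] by (intro mult_left_mono power_mono divide_left_mono mult_pos_pos) auto
  qed
  ultimately have "norm (kernel_coeff \<beta> \<theta> (Suc m) k t * ray_factor m k \<tau>) \<le> 2 * (1 / R) ^ m * (norm \<beta> / 2 ^ k * 1)"
    unfolding norm_mult using R by (intro mult_mono) auto
  then show ?thesis by (simp add: power_divide mult_ac)
qed

text \<open>
  The right-hand side is \<open>\<beta>/v\<close> with \<open>v = \<beta> (s - p)\<close>. The rows are summed by \<open>geometric_kernel_sums\<close> and
  the row sums by \<open>dyadic_kernel_sums\<close>; \<open>norm_dyadic_kernel_term_le\<close> makes the double series absolutely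
  convergent. Shifting t by \<tau> turns v into \<beta> times a cut point, so \<open>e\<^sup>v \<noteq> 1\<close> is already known.
\<close>

lemma dyadic_kernel_has_sum:
  assumes t: "t \<ge> 0" and \<tau>: "\<tau> \<ge> 0"
  shows "((\<lambda>(k, m). kernel_coeff \<beta> \<theta> (Suc m) k t * ray_factor m k \<tau>)
    has_sum (1 / (polar_point \<theta> t - ray_point \<tau>))) UNIV"
proof -
  define v where "v = \<beta> - of_real (norm \<beta> * (t + \<tau>))"
  define f where "f = (\<lambda>k m. kernel_coeff \<beta> \<theta> (Suc m) k t * ray_factor m k \<tau>)"
  obtain R where R: "R > 1" "\<And>k. R \<le> kernel_radius \<beta> k" using kernel_radius_bounded_below by blast
  have "norm (1 + dyadic_sign 0 * exp (- (v / 2 ^ 0))) > 1"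
    using kernel_radius_le[of "t + \<tau>" 0] kernel_radius_gt_1[of 0] t \<tau> unfolding v_def by simp
  then have ev: "exp v \<noteq> 1" by (auto simp: dyadic_sign_def exp_minus)
  have sm: "(\<lambda>(k, m). f k m) summable_on UNIV"
  proof (rule Infinite_Sum.abs_summable_summable, rule Infinite_Sum.abs_summable_on_comparison_test')
    show "(\<lambda>x. 2 * norm \<beta> * (case x of (k, m) \<Rightarrow> (1 / 2) ^ k * (1 / R) ^ m)) summable_on UNIV"
      using R by (intro summable_on_cmult_right summable_dyadic_geometric) auto
    show "norm (case x of (k, m) \<Rightarrow> f k m) \<le> 2 * norm \<beta> * (case x of (k, m) \<Rightarrow> (1 / 2) ^ k * (1 / R) ^ m)" for x
      using norm_dyadic_kernel_term_le[OF R t \<tau>] by (cases x) (simp add: f_def)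
  qed
  have inner: "(f k has_sum (\<beta> * (1 / 2 ^ k / (exp (v / 2 ^ k) + dyadic_sign k)))) UNIV" for k
  proof -
    let ?z = "(\<beta> - of_real (norm \<beta> * t)) / 2 ^ k"
    have zv: "?z - of_real (norm \<beta> * \<tau> / 2 ^ k) = v / 2 ^ k"
      by (simp add: v_def field_simps)
    have "(\<lambda>m. kernel_coeff \<beta> \<theta> (Suc m) k t * (1 - exp (- of_real (norm \<beta> * \<tau> / 2 ^ k))) ^ m) sums
       (1 / (exp (v / 2 ^ k) + dyadic_sign k))"
      unfolding kernel_coeff_Suc zv[symmetric] using kernel_radius_le[OF t, of k] kernel_radius_gt_1[of k] \<tau>
      by (intro geometric_kernel_sums) auto
    from sums_mult[OF this, of "\<beta> / 2 ^ k"]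
    have s: "f k sums (\<beta> / 2 ^ k * (1 / (exp (v / 2 ^ k) + dyadic_sign k)))"
      unfolding f_def ray_factor_def by (simp only: mult_ac)
    have "f k summable_on UNIV"
      using summable_on_SigmaD1[of f UNIV "\<lambda>_. UNIV" k] sm by simp
    then have h: "(f k has_sum infsum (f k) UNIV) UNIV" by (rule has_sum_infsum)
    from sums_unique2[OF has_sum_imp_sums[OF h] s] h show ?thesis by simp
  qed
  define S where "S = infsum (\<lambda>(k, m). f k m) UNIV"
  have S: "((\<lambda>(k, m). f k m) has_sum S) (UNIV \<times> UNIV)" using sm by (simp add: S_def)
  have "((\<lambda>k. \<beta> * (1 / 2 ^ k / (exp (v / 2 ^ k) + dyadic_sign k))) has_sum S) UNIV"
    using has_sum_SigmaD[OF S] inner by (auto)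
  then have "(\<lambda>k. \<beta> * (1 / 2 ^ k / (exp (v / 2 ^ k) + dyadic_sign k))) sums S"
    by (rule has_sum_imp_sums)
  moreover have "(\<lambda>k. \<beta> * (1 / 2 ^ k / (exp (v / 2 ^ k) + dyadic_sign k))) sums (\<beta> * (1 / v))"
    by (intro sums_mult dyadic_kernel_sums ev)
  ultimately have "S = \<beta> * (1 / v)" by (rule sums_unique2)
  also have "v = \<beta> * (polar_point \<theta> t - ray_point \<tau>)"
    using beta_on_cut[of "t + \<tau>"] unfolding v_def cis_minus_b by (simp add: algebra_simps)
  then have "\<beta> * (1 / v) = 1 / (polar_point \<theta> t - ray_point \<tau>)"
    using beta_nonzero by simp
  finally show ?thesis using S unfolding f_def by simp
qed

end

section \<open>Convergence of the dyadic series\<close>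

lemma pole_ray_iff:
  assumes "\<beta> \<noteq> 0"
  shows "x \<in> pole_ray \<beta> \<longleftrightarrow> x / \<beta> \<in> \<real>\<^sub>\<le>\<^sub>0"
proof
  assume "x \<in> pole_ray \<beta>"
  then show "x / \<beta> \<in> \<real>\<^sub>\<le>\<^sub>0" using assms by (auto simp: pole_ray_def)
next
  assume "x / \<beta> \<in> \<real>\<^sub>\<le>\<^sub>0"
  then obtain t where "t \<le> 0" "x / \<beta> = of_real t" by (auto simp: nonpos_Reals_def)
  then have "x = \<beta> * of_real t" using assms by (simp add: field_simps)
  with \<open>t \<le> 0\<close> show "x \<in> pole_ray \<beta>" by (auto simp: pole_ray_def)
qed

lemma pole_ray_eq_vimage: "\<beta> \<noteq> 0 \<Longrightarrow> - pole_ray \<beta> = (\<lambda>x. x / \<beta>) -` (- \<real>\<^sub>\<le>\<^sub>0)"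
  using pole_ray_iff by auto

lemma open_slit_plane:
  assumes "\<beta> \<noteq> 0"
  shows "open (- pole_ray \<beta>)"
  unfolding pole_ray_eq_vimage[OF assms]
  by (intro open_vimage continuous_intros) (auto simp: assms closed_nonpos_Reals_complex)

lemma connected_slit_plane:
  assumes "\<beta> \<noteq> 0"
  shows "connected (- pole_ray \<beta>)"
proof -
  have "(\<real>\<^sub>\<le>\<^sub>0 :: complex set) = complex_of_real ` {..0}" by (auto simp: nonpos_Reals_def)
  then have "connected (- \<real>\<^sub>\<le>\<^sub>0 :: complex set)"
    using starlike_imp_connected[OF starlike_slotted_complex_plane_left[of 0]] by simp
  then have "connected ((\<lambda>z. \<beta> * z) ` (- \<real>\<^sub>\<le>\<^sub>0))"
    by (intro connected_continuous_image continuous_intros)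
  also have "(\<lambda>z. \<beta> * z) ` (- \<real>\<^sub>\<le>\<^sub>0) = - pole_ray \<beta>"
    unfolding pole_ray_eq_vimage[OF assms] using assms
    by (auto simp: image_iff intro!: bexI[of _ "_ / \<beta>"])
  finally show ?thesis .
qed

lemma pochhammer_slit_nonzero:
  assumes "\<beta> \<noteq> 0" "x \<notin> pole_ray \<beta>"
  shows "pochhammer (2 ^ k * x / \<beta>) m \<noteq> 0"
proof
  assume "pochhammer (2 ^ k * x / \<beta>) m = 0"
  then obtain j where "2 ^ k * x / \<beta> = - of_nat j" by (auto simp: pochhammer_eq_0_iff)
  then have "x / \<beta> = of_real (- (real j / 2 ^ k))" by (simp add: field_simps)
  then have "x / \<beta> \<in> \<real>\<^sub>\<le>\<^sub>0" by (simp only: nonpos_Reals_of_real_iff) simp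
  with assms show False by (simp add: pole_ray_iff)
qed

lemma holomorphic_dyadic_term:
  assumes "\<beta> \<noteq> 0"
  shows "dyadic_term \<beta> \<theta> F m k holomorphic_on (- pole_ray \<beta>)"
proof -
  have "(\<lambda>x. pochhammer (2 ^ k * x / \<beta>) m) holomorphic_on (- pole_ray \<beta>)"
    unfolding pochhammer_prod by (intro holomorphic_intros) (use assms in auto)
  then show ?thesis
    unfolding dyadic_term_def[abs_def] using pochhammer_slit_nonzero[OF assms]
    by (intro holomorphic_intros) auto
qed

text \<open>
  Index pairs are \<open>(k, m)\<close> with m shifted to start at 0. As these index sets exhaust all pairs, every
  statement about partial sums reduces to unconditional summation over pairs.
\<close>

lemma filterlim_dyadic_rectangles:
  "filterlim (\<lambda>(n, N, l). {0} \<times> {..<n} \<union> {1..<N} \<times> {..<l}) (finite_subsets_at_top UNIV)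
     (sequentially \<times>\<^sub>F sequentially \<times>\<^sub>F sequentially)"
proof (rule filterlim_finite_subsets_at_top[THEN iffD2], intro allI impI)
  fix X :: "(nat \<times> nat) set"
  assume X: "finite X \<and> X \<subseteq> UNIV"
  define B where "B = Suc (Max (insert 0 (fst ` X \<union> snd ` X)))"
  have B: "k < B" "m < B" if "(k, m) \<in> X" for k m
  proof -
    have "k \<le> Max (insert 0 (fst ` X \<union> snd ` X))" "m \<le> Max (insert 0 (fst ` X \<union> snd ` X))"
      using X that by (auto intro!: Max_ge intro: rev_image_eqI)
    then show "k < B" "m < B" by (auto simp: B_def)
  qed
  have "\<forall>\<^sub>F p in sequentially \<times>\<^sub>F sequentially \<times>\<^sub>F sequentially. B \<le> fst p \<and> B \<le> fst (snd p) \<and> B \<le> snd (snd p)"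
  proof -
    have "\<forall>\<^sub>F p in sequentially \<times>\<^sub>F sequentially. B \<le> fst p \<and> B \<le> snd p"
      unfolding eventually_prod_filter
      by (rule exI[of _ "\<lambda>n. n \<ge> B"], rule exI[of _ "\<lambda>n. n \<ge> B"]) (simp add: eventually_ge_at_top)
    then show ?thesis
      by (subst eventually_prod_filter,
          intro exI[of _ "\<lambda>n. n \<ge> B"] exI[of _ "\<lambda>p. B \<le> fst p \<and> B \<le> snd p"])
         (simp add: eventually_ge_at_top)
  qed
  then show "\<forall>\<^sub>F p in sequentially \<times>\<^sub>F sequentially \<times>\<^sub>F sequentially.
      finite (case p of (n, N, l) \<Rightarrow> {0} \<times> {..<n} \<union> {1..<N} \<times> {..<l}) \<and>
      X \<subseteq> (case p of (n, N, l) \<Rightarrow> {0} \<times> {..<n} \<union> {1..<N} \<times> {..<l}) \<and>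
      (case p of (n, N, l) \<Rightarrow> {0} \<times> {..<n} \<union> {1..<N} \<times> {..<l}) \<subseteq> UNIV"
    by (rule eventually_mono) (use B in \<open>force\<close>)
qed

lemma dyadic_partial_sum_eq:
  "dyadic_partial_sum \<beta> \<theta> F n N l x =
    (\<Sum>(k, m)\<in>{0} \<times> {..<n} \<union> {1..<N} \<times> {..<l}. dyadic_term \<beta> \<theta> F (Suc m) k x)"
proof -
  have shift: "(\<Sum>m=1..n. g m) = (\<Sum>m<n. g (Suc m))" for n and g :: "nat \<Rightarrow> complex"
    by (simp add: sum.atLeast1_atMost_eq)
  show ?thesis
    unfolding dyadic_partial_sum_def shift
    by (subst sum.union_disjoint) (auto simp flip: sum.cartesian_product)
qed

lemma dyadic_coeff_eq:
  "dyadic_coeff \<beta> \<theta> F m k = cis \<theta> / (2 * of_real pi * \<i>) *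
     (LINT t:{0<..}|lborel. jump F \<theta> t * kernel_coeff \<beta> \<theta> m k t)"
  by (simp add: dyadic_coeff_def kernel_coeff_def)

locale dyadic_data = dyadic_direction +
  fixes F :: "complex \<Rightarrow> complex"
  assumes jump_integrable: "set_integrable lborel {0<..} (jump F \<theta>)"
begin

lemma integrable_jump_kernel_coeff:
  shows "set_integrable lborel {0<..} (\<lambda>t. jump F \<theta> t * kernel_coeff \<beta> \<theta> (Suc m) k t)"
    and "norm (dyadic_coeff \<beta> \<theta> F (Suc m) k) \<le>
      (LINT t:{0<..}|lborel. norm (jump F \<theta> t)) * (1 / kernel_radius \<beta> k) ^ m"
proof -
  let ?q = "(1 / kernel_radius \<beta> k) ^ m" and ?A = "LINT t:{0<..}|lborel. norm (jump F \<theta> t)"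
  have "kernel_coeff \<beta> \<theta> (Suc m) k \<in> borel_measurable borel" by (rule kernel_coeff_measurable)
  then have M: "set_borel_measurable lborel {0<..} (kernel_coeff \<beta> \<theta> (Suc m) k)"
    unfolding set_borel_measurable_def by measurable
  note I = set_integrable_mult_bounded[OF jump_integrable M norm_kernel_coeff_le]
  show "set_integrable lborel {0<..} (\<lambda>t. jump F \<theta> t * kernel_coeff \<beta> \<theta> (Suc m) k t)"
    by (rule I(1)) auto
  have n: "norm (LINT t:{0<..}|lborel. jump F \<theta> t * kernel_coeff \<beta> \<theta> (Suc m) k t) \<le> ?A * (2 * ?q)"
    by (rule I(2)) auto
  have "norm (dyadic_coeff \<beta> \<theta> F (Suc m) k) \<le> 1 / (2 * pi) * (?A * (2 * ?q))"
    unfolding dyadic_coeff_eq norm_mult by (intro mult_mono n) (auto simp: norm_divide norm_mult)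
  also have "\<dots> = 1 / pi * (?A * ?q)" by simp
  also have "\<dots> \<le> 1 * (?A * ?q)"
    using kernel_radius_gt_1[of k] pi_ge_two
    by (intro mult_right_mono mult_nonneg_nonneg set_integral_norm_nonneg) auto
  finally show "norm (dyadic_coeff \<beta> \<theta> F (Suc m) k) \<le> ?A * ?q" by simp
qed

lemma kernel_radius_tendsto_2: "kernel_radius \<beta> \<longlonglongrightarrow> 2"
proof (rule Lim_transform_eventually)
  have "(\<lambda>k. pi * (1 / 2) ^ Suc k) \<longlonglongrightarrow> pi * 0"
    by (intro tendsto_mult tendsto_const LIMSEQ_Suc LIMSEQ_power_zero) auto
  then have "(\<lambda>k. 2 * cos (pi * (1 / 2) ^ Suc k)) \<longlonglongrightarrow> 2 * cos (pi * 0)"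
    by (rule tendsto_mult[OF tendsto_const tendsto_cos])
  then show "(\<lambda>k. 2 * cos (pi * (1 / 2) ^ Suc k)) \<longlonglongrightarrow> 2" by simp
  show "\<forall>\<^sub>F k in sequentially. 2 * cos (pi * (1 / 2) ^ Suc k) = kernel_radius \<beta> k"
    using eventually_gt_at_top[of 0] by eventually_elim (simp add: kernel_radius_def power_divide)
qed

text \<open>
  Three rates compete: R bounds all kernel radii from below, \<open>r0 < R\<close> is the growth allowed to the Beta
  factor for the finitely many \<open>k < k0\<close>, and \<open>R1\<close> lies strictly between the rate \<open>M < 2\<close> of the rotated
  integral and the limit 2 of the radii.
\<close>

lemma dyadic_term_bound:
  assumes K: "compact K" "K \<subseteq> - pole_ray \<beta>"
  obtains D r where "D \<ge> 0" "0 \<le> r" "r < 1"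
    "\<And>x k m. x \<in> K \<Longrightarrow> norm (dyadic_term \<beta> \<theta> F (Suc m) k x) \<le> D * ((1 / 2) ^ k * r ^ m)"
proof -
  define A where "A = (LINT t:{0<..}|lborel. norm (jump F \<theta> t))"
  have A0: "A \<ge> 0" unfolding A_def by (rule set_integral_norm_nonneg)
  define L where "L = (\<lambda>x. x / \<beta>) ` K"
  have L: "compact L" "L \<inter> \<real>\<^sub>\<le>\<^sub>0 = {}"
    using K beta_nonzero unfolding L_def
    by (auto intro!: compact_continuous_image continuous_intros simp: pole_ray_iff)
  obtain e c where ec: "0 < e" "e \<le> 1" "c > 0" "\<And>y. y \<in> L \<Longrightarrow> e * Re y + \<bar>Im y\<bar> \<ge> c"
    using compact_slit_plane_ray[OF L] by blast
  define M where "M = max (sqrt 2) (1 + exp (- e))"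
  have "sqrt 2 < 2" by (rule real_less_lsqrt) auto
  then have M: "1 \<le> M" "M < 2" using ec by (auto simp: M_def le_max_iff_disj)
  define R1 where "R1 = (M + 2) / 2"
  have R1: "M < R1" "R1 < 2" "R1 > 1" using M by (auto simp: R1_def)
  have "\<forall>\<^sub>F k in sequentially. R1 < kernel_radius \<beta> k"
    using kernel_radius_tendsto_2 R1(2) by (rule order_tendstoD)
  then obtain k0 where k0: "\<And>k. k \<ge> k0 \<Longrightarrow> R1 < kernel_radius \<beta> k" by (auto simp: eventually_sequentially)
  obtain R where R: "R > 1" "\<And>k. R \<le> kernel_radius \<beta> k" using kernel_radius_bounded_below by blast
  define r0 where "r0 = (1 + R) / 2"
  have r0: "r0 > 1" "r0 < R" using R by (auto simp: r0_def)
  have "\<exists>D>0. \<forall>y\<in>L. \<forall>m. norm (fact m / pochhammer (2 ^ k * y) (Suc m)) \<le> D * r0 ^ m" for k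
  proof -
    have Lk: "compact ((\<lambda>y. 2 ^ k * y) ` L)"
      by (intro compact_continuous_image L continuous_intros)
    have "(\<lambda>y. 2 ^ k * y) ` L \<inter> \<real>\<^sub>\<le>\<^sub>0 = {}"
    proof -
      have "y \<in> \<real>\<^sub>\<le>\<^sub>0" if "2 ^ k * y \<in> \<real>\<^sub>\<le>\<^sub>0" for y :: complex
      proof -
        obtain t where "t \<le> 0" "2 ^ k * y = of_real t" using \<open>2 ^ k * y \<in> \<real>\<^sub>\<le>\<^sub>0\<close> by (auto simp: nonpos_Reals_def)
        then have "y = of_real (t / 2 ^ k)" "t / 2 ^ k \<le> 0" by (auto simp: field_simps)
        then show ?thesis by (simp only: nonpos_Reals_of_real_iff)
      qed
      then show ?thesis using L(2) by auto
    qed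
    from compact_slit_plane_beta_growth[OF Lk this r0(1)] show ?thesis
      by (metis image_eqI)
  qed
  then obtain E where E: "\<And>k. E k > 0"
    "\<And>k y m. y \<in> L \<Longrightarrow> norm (fact m / pochhammer (2 ^ k * y) (Suc m)) \<le> E k * r0 ^ m" by metis
  define r where "r = max (M / R1) (r0 / R)"
  have r: "0 \<le> r" "r < 1" "M / R1 \<le> r" "r0 / R \<le> r" using R R1 r0 M by (auto simp: r_def le_max_iff_disj)
  \<comment> \<open>the factor \<open>2 ^ k\<close> undoes \<open>(1 / 2) ^ k\<close> in the finitely many rows \<open>k < k0\<close>\<close>
  define D where "D = 2 * A / c + (\<Sum>k<k0. E k * A * 2 ^ k)"
  have D2: "D \<ge> E k * A * 2 ^ k" if "k < k0" for k
  proof -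
    have "E k * A * 2 ^ k \<le> (\<Sum>k<k0. E k * A * 2 ^ k)"
      using that A0 E(1) by (intro member_le_sum) (auto simp: less_imp_le)
    moreover have "2 * A / c \<ge> 0" using A0 ec by simp
    ultimately show ?thesis by (simp add: D_def)
  qed
  have D1: "D \<ge> 2 * A / c"
    unfolding D_def using A0 E(1) by (simp add: sum_nonneg less_imp_le)
  have D0: "D \<ge> 0" using D1 A0 ec by (meson divide_nonneg_pos mult_nonneg_nonneg order_trans zero_le_numeral)
  have "norm (dyadic_term \<beta> \<theta> F (Suc m) k x) \<le> D * ((1 / 2) ^ k * r ^ m)" if x: "x \<in> K" for x k m
  proof -
    define y where "y = x / \<beta>"
    have y: "y \<in> L" using x by (auto simp: L_def y_def)
    have "norm (dyadic_term \<beta> \<theta> F (Suc m) k x) =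
        norm (fact m / pochhammer (2 ^ k * y) (Suc m)) * norm (dyadic_coeff \<beta> \<theta> F (Suc m) k)"
      by (simp add: dyadic_term_def y_def norm_mult norm_divide)
    also have "\<dots> \<le> norm (fact m / pochhammer (2 ^ k * y) (Suc m)) * (A * (1 / kernel_radius \<beta> k) ^ m)"
      unfolding A_def by (intro mult_left_mono integrable_jump_kernel_coeff(2)) auto
    also have "\<dots> \<le> D * ((1 / 2) ^ k * r ^ m)"
    proof (cases "k < k0")
      case True
      have "norm (fact m / pochhammer (2 ^ k * y) (Suc m)) * (A * (1 / kernel_radius \<beta> k) ^ m)
          \<le> (E k * r0 ^ m) * (A * (1 / R) ^ m)"
        using R(1) R(2)[of k] A0 E r0
        by (intro mult_mono E(2) y mult_left_mono power_mono divide_left_mono) (auto intro!: mult_nonneg_nonneg simp: less_imp_le)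
      also have "\<dots> = (E k * A * 2 ^ k) * ((1 / 2) ^ k * (r0 / R) ^ m)"
        by (simp add: power_divide)
      also have "\<dots> \<le> D * ((1 / 2) ^ k * r ^ m)"
        using D2[OF True] D0 r r0 R by (intro mult_mono power_mono) auto
      finally show ?thesis .
    next
      case False
      have "e * Re (2 ^ k * y) + \<bar>Im (2 ^ k * y)\<bar> = 2 ^ k * (e * Re y + \<bar>Im y\<bar>)"
      proof -
        have "(2 ^ k * y) = of_real (2 ^ k) * y" by simp
        then have "Re (2 ^ k * y) = 2 ^ k * Re y" "Im (2 ^ k * y) = 2 ^ k * Im y"
          by (simp_all only: Re_complex_of_real Im_complex_of_real times_complex.sel)
        then show ?thesis by (simp add: abs_mult algebra_simps)
      qed
      then have "2 ^ k * c \<le> e * Re (2 ^ k * y) + \<bar>Im (2 ^ k * y)\<bar>" using ec(4)[OF y] by simp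
      from norm_beta_le[OF ec(1,2) _ this, of m] ec(3)
      have "norm (fact m / pochhammer (2 ^ k * y) (Suc m)) \<le> 2 * M ^ m / (2 ^ k * c)" by (simp add: M_def)
      then have "norm (fact m / pochhammer (2 ^ k * y) (Suc m)) * (A * (1 / kernel_radius \<beta> k) ^ m)
          \<le> (2 * M ^ m / (2 ^ k * c)) * (A * (1 / R1) ^ m)"
        using k0[of k] False R1 A0 ec(3) M
        by (intro mult_mono mult_left_mono power_mono divide_left_mono) (auto intro!: mult_nonneg_nonneg)
      also have "\<dots> = (2 * A / c) * ((1 / 2) ^ k * (M / R1) ^ m)"
        by (simp add: power_divide mult_ac)
      also have "\<dots> \<le> D * ((1 / 2) ^ k * r ^ m)"
        using D1 D0 r R1 M by (intro mult_mono power_mono) auto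
      finally show ?thesis .
    qed
    finally show ?thesis .
  qed
  with D0 r(1,2) show thesis by (rule that)
qed

end

context dyadic_data
begin

abbreviation dyadic_block :: "(nat \<times> nat) set \<Rightarrow> complex \<Rightarrow> complex" where
  "dyadic_block X x \<equiv> \<Sum>(k, m)\<in>X. dyadic_term \<beta> \<theta> F (Suc m) k x"

definition dyadic_sum :: "complex \<Rightarrow> complex" where
  "dyadic_sum x = (\<Sum>\<^sub>\<infinity>(k, m). dyadic_term \<beta> \<theta> F (Suc m) k x)"

lemma dyadic_terms_summable:
  assumes x: "x \<notin> pole_ray \<beta>"
  shows "(\<lambda>(k, m). dyadic_term \<beta> \<theta> F (Suc m) k x) summable_on UNIV"
proof -
  have "{x} \<subseteq> - pole_ray \<beta>" using x by simp
  from dyadic_term_bound[OF compact_sing this] obtain D r where D: "D \<ge> 0" "0 \<le> r" "r < 1"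
    "\<And>y k m. y \<in> {x} \<Longrightarrow> norm (dyadic_term \<beta> \<theta> F (Suc m) k y) \<le> D * ((1 / 2) ^ k * r ^ m)"
    by blast
  show ?thesis
  proof (rule Infinite_Sum.abs_summable_summable, rule Infinite_Sum.abs_summable_on_comparison_test')
    show "(\<lambda>p. D * (case p of (k, m) \<Rightarrow> (1 / 2) ^ k * r ^ m)) summable_on UNIV"
      using D by (intro summable_on_cmult_right summable_dyadic_geometric) auto
    show "norm (case p of (k, m) \<Rightarrow> dyadic_term \<beta> \<theta> F (Suc m) k x) \<le> D * (case p of (k, m) \<Rightarrow> (1 / 2) ^ k * r ^ m)" for p
      using D(4)[OF singletonI] by (cases p) simp
  qed
qed

lemma uniform_limit_dyadic_sum:
  assumes K: "compact K" "K \<subseteq> - pole_ray \<beta>"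
  shows "uniform_limit K dyadic_block dyadic_sum
    (finite_subsets_at_top UNIV)"
proof -
  obtain D r where D: "D \<ge> 0" "0 \<le> r" "r < 1"
    "\<And>x k m. x \<in> K \<Longrightarrow> norm (dyadic_term \<beta> \<theta> F (Suc m) k x) \<le> D * ((1 / 2) ^ k * r ^ m)"
    using dyadic_term_bound[OF K] by blast
  have "uniform_limit K (\<lambda>X x. \<Sum>p\<in>X. (\<lambda>p x. case p of (k, m) \<Rightarrow> dyadic_term \<beta> \<theta> F (Suc m) k x) p x)
      (\<lambda>x. \<Sum>\<^sub>\<infinity>p\<in>UNIV. (\<lambda>p x. case p of (k, m) \<Rightarrow> dyadic_term \<beta> \<theta> F (Suc m) k x) p x) (finite_subsets_at_top UNIV)"
  proof (rule Weierstrass_m_test_general)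
    show "(\<lambda>p. D * (case p of (k, m) \<Rightarrow> (1 / 2) ^ k * r ^ m)) summable_on UNIV"
      using D by (intro summable_on_cmult_right summable_dyadic_geometric) auto
    show "norm (case p of (k, m) \<Rightarrow> dyadic_term \<beta> \<theta> F (Suc m) k x) \<le> D * (case p of (k, m) \<Rightarrow> (1 / 2) ^ k * r ^ m)"
      if "x \<in> K" for p x
      using D(4)[OF that] by (cases p) simp
  qed
  then show ?thesis by (simp add: dyadic_sum_def[abs_def])
qed

lemma uniform_limit_dyadic_partial_sum:
  assumes "compact K" "K \<subseteq> - pole_ray \<beta>"
  shows "uniform_limit K (\<lambda>(n, N, l). dyadic_partial_sum \<beta> \<theta> F n N l) dyadic_sum
    (sequentially \<times>\<^sub>F sequentially \<times>\<^sub>F sequentially)"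
proof -
  have "(\<lambda>(n, N, l). dyadic_partial_sum \<beta> \<theta> F n N l) =
     dyadic_block \<circ> (\<lambda>(n, N, l). {0} \<times> {..<n} \<union> {1..<N} \<times> {..<l})"
    by (auto simp: fun_eq_iff dyadic_partial_sum_eq)
  then show ?thesis
    using filterlim_compose[OF uniform_limit_dyadic_sum[OF assms] filterlim_dyadic_rectangles]
    by (simp add: comp_def)
qed

lemma holomorphic_dyadic_sum:
  shows "dyadic_sum holomorphic_on (- pole_ray \<beta>)"
proof -
  let ?U = "- pole_ray \<beta>"
  have opn: "open ?U" using open_slit_plane[OF beta_nonzero] .
  have hol_term: "dyadic_term \<beta> \<theta> F m k holomorphic_on ?U" for m k
    by (rule holomorphic_dyadic_term[OF beta_nonzero])
  have "\<exists>e>0. dyadic_sum holomorphic_on ball z e" if z: "z \<in> ?U" for z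
  proof -
    obtain e where e: "e > 0" "cball z e \<subseteq> ?U" using opn z open_contains_cball by blast
    have "dyadic_sum holomorphic_on ball z e"
    proof (rule holomorphic_uniform_limit)
      have hol: "dyadic_block X holomorphic_on ?U" for X
        unfolding split_def by (intro holomorphic_on_sum hol_term)
      show "\<forall>\<^sub>F X in finite_subsets_at_top UNIV.
          continuous_on (cball z e) (dyadic_block X) \<and>
          dyadic_block X holomorphic_on ball z e"
        using hol e(2) ball_subset_cball[of z e]
        by (intro always_eventually allI conjI)
           (meson holomorphic_on_imp_continuous_on holomorphic_on_subset order_trans)+
      show "uniform_limit (cball z e) dyadic_block dyadic_sum
        (finite_subsets_at_top UNIV)"
        by (rule uniform_limit_dyadic_sum[OF _ e(2)]) simp
    qed auto
    with e show ?thesis by blast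
  qed
  then show ?thesis
    by (meson analytic_on_def analytic_on_holomorphic analytic_imp_holomorphic)
qed

lemma dyadic_series_eq_dyadic_sum:
  assumes x: "x \<notin> pole_ray \<beta>"
  shows "dyadic_series \<beta> \<theta> F x = dyadic_sum x"
proof -
  let ?f = "\<lambda>k m. dyadic_term \<beta> \<theta> F (Suc m) k x"
  have inner: "(?f k has_sum (\<Sum>m. ?f k m)) UNIV" for k
  proof -
    have "?f k summable_on UNIV"
      using summable_on_SigmaD1[of ?f UNIV "\<lambda>_. UNIV" k] dyadic_terms_summable[OF x] by simp
    then have h: "(?f k has_sum infsum (?f k) UNIV) UNIV" by (rule has_sum_infsum)
    from sums_unique[OF has_sum_imp_sums[OF h]] h show ?thesis by simp
  qed
  define g where "g = (\<lambda>k. \<Sum>m. ?f k m)"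
  have "((\<lambda>(k, m). ?f k m) has_sum dyadic_sum x) (UNIV \<times> UNIV)"
    unfolding dyadic_sum_def UNIV_Times_UNIV by (rule has_sum_infsum[OF dyadic_terms_summable[OF x]])
  then have "(g has_sum dyadic_sum x) UNIV"
    by (rule has_sum_SigmaD) (simp only: prod.case g_def inner)
  then have sums: "g sums dyadic_sum x" by (rule has_sum_imp_sums)
  have "dyadic_series \<beta> \<theta> F x = g 0 + (\<Sum>k. g (Suc k))" by (simp only: dyadic_series_def g_def)
  also have "\<dots> = suminf g" unfolding suminf_split_head[OF sums_summable[OF sums]] by simp
  also have "\<dots> = dyadic_sum x" by (rule sums_unique[OF sums, symmetric])
  finally show ?thesis .
qed

section \<open>The Laplace integral of the dyadic expansion\<close>

text \<open>
  Here \<open>s - p = 1 + (t + \<tau>) cis \<theta>\<close>, and \<open>cos \<theta> \<ge> 0\<close>.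
\<close>

lemma norm_cut_kernel_le:
  assumes "t \<ge> 0" "\<tau> \<ge> 0"
  shows "norm (1 / (polar_point \<theta> t - ray_point \<tau>)) \<le> 1"
proof -
  have "cos \<theta> \<ge> 0" using theta_range by (intro cos_ge_zero) auto
  define w where "w = polar_point \<theta> t - ray_point \<tau>"
  have w: "w = polar_point \<theta> (t + \<tau>)"
    unfolding w_def cis_minus_b by (simp add: algebra_simps)
  have "1 \<le> Re w" unfolding w using assms \<open>cos \<theta> \<ge> 0\<close> by simp
  then have "1 \<le> norm w" using complex_Re_le_cmod order_trans by blast
  then show ?thesis unfolding w_def[symmetric] by (auto simp: norm_divide divide_le_eq_1)
qed

text \<open>
  The kernel expansion converges uniformly in t and \<tau>, so it may be integrated against the jump;
  what remains of the convergence is uniform in \<tau>, as the termwise Laplace transform requires.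
\<close>

lemma uniform_expansion_on_laplace_ray:
  assumes cauchy: "\<And>\<tau>. \<tau> \<ge> 0 \<Longrightarrow> F (ray_point \<tau>) = cis \<theta> / (2 * of_real pi * \<i>) *
      (LINT t:{0<..}|lborel. jump F \<theta> t / (polar_point \<theta> t - ray_point \<tau>))"
  shows "uniform_limit {0..} (\<lambda>X \<tau>. \<Sum>(k, m)\<in>X. dyadic_coeff \<beta> \<theta> F (Suc m) k * ray_factor m k \<tau>)
     (\<lambda>\<tau>. F (ray_point \<tau>)) (finite_subsets_at_top UNIV)"
proof (rule uniform_limitI)
  fix \<epsilon> :: real assume \<epsilon>: "\<epsilon> > 0"
  define A where "A = (LINT t:{0<..}|lborel. norm (jump F \<theta> t))"
  have A0: "A \<ge> 0" unfolding A_def by (rule set_integral_norm_nonneg)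
  define c where "c = cis \<theta> / (2 * of_real pi * \<i>)"
  have c: "norm c \<le> 1" using pi_ge_two by (simp add: c_def norm_divide norm_mult)
  define g where "g = (\<lambda>(k, m) (t, \<tau>). kernel_coeff \<beta> \<theta> (Suc m) k t * ray_factor m k \<tau>)"
  define ker where "ker = (\<lambda>(t, \<tau>). 1 / (polar_point \<theta> t - ray_point \<tau>))"
  obtain R where R: "R > 1" "\<And>k. R \<le> kernel_radius \<beta> k" using kernel_radius_bounded_below by blast
  have "uniform_limit ({0..} \<times> {0..}) (\<lambda>X p. \<Sum>i\<in>X. g i p) ker (finite_subsets_at_top UNIV)"
  proof (rule Weierstrass_m_test_general')
    show "(\<lambda>x. 2 * norm \<beta> * (case x of (k, m) \<Rightarrow> (1 / 2) ^ k * (1 / R) ^ m)) summable_on UNIV"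
      using R by (intro summable_on_cmult_right summable_dyadic_geometric) auto
    show "((\<lambda>i. g i p) has_sum ker p) UNIV" if "p \<in> {0..} \<times> {0..}" for p
      using that dyadic_kernel_has_sum[of "fst p" "snd p"] by (cases p) (auto simp: g_def ker_def split_def)
    show "norm (g i p) \<le> 2 * norm \<beta> * (case i of (k, m) \<Rightarrow> (1 / 2) ^ k * (1 / R) ^ m)"
      if "p \<in> {0..} \<times> {0..}" for i p
      using that norm_dyadic_kernel_term_le[OF R(1) R(2), of "fst p" "snd p" "snd i" "fst i"]
      by (cases p; cases i) (auto simp: g_def)
  qed
  then have "\<forall>\<^sub>F X in finite_subsets_at_top UNIV. \<forall>p\<in>{0..} \<times> {0..}. dist (\<Sum>i\<in>X. g i p) (ker p) < \<epsilon> / (A + 1)"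
    using \<epsilon> A0 by (intro uniform_limitD) auto
  moreover have "\<forall>\<^sub>F X in finite_subsets_at_top (UNIV :: (nat \<times> nat) set). finite X"
    by (rule eventually_finite_subsets_at_top_weakI) auto
  ultimately show "\<forall>\<^sub>F X in finite_subsets_at_top UNIV. \<forall>\<tau>\<in>{0..}.
     dist (\<Sum>(k, m)\<in>X. dyadic_coeff \<beta> \<theta> F (Suc m) k * ray_factor m k \<tau>)
      (F (ray_point \<tau>)) < \<epsilon>"
  proof eventually_elim
    case (elim X)
    show ?case
    proof
      fix \<tau> :: real assume \<tau>: "\<tau> \<in> {0..}"
      have int1: "set_integrable lborel {0<..} (\<lambda>t. jump F \<theta> t * g i (t, \<tau>))"
        and eq1: "(LINT t:{0<..}|lborel. jump F \<theta> t * g i (t, \<tau>)) =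
          (LINT t:{0<..}|lborel. jump F \<theta> t * kernel_coeff \<beta> \<theta> (Suc (snd i)) (fst i) t) * ray_factor (snd i) (fst i) \<tau>" for i
      proof -
        have e: "jump F \<theta> t * g i (t, \<tau>) =
            (jump F \<theta> t * kernel_coeff \<beta> \<theta> (Suc (snd i)) (fst i) t) * ray_factor (snd i) (fst i) \<tau>" for t
          by (cases i) (simp add: g_def)
        show "set_integrable lborel {0<..} (\<lambda>t. jump F \<theta> t * g i (t, \<tau>))"
          unfolding e by (intro set_integrable_mult_left integrable_jump_kernel_coeff)
        show "(LINT t:{0<..}|lborel. jump F \<theta> t * g i (t, \<tau>)) =
          (LINT t:{0<..}|lborel. jump F \<theta> t * kernel_coeff \<beta> \<theta> (Suc (snd i)) (fst i) t) * ray_factor (snd i) (fst i) \<tau>"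
          unfolding e by (rule set_integral_mult_left)
      qed
      have int2: "set_integrable lborel {0<..} (\<lambda>t. jump F \<theta> t * (\<Sum>i\<in>X. g i (t, \<tau>)))"
        using int1 unfolding sum_distrib_left set_integrable_def scaleR_sum_right by (intro Bochner_Integration.integrable_sum) auto
      have sum_eq: "(\<Sum>(k, m)\<in>X. dyadic_coeff \<beta> \<theta> F (Suc m) k * ray_factor m k \<tau>)
          = c * (LINT t:{0<..}|lborel. jump F \<theta> t * (\<Sum>i\<in>X. g i (t, \<tau>)))"
      proof -
        have "(LINT t:{0<..}|lborel. jump F \<theta> t * (\<Sum>i\<in>X. g i (t, \<tau>))) = (\<Sum>i\<in>X. LINT t:{0<..}|lborel. jump F \<theta> t * g i (t, \<tau>))"
          using int1 unfolding sum_distrib_left set_lebesgue_integral_def set_integrable_def scaleR_sum_right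
          by (intro Bochner_Integration.integral_sum) auto
        then show ?thesis
          unfolding eq1 by (simp add: sum_distrib_left dyadic_coeff_eq c_def split_def mult.assoc)
      qed
      have ker_meas: "set_borel_measurable lborel {0<..} (\<lambda>t. ker (t, \<tau>))"
      proof -
        have "(\<lambda>t. ker (t, \<tau>)) \<in> borel_measurable borel"
          unfolding ker_def by (auto intro!: borel_measurable_divide borel_measurable_continuous_onI continuous_intros)
        then show ?thesis unfolding set_borel_measurable_def by measurable
      qed
      have int3: "set_integrable lborel {0<..} (\<lambda>t. jump F \<theta> t * ker (t, \<tau>))"
        by (rule set_integrable_mult_bounded(1)[OF jump_integrable ker_meas, of 1])
           (use \<tau> norm_cut_kernel_le in \<open>auto simp: ker_def\<close>)
      have F_eq: "F (ray_point \<tau>) = c * (LINT t:{0<..}|lborel. jump F \<theta> t * ker (t, \<tau>))"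
        using cauchy[of \<tau>] \<tau> by (simp add: c_def ker_def)
      let ?d = "\<lambda>t. (\<Sum>i\<in>X. g i (t, \<tau>)) - ker (t, \<tau>)"
      have "dist (\<Sum>(k, m)\<in>X. dyadic_coeff \<beta> \<theta> F (Suc m) k * ray_factor m k \<tau>) (F (ray_point \<tau>)) =
          norm (c * (LINT t:{0<..}|lborel. jump F \<theta> t * ?d t))"
        unfolding sum_eq F_eq dist_norm right_diff_distrib[of "jump F \<theta> _"]
        by (subst set_integral_diff(2)[OF int2 int3]) (simp add: right_diff_distrib)
      also have "\<dots> \<le> 1 * norm (LINT t:{0<..}|lborel. jump F \<theta> t * ?d t)"
        unfolding norm_mult using c by (intro mult_right_mono) auto
      also have "\<dots> \<le> 1 * (A * (\<epsilon> / (A + 1)))"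
      proof -
        have "(\<lambda>t. g i (t, \<tau>)) \<in> borel_measurable borel" for i
          by (cases i) (simp add: g_def)
        then have "(\<lambda>t. \<Sum>i\<in>X. g i (t, \<tau>)) \<in> borel_measurable borel" by (intro borel_measurable_sum)
        then have "set_borel_measurable lborel {0<..} (\<lambda>t. \<Sum>i\<in>X. g i (t, \<tau>))"
          unfolding set_borel_measurable_def by measurable
        then have "set_borel_measurable lborel {0<..} ?d"
          using ker_meas unfolding set_borel_measurable_def scaleR_diff_right by (intro borel_measurable_diff)
        from set_integrable_mult_bounded(2)[OF jump_integrable this, of "\<epsilon> / (A + 1)"] show ?thesis
          using elim(1) \<tau> unfolding A_def[symmetric] by (auto simp: dist_norm intro: less_imp_le)
      qed
      also have "\<dots> < \<epsilon>" using A0 \<epsilon> by (simp add: divide_simps)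
      finally show "dist (\<Sum>(k, m)\<in>X. dyadic_coeff \<beta> \<theta> F (Suc m) k * ray_factor m k \<tau>)
          (F (ray_point \<tau>)) < \<epsilon>" .
    qed
  qed
qed

lemma dyadic_term_laplace:
  fixes x d :: complex and k m :: nat
  assumes x: "Re (x / \<beta>) > 0"
  defines "f \<equiv> (\<lambda>\<tau>. exp (- x * (ray_point \<tau>)) *
      (d * ray_factor m k \<tau>) * cis (- b))"
  shows "set_integrable lborel {0..} f"
    and "(LINT \<tau>:{0..}|lborel. f \<tau>) = fact m / pochhammer (2 ^ k * x / \<beta>) (Suc m) * d"
proof -
  define y where "y = 2 ^ k * x / \<beta>"
  define u where "u = complex_of_real (norm \<beta> / 2 ^ k)"
  have yu: "y * u = x / \<beta> * of_real (norm \<beta>)" by (simp add: y_def u_def)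
  have "Re (y * u) = Re (x / \<beta>) * norm \<beta>" unfolding yu
    by (simp only: times_complex.sel Re_complex_of_real Im_complex_of_real)
  then have R: "Re u \<ge> 0" "Re (y * u) > 0" using x beta_nonzero by (auto simp: u_def)
  have xc: "x * cis (- b) = y * u"
    unfolding yu beta_cis_minus_b[symmetric] using beta_nonzero by simp
  have bc: "\<beta> / 2 ^ k * cis (- b) = u"
    using beta_cis_minus_b by (simp add: u_def)
  have ex: "- x * (ray_point \<tau>) = - y * (of_real \<tau> * u)" for \<tau>
    using xc by (metis minus_mult_left mult.assoc mult.commute)
  have eu: "- of_real (norm \<beta> * \<tau> / 2 ^ k) = - (of_real \<tau> * u)" for \<tau>
    by (simp add: u_def)
  have f: "f \<tau> = (exp (- y * (of_real \<tau> * u)) * (1 - exp (- (of_real \<tau> * u))) ^ m * u) * d" for \<tau>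
    unfolding f_def ray_factor_def ex eu bc[symmetric] by (simp only: mult_ac times_divide_eq_right times_divide_eq_left)
  note B = beta_ray_integral[OF R, of m]
  show "set_integrable lborel {0..} f"
    using B unfolding f[abs_def] by (intro set_integrable_mult_left) auto
  have "(LINT \<tau>:{0..}|lborel. f \<tau>) = (LINT \<tau>:{0..}|lborel. exp (- y * (of_real \<tau> * u)) * (1 - exp (- (of_real \<tau> * u))) ^ m * u) * d"
    unfolding f by (rule set_integral_mult_left)
  then show "(LINT \<tau>:{0..}|lborel. f \<tau>) = fact m / pochhammer (2 ^ k * x / \<beta>) (Suc m) * d"
    using B by (simp add: y_def)
qed

text \<open>
  On this half plane \<open>e\<^sup>-\<^sup>x\<^sup>p\<close> is integrable along the ray, so the uniform expansion of F may be
  transformed term by term; by \<open>dyadic_term_laplace\<close> this gives the terms of the dyadic series.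
\<close>

lemma laplace_ray_eq_dyadic_sum:
  assumes cauchy: "\<And>\<tau>. \<tau> \<ge> 0 \<Longrightarrow> F (ray_point \<tau>) = cis \<theta> / (2 * of_real pi * \<i>) *
      (LINT t:{0<..}|lborel. jump F \<theta> t / (polar_point \<theta> t - ray_point \<tau>))"
    and x: "Re (x / \<beta>) > 0"
  shows "laplace_ray F b x = dyadic_sum x"
proof -
  define P where "P = (\<lambda>X \<tau>. \<Sum>(k, m)\<in>X. dyadic_coeff \<beta> \<theta> F (Suc m) k * ray_factor m k \<tau>)"
  define E where "E = (\<lambda>\<tau>. exp (- x * (ray_point \<tau>)))"
  define G where "G = (\<lambda>\<tau>. F (ray_point \<tau>))"
  have ulim: "uniform_limit {0..} P G (finite_subsets_at_top UNIV)"
    unfolding P_def G_def by (rule uniform_expansion_on_laplace_ray[OF cauchy])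
  define a where "a = x * cis (- b)"
  have "a = x / \<beta> * of_real (norm \<beta>)" unfolding a_def beta_cis_minus_b[symmetric] using beta_nonzero by simp
  then have "Re a = Re (x / \<beta>) * norm \<beta>"
    by (simp only: times_complex.sel Re_complex_of_real Im_complex_of_real)
  then have a: "Re a > 0" using x beta_nonzero by simp
  have E: "E \<tau> = exp (- a * of_real \<tau>)" for \<tau> by (simp add: E_def a_def mult_ac)
  have contP: "continuous_on {0..} (P X)" for X
    unfolding P_def split_def ray_factor_def by (intro continuous_intros) auto
  have contG: "continuous_on {0..} G"
    using uniform_limit_theorem[OF _ ulim] contP by (auto intro: always_eventually)
  have Ea: "set_integrable lborel {0..} E"
    unfolding E[abs_def] by (rule integral_exp_ray(1)[OF a])
  define B where "B = (LINT \<tau>:{0..}|lborel. norm (E \<tau>))"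
  have B0: "B \<ge> 0" unfolding B_def by (rule set_integral_norm_nonneg)
  have EP: "set_integrable lborel {0..} (\<lambda>\<tau>. E \<tau> * P X \<tau> * cis (- b)) \<and>
      (LINT \<tau>:{0..}|lborel. E \<tau> * P X \<tau> * cis (- b)) = dyadic_block X x"
    if "finite X" for X
    using that
  proof induction
    case empty
    then show ?case by (simp add: P_def set_integrable_def set_lebesgue_integral_def)
  next
    case (insert p X)
    obtain k m where p: "p = (k, m)" by (cases p)
    let ?f = "\<lambda>\<tau>. E \<tau> * (dyadic_coeff \<beta> \<theta> F (Suc m) k * ray_factor m k \<tau>) * cis (- b)"
    have e: "E \<tau> * P (insert p X) \<tau> * cis (- b) = ?f \<tau> + E \<tau> * P X \<tau> * cis (- b)" for \<tau>
      using insert by (simp add: P_def p algebra_simps)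
    note T = dyadic_term_laplace[OF x, of "dyadic_coeff \<beta> \<theta> F (Suc m) k" m k, folded E_def]
    have "(LINT \<tau>:{0..}|lborel. ?f \<tau>) = dyadic_term \<beta> \<theta> F (Suc m) k x"
      using T(2) by (simp add: dyadic_term_def E_def)
    moreover have "set_integrable lborel {0..} ?f" using T(1) by (simp add: E_def)
    ultimately show ?case
      unfolding e using insert by (simp add: p set_integral_add)
  qed
  have EG: "set_integrable lborel {0..} (\<lambda>\<tau>. E \<tau> * G \<tau> * cis (- b))"
    and near: "\<epsilon> > 0 \<Longrightarrow> \<forall>\<^sub>F X in finite_subsets_at_top UNIV.
      norm (dyadic_block X x - laplace_ray F b x) \<le> \<epsilon> * B" for \<epsilon>
  proof -
    have fin: "\<forall>\<^sub>F X in finite_subsets_at_top (UNIV :: (nat \<times> nat) set). finite X"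
      by (rule eventually_finite_subsets_at_top_weakI) auto
    have diff: "set_integrable lborel {0..} (\<lambda>\<tau>. E \<tau> * (P X \<tau> - G \<tau>) * cis (- b))"
      "norm (LINT \<tau>:{0..}|lborel. E \<tau> * (P X \<tau> - G \<tau>) * cis (- b)) \<le> \<epsilon> * B"
      if close: "\<And>\<tau>. \<tau> \<ge> 0 \<Longrightarrow> norm (P X \<tau> - G \<tau>) \<le> \<epsilon>" for X and \<epsilon> :: real
    proof -
      have k: "set_borel_measurable lborel {0..} (\<lambda>\<tau>. (P X \<tau> - G \<tau>) * cis (- b))"
        by (intro set_borel_measurable_continuous_on continuous_intros contP contG) auto
      have bd: "norm ((P X \<tau> - G \<tau>) * cis (- b)) \<le> \<epsilon>" if "\<tau> \<in> {0..}" for \<tau>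
        using close that by (simp add: norm_mult)
      note M = set_integrable_mult_bounded[OF Ea k bd]
      show "set_integrable lborel {0..} (\<lambda>\<tau>. E \<tau> * (P X \<tau> - G \<tau>) * cis (- b))"
        using M(1) unfolding mult.assoc .
      show "norm (LINT \<tau>:{0..}|lborel. E \<tau> * (P X \<tau> - G \<tau>) * cis (- b)) \<le> \<epsilon> * B"
        using M(2) unfolding mult.assoc B_def mult.commute[of \<epsilon>] .
    qed
    have ev: "\<forall>\<^sub>F X in finite_subsets_at_top UNIV. finite X \<and> (\<forall>\<tau>\<ge>0. norm (P X \<tau> - G \<tau>) \<le> \<epsilon>)" if "\<epsilon> > 0" for \<epsilon>
      using uniform_limitD[OF ulim that] fin
      by eventually_elim (auto simp: dist_norm intro: less_imp_le)
    obtain X where X: "finite X" "\<And>\<tau>. \<tau> \<ge> 0 \<Longrightarrow> norm (P X \<tau> - G \<tau>) \<le> 1"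
      using eventually_happens[OF ev[of 1]] by auto
    have "set_integrable lborel {0..} (\<lambda>\<tau>. E \<tau> * P X \<tau> * cis (- b) - E \<tau> * (P X \<tau> - G \<tau>) * cis (- b))"
      using EP[OF X(1)] diff(1)[OF X(2)] by (intro set_integral_diff(1)) auto
    then show EG: "set_integrable lborel {0..} (\<lambda>\<tau>. E \<tau> * G \<tau> * cis (- b))"
      by (simp add: algebra_simps)
    have L: "laplace_ray F b x = (LINT \<tau>:{0..}|lborel. E \<tau> * G \<tau> * cis (- b))"
      by (simp add: laplace_ray_def E_def G_def)
    show "\<forall>\<^sub>F X in finite_subsets_at_top UNIV.
      norm (dyadic_block X x - laplace_ray F b x) \<le> \<epsilon> * B" if "\<epsilon> > 0"
      using ev[OF that]
    proof eventually_elim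
      case (elim X)
      then have fX: "finite X" and cl: "\<And>\<tau>. \<tau> \<ge> 0 \<Longrightarrow> norm (P X \<tau> - G \<tau>) \<le> \<epsilon>" by auto
      have "dyadic_block X x - laplace_ray F b x =
          (LINT \<tau>:{0..}|lborel. E \<tau> * P X \<tau> * cis (- b)) - (LINT \<tau>:{0..}|lborel. E \<tau> * G \<tau> * cis (- b))"
        using EP[OF fX] L by simp
      also have "\<dots> = (LINT \<tau>:{0..}|lborel. E \<tau> * P X \<tau> * cis (- b) - E \<tau> * G \<tau> * cis (- b))"
        using EP[OF fX] EG by (subst set_integral_diff(2)) auto
      also have "\<dots> = (LINT \<tau>:{0..}|lborel. E \<tau> * (P X \<tau> - G \<tau>) * cis (- b))"
        by (simp add: algebra_simps)
      finally show ?case using diff(2)[OF cl] by simp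
    qed
  qed
  have "((\<lambda>X. dyadic_block X x) \<longlongrightarrow> laplace_ray F b x) (finite_subsets_at_top UNIV)"
  proof (rule tendstoI)
    fix e :: real assume e: "e > 0"
    from near[of "e / (B + 1)"] e B0
    have "\<forall>\<^sub>F X in finite_subsets_at_top UNIV.
      norm (dyadic_block X x - laplace_ray F b x) \<le> e / (B + 1) * B" by simp
    moreover have "e / (B + 1) * B < e" using e B0 by (simp add: divide_simps)
    ultimately show "\<forall>\<^sub>F X in finite_subsets_at_top UNIV.
      dist (dyadic_block X x) (laplace_ray F b x) < e"
      by (auto simp: dist_norm elim!: eventually_mono)
  qed
  moreover have "((\<lambda>X. dyadic_block X x) \<longlongrightarrow> dyadic_sum x) (finite_subsets_at_top UNIV)"
  proof -
    have "x \<notin> pole_ray \<beta>"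
      using x by (auto simp: pole_ray_iff[OF beta_nonzero] nonpos_Reals_def)
    from dyadic_terms_summable[OF this] show ?thesis
      unfolding dyadic_sum_def by (auto simp: has_sum_def dest!: has_sum_infsum)
  qed
  ultimately show ?thesis
    using tendsto_unique[OF finite_subsets_at_top_neq_bot] by blast
qed

end

section \<open>Rectangular contours and area means\<close>

lemma has_contour_integral_affine:
  fixes f :: "complex \<Rightarrow> complex" and g :: "real \<Rightarrow> complex"
  assumes le: "s1 \<le> s2" and cont: "continuous_on {s1..s2} (\<lambda>s. f (g s))"
    and g: "\<And>s. g s = p + of_real s * w"
  shows "(f has_contour_integral w * integral {s1..s2} (\<lambda>s. f (g s))) (linepath (g s1) (g s2))"
proof -
  let ?h = "\<lambda>t. s1 + t * (s2 - s1)"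
  have "((\<lambda>t. (s2 - s1) *\<^sub>R f (g (?h t))) has_integral integral {?h 0..?h 1} (\<lambda>s. f (g s))) {0..1}"
  proof (rule has_integral_substitution[where c = s1 and d = s2])
    show "?h ` {0..1} \<subseteq> {s1..s2}"
    proof safe
      fix t :: real assume "t \<in> {0..1}"
      then have "0 \<le> t * (s2 - s1)" "t * (s2 - s1) \<le> 1 * (s2 - s1)"
        using le mult_right_mono[of t 1 "s2 - s1"] by auto
      then show "?h t \<in> {s1..s2}" by auto
    qed
  qed (use le cont in \<open>auto intro!: derivative_eq_intros\<close>)
  then have "((\<lambda>t. w * ((s2 - s1) *\<^sub>R f (g (?h t)))) has_integral w * integral {s1..s2} (\<lambda>s. f (g s))) {0..1}"
    by (intro has_integral_mult_right) simp
  moreover have "linepath (g s1) (g s2) t = g (?h t)" for t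
    by (simp add: linepath_def g scaleR_conv_of_real algebra_simps)
  moreover have "g s2 - g s1 = w * of_real (s2 - s1)" by (simp add: g algebra_simps)
  ultimately show ?thesis
    by (simp add: has_contour_integral_linepath scaleR_conv_of_real mult_ac)
qed

lemma has_contour_integral_horizontal:
  fixes f :: "complex \<Rightarrow> complex"
  assumes "x1 \<le> x2" "continuous_on {x1..x2} (\<lambda>x. f (Complex x y))"
  shows "(f has_contour_integral integral {x1..x2} (\<lambda>x. f (Complex x y)))
    (linepath (Complex x1 y) (Complex x2 y))"
  using has_contour_integral_affine[where g = "\<lambda>x. Complex x y" and p = "Complex 0 y" and w = 1, OF assms]
  by (simp add: complex_eq_iff)

lemma has_contour_integral_vertical:
  fixes f :: "complex \<Rightarrow> complex"
  assumes "y1 \<le> y2" "continuous_on {y1..y2} (\<lambda>y. f (Complex x y))"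
  shows "(f has_contour_integral \<i> * integral {y1..y2} (\<lambda>y. f (Complex x y)))
    (linepath (Complex x y1) (Complex x y2))"
  using has_contour_integral_affine[where g = "\<lambda>y. Complex x y" and p = "Complex x 0" and w = \<i>, OF assms]
  by (simp add: complex_eq_iff)

lemma continuous_on_Complex_line:
  "continuous_on A (\<lambda>x. Complex x y)" "continuous_on A (\<lambda>y. Complex x y)"
  by (intro continuous_intros)+

lemma has_contour_integral_rectpath:
  fixes f :: "complex \<Rightarrow> complex"
  assumes "x1 \<le> x2" "y1 \<le> y2"
    and cont: "continuous_on (path_image (rectpath (Complex x1 y1) (Complex x2 y2))) f"
  shows "(f has_contour_integral
      (integral {x1..x2} (\<lambda>x. f (Complex x y1)) + \<i> * integral {y1..y2} (\<lambda>y. f (Complex x2 y))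
       - integral {x1..x2} (\<lambda>x. f (Complex x y2)) - \<i> * integral {y1..y2} (\<lambda>y. f (Complex x1 y))))
    (rectpath (Complex x1 y1) (Complex x2 y2))"
proof -
  have im: "Complex x y1 \<in> path_image (rectpath (Complex x1 y1) (Complex x2 y2))"
    "Complex x y2 \<in> path_image (rectpath (Complex x1 y1) (Complex x2 y2))" if "x \<in> {x1..x2}" for x
    using that assms by (auto simp: path_image_rectpath)
  have im': "Complex x1 y \<in> path_image (rectpath (Complex x1 y1) (Complex x2 y2))"
    "Complex x2 y \<in> path_image (rectpath (Complex x1 y1) (Complex x2 y2))" if "y \<in> {y1..y2}" for y
    using that assms by (auto simp: path_image_rectpath)
  note c = continuous_on_compose2[OF cont continuous_on_Complex_line(1)] continuous_on_compose2[OF cont continuous_on_Complex_line(2)]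
  have "(f has_contour_integral integral {x1..x2} (\<lambda>x. f (Complex x y1))
      + (\<i> * integral {y1..y2} (\<lambda>y. f (Complex x2 y))
      + (- integral {x1..x2} (\<lambda>x. f (Complex x y2))
      + - (\<i> * integral {y1..y2} (\<lambda>y. f (Complex x1 y))))))
    (rectpath (Complex x1 y1) (Complex x2 y2))"
    unfolding rectpath_def Let_def complex.sel
    by (intro has_contour_integral_join has_contour_integral_horizontal has_contour_integral_vertical
          has_contour_integral_reverse_linepath valid_path_join valid_path_linepath assms c)
       (use im im' in auto)
  then show ?thesis by (simp add: algebra_simps)
qed

lemma lborel_complex: "(lborel :: complex measure) = distr (lborel \<Otimes>\<^sub>M lborel) borel (\<lambda>(x, y). Complex x y)"
proof (rule lborel_eqI)
  have meas: "(\<lambda>(x, y). Complex x y) \<in> borel_measurable (lborel \<Otimes>\<^sub>M lborel)"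
    unfolding Complex_eq split_def by measurable
  fix l u :: complex
  assume "\<And>b. b \<in> Basis \<Longrightarrow> l \<bullet> b \<le> u \<bullet> b"
  from this[of 1] this[of \<i>] have le: "Re l \<le> Re u" "Im l \<le> Im u" by (auto simp: Basis_complex_def)
  have "(\<lambda>(x, y). Complex x y) -` box l u \<inter> space (lborel \<Otimes>\<^sub>M lborel) = {Re l<..<Re u} \<times> {Im l<..<Im u}"
    by (auto simp: in_box_complex_iff space_pair_measure)
  then have "emeasure (distr (lborel \<Otimes>\<^sub>M lborel) borel (\<lambda>(x, y). Complex x y)) (box l u)
      = emeasure (lborel \<Otimes>\<^sub>M lborel) ({Re l<..<Re u} \<times> {Im l<..<Im u})"
    by (subst emeasure_distr[OF meas]) auto
  also have "\<dots> = ennreal ((Re u - Re l) * (Im u - Im l))"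
    by (subst lborel.emeasure_pair_measure_Times) (use le in \<open>auto simp: ennreal_mult\<close>)
  also have "(Re u - Re l) * (Im u - Im l) = (\<Prod>b\<in>Basis. (u - l) \<bullet> b)"
    by (simp add: Basis_complex_def)
  finally show "emeasure (distr (lborel \<Otimes>\<^sub>M lborel) borel (\<lambda>(x, y). Complex x y)) (box l u)
      = (\<Prod>b\<in>Basis. (u - l) \<bullet> b)" .
qed simp

lemma nn_integral_complex_iterated:
  assumes [measurable]: "g \<in> borel_measurable (borel :: complex measure)"
  shows "(\<integral>\<^sup>+ x. \<integral>\<^sup>+ y. g (Complex x y) \<partial>lborel \<partial>lborel) = (\<integral>\<^sup>+ z. g z \<partial>lborel)"
    and "(\<integral>\<^sup>+ y. \<integral>\<^sup>+ x. g (Complex x y) \<partial>lborel \<partial>lborel) = (\<integral>\<^sup>+ z. g z \<partial>lborel)"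
proof -
  have meas[measurable]: "(\<lambda>(x, y). Complex x y) \<in> borel_measurable (lborel \<Otimes>\<^sub>M lborel)"
    unfolding Complex_eq split_def by measurable
  have "(\<integral>\<^sup>+ z. g z \<partial>lborel) = (\<integral>\<^sup>+ p. g (case p of (x, y) \<Rightarrow> Complex x y) \<partial>(lborel \<Otimes>\<^sub>M lborel))"
    by (subst lborel_complex, subst nn_integral_distr) (auto simp: split_def)
  also have "\<dots> = (\<integral>\<^sup>+ p. (case p of (x, y) \<Rightarrow> g (Complex x y)) \<partial>(lborel \<Otimes>\<^sub>M lborel))"
    by (simp add: split_def)
  finally have *: "(\<integral>\<^sup>+ z. g z \<partial>lborel) = (\<integral>\<^sup>+ p. (case p of (x, y) \<Rightarrow> g (Complex x y)) \<partial>(lborel \<Otimes>\<^sub>M lborel))" .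
  have m: "(\<lambda>(x, y). g (Complex x y)) \<in> borel_measurable (lborel \<Otimes>\<^sub>M lborel)"
    using measurable_compose[OF meas assms] by (simp add: split_def)
  show "(\<integral>\<^sup>+ x. \<integral>\<^sup>+ y. g (Complex x y) \<partial>lborel \<partial>lborel) = (\<integral>\<^sup>+ z. g z \<partial>lborel)"
    unfolding * using lborel.nn_integral_fst[OF m] by simp
  show "(\<integral>\<^sup>+ y. \<integral>\<^sup>+ x. g (Complex x y) \<partial>lborel \<partial>lborel) = (\<integral>\<^sup>+ z. g z \<partial>lborel)"
    unfolding * using lborel_pair.nn_integral_snd[OF m] by simp
qed

lemma norm_integral_side_le:
  fixes k w :: "real \<Rightarrow> complex"
  assumes k: "continuous_on {c - h..c + h} k" and w: "continuous_on {c - h..c + h} w"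
    and a: "0 < a" "a \<le> h" and low: "\<And>s. a \<le> norm (w s)"
  shows "norm (integral {c - a..c + a} (\<lambda>s. k s / w s)) \<le> integral {c - h..c + h} (\<lambda>s. norm (k s)) / a"
proof -
  have "w s \<noteq> 0" for s using low[of s] a by auto
  then have kw: "continuous_on {c - a..c + a} (\<lambda>s. k s / w s)"
    using a by (intro continuous_intros continuous_on_subset[OF k] continuous_on_subset[OF w]) auto
  have "norm (k s / w s) \<le> norm (k s) / a" for s
    unfolding norm_divide using low[of s] a by (intro divide_left_mono mult_pos_pos) auto
  then have "norm (integral {c - a..c + a} (\<lambda>s. k s / w s)) \<le> integral {c - a..c + a} (\<lambda>s. norm (k s) / a)"
    using a by (intro integral_norm_bound_integral integrable_continuous_interval kw continuous_intros continuous_on_subset[OF k]) auto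
  also have "\<dots> \<le> integral {c - h..c + h} (\<lambda>s. norm (k s) / a)"
    using a by (intro integral_subset_le integrable_continuous_interval continuous_intros continuous_on_subset[OF k]) auto
  finally show ?thesis by simp
qed

lemma square_subset_ball:
  assumes "\<bar>Re z - Re p\<bar> \<le> d / 2" "\<bar>Im z - Im p\<bar> \<le> d / 2" "d > 0"
  shows "z \<in> ball p d"
proof -
  have "(norm (z - p))\<^sup>2 = (Re z - Re p)\<^sup>2 + (Im z - Im p)\<^sup>2" by (simp add: cmod_power2)
  also have "\<dots> \<le> (d / 2)\<^sup>2 + (d / 2)\<^sup>2"
    using assms by (intro add_mono) (auto simp: abs_le_square_iff[symmetric])
  also have "\<dots> < d\<^sup>2" using assms by (simp add: power2_eq_square)
  finally show ?thesis using assms by (simp add: dist_norm norm_minus_commute power2_less_imp_less)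
qed

definition horizontal_chord :: "(complex \<Rightarrow> complex) \<Rightarrow> complex \<Rightarrow> real \<Rightarrow> real \<Rightarrow> real" where
  "horizontal_chord f p h y = integral {Re p - h..Re p + h} (\<lambda>x. norm (f (Complex x y)))"

definition vertical_chord :: "(complex \<Rightarrow> complex) \<Rightarrow> complex \<Rightarrow> real \<Rightarrow> real \<Rightarrow> real" where
  "vertical_chord f p h x = integral {Im p - h..Im p + h} (\<lambda>y. norm (f (Complex x y)))"

text \<open>
  Cauchy's formula on the square of half-side a. The integrals extend over sides of the larger square of
  half-side h, so that averaging over a turns each of them into an area integral.
\<close>

lemma norm_le_square_contour:
  fixes f :: "complex \<Rightarrow> complex"
  assumes hol: "f holomorphic_on ball p d" and a: "0 < a" "a \<le> d / 2" and h: "h = d / 2"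
  shows "2 * pi * norm (f p) * a \<le> horizontal_chord f p h (Im p - a) + horizontal_chord f p h (Im p + a)
      + vertical_chord f p h (Re p + a) + vertical_chord f p h (Re p - a)"
proof -
  have d: "d > 0" and ah: "a \<le> h" using a h by auto
  have inball: "Complex x y \<in> ball p d" if "\<bar>x - Re p\<bar> \<le> h" "\<bar>y - Im p\<bar> \<le> h" for x y
    using that d by (intro square_subset_ball) (simp_all add: h)
  define R where "R = rectpath (Complex (Re p - a) (Im p - a)) (Complex (Re p + a) (Im p + a))"
  have img: "path_image R \<subseteq> ball p d - {p}"
  proof
    fix z assume "z \<in> path_image R"
    then have "(Re z \<in> {Re p - a, Re p + a} \<and> Im z \<in> {Im p - a..Im p + a}) \<or>
        (Im z \<in> {Im p - a, Im p + a} \<and> Re z \<in> {Re p - a..Re p + a})"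
      using a unfolding R_def by (subst (asm) path_image_rectpath) auto
    then have "\<bar>Re z - Re p\<bar> \<le> h" "\<bar>Im z - Im p\<bar> \<le> h" "z \<noteq> p" using a ah by auto
    then show "z \<in> ball p d - {p}" using inball[of "Re z" "Im z"] by auto
  qed
  have wn: "winding_number R p = 1"
    unfolding R_def by (rule winding_number_rectpath) (use a in \<open>auto simp: in_box_complex_iff\<close>)
  have "((\<lambda>w. f w / (w - p)) has_contour_integral (2 * pi * \<i> * winding_number R p * f p)) R"
    by (rule Cauchy_integral_formula_convex_simple[OF convex_ball hol _ _ img]) (use d in \<open>auto simp: R_def\<close>)
  then have C1: "((\<lambda>w. f w / (w - p)) has_contour_integral (2 * pi * \<i> * f p)) R" using wn by simp
  have contf: "continuous_on (ball p d) f" by (rule holomorphic_on_imp_continuous_on[OF hol])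
  have contq: "continuous_on (path_image R) (\<lambda>w. f w / (w - p))"
    using img by (intro continuous_intros continuous_on_subset[OF contf]) auto
  let ?g = "\<lambda>w. f w / (w - p)"
  have formula: "2 * pi * \<i> * f p = (integral {Re p - a..Re p + a} (\<lambda>x. ?g (Complex x (Im p - a)))
     + \<i> * integral {Im p - a..Im p + a} (\<lambda>y. ?g (Complex (Re p + a) y))
     - integral {Re p - a..Re p + a} (\<lambda>x. ?g (Complex x (Im p + a)))
     - \<i> * integral {Im p - a..Im p + a} (\<lambda>y. ?g (Complex (Re p - a) y)))"
    using has_contour_integral_unique[OF C1 has_contour_integral_rectpath[of "Re p - a" "Re p + a" "Im p - a" "Im p + a" ?g, folded R_def, OF _ _ contq]]
      a by simp
  have H: "norm (integral {Re p - a..Re p + a} (\<lambda>x. ?g (Complex x y))) \<le>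
      horizontal_chord f p h y / a" if y: "\<bar>y - Im p\<bar> = a" for y
    unfolding horizontal_chord_def
  proof (rule norm_integral_side_le[OF _ _ a(1) ah])
    show "continuous_on {Re p - h..Re p + h} (\<lambda>x. f (Complex x y))"
      by (rule continuous_on_compose2[OF contf continuous_on_Complex_line(1)]) (use inball y ah in \<open>auto simp: abs_le_iff\<close>)
    show "a \<le> norm (Complex x y - p)" for x using abs_Im_le_cmod[of "Complex x y - p"] y by simp
  qed (intro continuous_intros)
  have V: "norm (\<i> * integral {Im p - a..Im p + a} (\<lambda>y. ?g (Complex x y))) \<le>
      vertical_chord f p h x / a" if x: "\<bar>x - Re p\<bar> = a" for x
    unfolding norm_mult norm_ii mult_1 vertical_chord_def
  proof (rule norm_integral_side_le[OF _ _ a(1) ah])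
    show "continuous_on {Im p - h..Im p + h} (\<lambda>y. f (Complex x y))"
      by (rule continuous_on_compose2[OF contf continuous_on_Complex_line(2)]) (use inball x ah in \<open>auto simp: abs_le_iff\<close>)
    show "a \<le> norm (Complex x y - p)" for y using abs_Re_le_cmod[of "Complex x y - p"] x by simp
  qed (intro continuous_intros)
  have n4: "norm (A + B - C - D) \<le> norm A + norm B + norm C + norm D" for A B C D :: complex
    by (smt (verit) norm_triangle_ineq norm_triangle_ineq4)
  have "norm (2 * pi * \<i> * f p) \<le>
     horizontal_chord f p h (Im p - a) / a + vertical_chord f p h (Re p + a) / a
     + horizontal_chord f p h (Im p + a) / a + vertical_chord f p h (Re p - a) / a"
    using formula H[of "Im p - a"] H[of "Im p + a"] V[of "Re p + a"] V[of "Re p - a"] a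
    by (intro order_trans[OF eq_refl[OF arg_cong[where f = norm]] order_trans[OF n4]]) auto
  then show ?thesis using a by (simp add: norm_mult field_simps)
qed

lemma ennreal_integral_norm:
  fixes k :: "real \<Rightarrow> complex"
  assumes "continuous_on {a..c} k"
  shows "ennreal (integral {a..c} (\<lambda>s. norm (k s))) = (\<integral>\<^sup>+ s. ennreal (norm (indicator {a..c} s *\<^sub>R k s)) \<partial>lborel)"
proof -
  have "((\<lambda>s. norm (k s)) has_integral integral {a..c} (\<lambda>s. norm (k s))) {a..c}"
    by (intro integrable_integral integrable_continuous_interval continuous_on_norm assms)
  then have "(\<integral>\<^sup>+ s. ennreal (indicator {a..c} s * norm (k s)) \<partial>lborel) = ennreal (integral {a..c} (\<lambda>s. norm (k s)))"
    by (intro nn_integral_has_integral_lebesgue) auto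
  then show ?thesis by simp
qed

text \<open>
  Average \<open>norm_le_square_contour\<close> over \<open>d/4 \<le> a \<le> d/2\<close>. Squares in place of discs make Fubini's theorem in
  Cartesian coordinates sufficient.
\<close>

lemma norm_le_area_integral:
  fixes f :: "complex \<Rightarrow> complex"
  assumes hol: "f holomorphic_on ball p d" and d: "d > 0"
    and int: "set_integrable lborel (ball p d) f"
  shows "norm (f p) \<le> 16 / d\<^sup>2 * (LINT z:ball p d|lborel. norm (f z))"
proof -
  define h where "h = d / 2"
  have h: "h > 0" using d by (simp add: h_def)
  define Q where "Q = {z. \<bar>Re z - Re p\<bar> \<le> h \<and> \<bar>Im z - Im p\<bar> \<le> h}"
  have Qball: "Q \<subseteq> ball p d" using d by (auto simp: Q_def h_def intro!: square_subset_ball)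
  have contf: "continuous_on (ball p d) f" by (rule holomorphic_on_imp_continuous_on[OF hol])
  have closedQ: "closed Q" unfolding Q_def by (intro closed_Collect_conj closed_Collect_le continuous_intros)
  define g where "g = (\<lambda>z. ennreal (norm (indicator Q z *\<^sub>R f z)))"
  have fm: "(\<lambda>z. indicator Q z *\<^sub>R f z) \<in> borel_measurable borel"
    using continuous_on_subset[OF contf Qball] closedQ
    by (intro borel_measurable_continuous_on_indicator) auto
  then have g[measurable]: "g \<in> borel_measurable borel" unfolding g_def by measurable
  define A where "A = (LINT z:ball p d|lborel. norm (f z))"
  have A0: "A \<ge> 0" unfolding A_def set_lebesgue_integral_def by (intro integral_nonneg_AE) auto
  have N: "(\<integral>\<^sup>+ z. g z \<partial>lborel) \<le> ennreal A"
  proof -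
    have "(\<integral>\<^sup>+ z. g z \<partial>lborel) \<le> (\<integral>\<^sup>+ z. ennreal (indicator (ball p d) z *\<^sub>R norm (f z)) \<partial>lborel)"
      unfolding g_def using Qball by (intro nn_integral_mono ennreal_leI) (auto simp: indicator_def)
    also have "\<dots> = ennreal A"
      using set_integrable_norm[OF int] unfolding A_def set_lebesgue_integral_def set_integrable_def
      by (intro nn_integral_eq_integral) auto
    finally show ?thesis .
  qed
  define V where "V = (\<lambda>y. \<integral>\<^sup>+ x. g (Complex x y) \<partial>lborel)"
  define U where "U = (\<lambda>x. \<integral>\<^sup>+ y. g (Complex x y) \<partial>lborel)"
  have [measurable]: "V \<in> borel_measurable borel" "U \<in> borel_measurable borel"
    unfolding V_def U_def Complex_eq by measurable
  have VN: "(\<integral>\<^sup>+ y. V y \<partial>lborel) \<le> ennreal A" and UN: "(\<integral>\<^sup>+ x. U x \<partial>lborel) \<le> ennreal A"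
    using nn_integral_complex_iterated[OF g] N by (simp_all add: V_def U_def)
  have Veq: "ennreal (horizontal_chord f p h y) = V y"
    if "\<bar>y - Im p\<bar> \<le> h" for y
  proof -
    have mem: "Complex x y \<in> Q \<longleftrightarrow> x \<in> {Re p - h..Re p + h}" for x
      using that by (auto simp: Q_def abs_le_iff)
    have "continuous_on {Re p - h..Re p + h} (\<lambda>x. f (Complex x y))"
      by (intro continuous_on_compose2[OF continuous_on_subset[OF contf Qball]])
         (auto simp: mem intro!: continuous_intros)
    from ennreal_integral_norm[OF this] show ?thesis unfolding V_def g_def horizontal_chord_def by (simp add: indicator_def mem)
  qed
  have Ueq: "ennreal (vertical_chord f p h x) = U x"
    if "\<bar>x - Re p\<bar> \<le> h" for x
  proof -
    have mem: "Complex x y \<in> Q \<longleftrightarrow> y \<in> {Im p - h..Im p + h}" for y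
      using that by (auto simp: Q_def abs_le_iff)
    have "continuous_on {Im p - h..Im p + h} (\<lambda>y. f (Complex x y))"
      by (intro continuous_on_compose2[OF continuous_on_subset[OF contf Qball]])
         (auto simp: mem intro!: continuous_intros)
    from ennreal_integral_norm[OF this] show ?thesis unfolding U_def g_def vertical_chord_def by (simp add: indicator_def mem)
  qed
  have "0 \<le> integral S (\<lambda>x. norm (k x))" for S and k :: "real \<Rightarrow> complex"
    by (cases "(\<lambda>x. norm (k x)) integrable_on S") (auto intro: integral_nonneg simp: not_integrable_integral)
  then have nonneg: "0 \<le> horizontal_chord f p h y" "0 \<le> vertical_chord f p h x" for x y
    by (simp_all add: horizontal_chord_def vertical_chord_def)
  \<comment> \<open>V and U are the integrals of \<open>|f|\<close> over horizontal and vertical chords of the square Q\<close>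
  have pt: "ennreal (2 * pi * norm (f p) * (h / 2)) \<le> V (Im p - a) + V (Im p + a) + U (Re p + a) + U (Re p - a)"
    if a: "a \<in> {h / 2..h}" for a
  proof -
    have "2 * pi * norm (f p) * (h / 2) \<le> 2 * pi * norm (f p) * a" using a by (intro mult_left_mono) auto
    also note norm_le_square_contour[OF hol _ _ h_def, of a]
    finally have "2 * pi * norm (f p) * (h / 2) \<le> horizontal_chord f p h (Im p - a) + horizontal_chord f p h (Im p + a)
      + vertical_chord f p h (Re p + a) + vertical_chord f p h (Re p - a)"
      using a h by (simp add: h_def)
    then have "ennreal (2 * pi * norm (f p) * (h / 2)) \<le> ennreal (horizontal_chord f p h (Im p - a) + horizontal_chord f p h (Im p + a)
      + vertical_chord f p h (Re p + a) + vertical_chord f p h (Re p - a))"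
      by (rule ennreal_leI)
    also have "\<dots> = V (Im p - a) + V (Im p + a) + U (Re p + a) + U (Re p - a)"
    proof -
      have "\<bar>Im p - a - Im p\<bar> \<le> h" "\<bar>Im p + a - Im p\<bar> \<le> h" "\<bar>Re p + a - Re p\<bar> \<le> h" "\<bar>Re p - a - Re p\<bar> \<le> h"
        using a h by auto
      then show ?thesis by (simp only: ennreal_plus nonneg add_nonneg_nonneg Veq Ueq)
    qed
    finally show ?thesis .
  qed
  have shift: "(\<integral>\<^sup>+ a. W (c + s * a) \<partial>lborel) = (\<integral>\<^sup>+ a. W a \<partial>lborel)"
    if "W \<in> borel_measurable borel" "\<bar>s\<bar> = 1" for W :: "real \<Rightarrow> ennreal" and c s
    using nn_integral_real_affine[OF that(1), of s c] that(2) by auto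
  have "ennreal (2 * pi * norm (f p) * (h / 2)) * ennreal (h / 2)
      = (\<integral>\<^sup>+ a. ennreal (2 * pi * norm (f p) * (h / 2)) * indicator {h / 2..h} a \<partial>lborel)"
    using h by (subst nn_integral_cmult_indicator) auto
  also have "\<dots> \<le> (\<integral>\<^sup>+ a. V (Im p - a) + V (Im p + a) + U (Re p + a) + U (Re p - a) \<partial>lborel)"
    using pt by (intro nn_integral_mono) (auto simp: indicator_def)
  also have "\<dots> = (\<integral>\<^sup>+ a. V (Im p - a) \<partial>lborel) + (\<integral>\<^sup>+ a. V (Im p + a) \<partial>lborel)
      + (\<integral>\<^sup>+ a. U (Re p + a) \<partial>lborel) + (\<integral>\<^sup>+ a. U (Re p - a) \<partial>lborel)"
    by (simp add: nn_integral_add)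
  also have "\<dots> = (\<integral>\<^sup>+ a. V a \<partial>lborel) + (\<integral>\<^sup>+ a. V a \<partial>lborel)
      + (\<integral>\<^sup>+ a. U a \<partial>lborel) + (\<integral>\<^sup>+ a. U a \<partial>lborel)"
    using shift[of V "-1" "Im p"] shift[of V 1 "Im p"] shift[of U "-1" "Re p"] shift[of U 1 "Re p"]
    by simp
  also have "\<dots> \<le> ennreal A + ennreal A + ennreal A + ennreal A"
    by (intro add_mono VN UN)
  also have "\<dots> = ennreal (4 * A)" using A0 by (simp flip: ennreal_plus)
  finally have "2 * pi * norm (f p) * (h / 2) * (h / 2) \<le> 4 * A"
    using h A0 by (simp add: ennreal_le_iff flip: ennreal_mult)
  moreover have "4 * norm (f p) * (h / 2) * (h / 2) \<le> 2 * pi * norm (f p) * (h / 2) * (h / 2)"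
    using pi_ge_two h by (intro mult_right_mono) auto
  moreover have "norm (f p) * h\<^sup>2 = 4 * norm (f p) * (h / 2) * (h / 2)" by (simp add: power2_eq_square)
  ultimately have "norm (f p) * h\<^sup>2 \<le> 4 * A" by linarith
  then have "norm (f p) * d\<^sup>2 \<le> 16 * A" by (simp add: h_def power_divide)
  then show ?thesis unfolding A_def[symmetric] using d by (simp add: field_simps)
qed

section \<open>Cauchy's formula in a strip\<close>

text \<open>
  On the two boundary lines \<Phi> is only continuous: in the application they are the two sides of the cut,
  where \<Phi> has unrelated values. In the strip \<open>z0\<close> is the only zero of the denominator, so
  \<open>exp z (z - z0)/(exp z - exp z0)\<close> extends to a holomorphic function with value 1 at \<open>z0\<close>.
\<close>

lemma cauchy_formula_strip:
  fixes \<Phi> :: "complex \<Rightarrow> complex"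
  assumes cont: "continuous_on {z. 0 \<le> Im z \<and> Im z \<le> 2 * pi} \<Phi>"
    and hol: "\<Phi> holomorphic_on {z. 0 < Im z \<and> Im z < 2 * pi}"
    and z0: "x1 < Re z0" "Re z0 < x2" "0 < Im z0" "Im z0 < 2 * pi"
  defines "k \<equiv> (\<lambda>z. \<Phi> z * (exp z / (exp z - exp z0)))"
  shows "integral {x1..x2} (\<lambda>x. k (Complex x 0)) + \<i> * integral {0..2 * pi} (\<lambda>y. k (Complex x2 y))
    - integral {x1..x2} (\<lambda>x. k (Complex x (2 * pi))) - \<i> * integral {0..2 * pi} (\<lambda>y. k (Complex x1 y))
    = 2 * pi * \<i> * \<Phi> z0"
proof -
  define S where "S = {z. 0 \<le> Im z \<and> Im z \<le> 2 * pi}"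
  define U where "U = {z. 0 < Im z \<and> Im z < 2 * pi}"
  define S' where "S' = {z. Im z0 - 2 * pi < Im z \<and> Im z < Im z0 + 2 * pi}"
  have S'_open: "open S'" and U_open: "open U"
    unfolding S'_def U_def by (intro open_Collect_conj open_Collect_less continuous_intros)+
  have sub: "S \<subseteq> S'" "U \<subseteq> S" using z0 by (auto simp: S_def S'_def U_def)
  have U_int: "U \<subseteq> interior S" by (rule interior_maximal[OF sub(2) U_open])
  have interior_U: "interior S \<subseteq> U"
  proof
    fix z assume "z \<in> interior S"
    then obtain e where e: "e > 0" "ball z e \<subseteq> S" by (meson mem_interior)
    have "z - \<i> * of_real (e / 2) \<in> ball z e" "z + \<i> * of_real (e / 2) \<in> ball z e"
      using e by (auto simp: dist_norm norm_mult)
    then have "z - \<i> * of_real (e / 2) \<in> S" "z + \<i> * of_real (e / 2) \<in> S" using e by auto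
    then show "z \<in> U" using e by (auto simp: S_def U_def)
  qed
  have zero: "z = z0" if zS: "z \<in> S'" and ez: "exp z = exp z0" for z
  proof -
    obtain n :: int where n: "z = z0 + of_int (2 * n) * of_real pi * \<i>"
      using ez by (auto simp: exp_eq)
    then have "Im z = Im z0 + of_int (2 * n) * pi" by simp
    then have "- 1 * pi < real_of_int n * pi" "real_of_int n * pi < 1 * pi"
      using zS by (auto simp: S'_def mult.commute)
    then have "- 1 < real_of_int n" "real_of_int n < 1"
      by (simp_all only: mult_less_cancel_right_pos pi_gt_zero)
    then have "n = 0" by linarith
    then show ?thesis using n by simp
  qed
  have dexp: "((\<lambda>z. (exp z - exp z0) / (z - z0)) \<longlongrightarrow> exp z0) (at z0)"
    using DERIV_exp[of z0] by (simp add: has_field_derivative_iff)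
  have lim: "((\<lambda>z. exp z * inverse ((exp z - exp z0) / (z - z0))) \<longlongrightarrow> exp z0 * inverse (exp z0)) (at z0)"
    by (intro tendsto_intros tendsto_inverse[OF dexp]) auto
  define w where "w = (\<lambda>z. if z = z0 then 1 else exp z * inverse ((exp z - exp z0) / (z - z0)))"
  have w_hol: "w holomorphic_on S'"
    unfolding w_def
  proof (rule removable_singularity[OF _ S'_open])
    show "(\<lambda>z. exp z * inverse ((exp z - exp z0) / (z - z0))) holomorphic_on S' - {z0}"
      using zero by (intro holomorphic_intros) auto
    show "((\<lambda>z. exp z * inverse ((exp z - exp z0) / (z - z0))) \<longlongrightarrow> 1) (at z0)" using lim by simp
  qed
  define R where "R = rectpath (Complex x1 0) (Complex x2 (2 * pi))"
  have img: "path_image R \<subseteq> S - {z0}"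
  proof
    fix z assume "z \<in> path_image R"
    then have "(Re z \<in> {x1, x2} \<and> Im z \<in> {0..2 * pi}) \<or> (Im z \<in> {0, 2 * pi} \<and> Re z \<in> {x1..x2})"
      using z0 unfolding R_def by (subst (asm) path_image_rectpath) auto
    then show "z \<in> S - {z0}" using z0 by (auto simp: S_def)
  qed
  have wn: "winding_number R z0 = 1"
    unfolding R_def by (rule winding_number_rectpath) (use z0 in \<open>auto simp: in_box_complex_iff\<close>)
  have "((\<lambda>z. \<Phi> z * w z / (z - z0)) has_contour_integral 2 * pi * \<i> * winding_number R z0 * (\<Phi> z0 * w z0)) R"
  proof (rule Cauchy_integral_formula_weak[where S = S and k = "{}"])
    show "convex S"
    proof -
      have "S = {z. 0 \<le> \<i> \<bullet> z} \<inter> {z. \<i> \<bullet> z \<le> 2 * pi}" by (auto simp: S_def inner_complex_def)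
      then show ?thesis by (metis convex_Int convex_halfspace_ge convex_halfspace_le)
    qed
    show "continuous_on S (\<lambda>z. \<Phi> z * w z)"
      using cont holomorphic_on_imp_continuous_on[OF w_hol] sub
      by (intro continuous_on_mult) (auto simp: S_def intro: continuous_on_subset)
    show "(\<lambda>z. \<Phi> z * w z) field_differentiable at z" if "z \<in> interior S - {}" for z
    proof -
      have "(\<lambda>z. \<Phi> z * w z) holomorphic_on U"
        using hol w_hol sub by (intro holomorphic_on_mult) (auto simp: U_def intro: holomorphic_on_subset)
      then show ?thesis using that interior_U U_open holomorphic_on_imp_differentiable_at by blast
    qed
    show "z0 \<in> interior S - {}" using U_int z0 by (auto simp: U_def)
    show "path_image R \<subseteq> S - {z0}" by (rule img)
  qed (auto simp: R_def)
  then have "((\<lambda>z. \<Phi> z * w z / (z - z0)) has_contour_integral 2 * pi * \<i> * \<Phi> z0) R"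
    using wn by (simp add: w_def)
  moreover have "\<Phi> z * w z / (z - z0) = k z" if "z \<in> path_image R" for z
    using img that by (auto simp: w_def k_def divide_simps)
  ultimately have c1: "(k has_contour_integral 2 * pi * \<i> * \<Phi> z0) R"
    using has_contour_integral_eq by blast
  have kc: "continuous_on (path_image R) k"
    unfolding k_def using img zero sub
    by (intro continuous_intros continuous_on_subset[OF cont]) (auto simp: S_def)
  from has_contour_integral_unique[OF c1 has_contour_integral_rectpath[of x1 x2 0 "2 * pi" k, folded R_def, OF _ _ kc]] z0
  show ?thesis by simp
qed

lemma tendsto_truncated_integral:
  fixes g k :: "real \<Rightarrow> complex"
  assumes g: "set_integrable lborel {0<..} g"
    and k: "continuous_on {0<..} k" "\<And>t. t > 0 \<Longrightarrow> norm (k t) \<le> B"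
    and w: "\<And>n. continuous_on {0<..} (w n)" "\<And>n t. t \<in> {a n..c n} \<Longrightarrow> norm (w n t) \<le> 1"
      "\<And>t. t > 0 \<Longrightarrow> (\<lambda>n. w n t) \<longlonglongrightarrow> 1"
    and a: "\<And>n. a n > 0" "a \<longlonglongrightarrow> 0" and c: "filterlim c at_top sequentially"
  shows "(\<lambda>n. LINT t:{a n..c n}|lborel. g t * (w n t * k t)) \<longlonglongrightarrow> (LINT t:{0<..}|lborel. g t * k t)"
  unfolding set_lebesgue_integral_def
proof (rule integral_dominated_convergence)
  have B0: "B \<ge> 0" using k(2)[of 1] norm_ge_zero[of "k 1"] by linarith
  show "(\<lambda>t. indicator {0<..} t *\<^sub>R (g t * k t)) \<in> borel_measurable lborel"
  proof -
    have "set_integrable lborel {0<..} (\<lambda>t. g t * k t)"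
      by (rule set_integrable_mult_bounded(1)[OF g set_borel_measurable_continuous_on[OF _ k(1)] k(2)]) auto
    then show ?thesis unfolding set_integrable_def by (rule borel_measurable_integrable)
  qed
  show "(\<lambda>t. indicator {a n..c n} t *\<^sub>R (g t * (w n t * k t))) \<in> borel_measurable lborel" for n
  proof -
    have sub: "{a n..c n} \<subseteq> {0<..}" using a(1)[of n] by auto
    have gn: "set_integrable lborel {a n..c n} g" by (rule set_integrable_subset[OF g _ sub]) simp
    have "set_borel_measurable lborel {a n..c n} (\<lambda>t. w n t * k t)"
      by (intro set_borel_measurable_continuous_on continuous_on_mult continuous_on_subset[OF k(1) sub] continuous_on_subset[OF w(1) sub]) simp
    moreover have "norm (w n t * k t) \<le> 1 * B" if "t \<in> {a n..c n}" for t
      unfolding norm_mult using w(2)[OF that] k(2)[of t] sub that by (intro mult_mono) auto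
    ultimately have "set_integrable lborel {a n..c n} (\<lambda>t. g t * (w n t * k t))"
      by (rule set_integrable_mult_bounded(1)[OF gn])
    then show ?thesis unfolding set_integrable_def by (rule borel_measurable_integrable)
  qed
  show "integrable lborel (\<lambda>t. norm (indicator {0<..} t *\<^sub>R g t) * B)"
    using g unfolding set_integrable_def by (intro integrable_mult_left integrable_norm) auto
  show "AE t in lborel. (\<lambda>n. indicator {a n..c n} t *\<^sub>R (g t * (w n t * k t))) \<longlonglongrightarrow> indicator {0<..} t *\<^sub>R (g t * k t)"
  proof (rule AE_I2)
    fix t :: real
    show "(\<lambda>n. indicator {a n..c n} t *\<^sub>R (g t * (w n t * k t))) \<longlonglongrightarrow> indicator {0<..} t *\<^sub>R (g t * k t)"
    proof (cases "t > 0")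
      case True
      have lim: "(\<lambda>n. g t * (w n t * k t)) \<longlonglongrightarrow> g t * (1 * k t)"
        by (intro tendsto_intros w True)
      have "\<forall>\<^sub>F n in sequentially. a n < t" using a(2) True by (rule order_tendstoD)
      moreover have "\<forall>\<^sub>F n in sequentially. t \<le> c n" using c by (simp add: filterlim_at_top)
      ultimately have "\<forall>\<^sub>F n in sequentially. g t * (w n t * k t) = indicator {a n..c n} t *\<^sub>R (g t * (w n t * k t))"
        by eventually_elim simp
      from Lim_transform_eventually[OF lim this] show ?thesis using True by simp
    next
      case False
      then have "indicator {a n..c n} t = (0::real)" for n using a(1)[of n] by auto
      then show ?thesis using False by simp
    qed
  qed
  show "AE t in lborel. norm (indicator {a n..c n} t *\<^sub>R (g t * (w n t * k t))) \<le> norm (indicator {0<..} t *\<^sub>R g t) * B" for n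
  proof (rule AE_I2)
    fix t :: real
    show "norm (indicator {a n..c n} t *\<^sub>R (g t * (w n t * k t))) \<le> norm (indicator {0<..} t *\<^sub>R g t) * B"
    proof (cases "t \<in> {a n..c n}")
      case True
      then have t: "t > 0" using a(1)[of n] by auto
      have "norm (w n t) * norm (k t) \<le> 1 * B" using w(2)[OF True] k(2)[OF t] by (intro mult_mono) auto
      then show ?thesis using True t by (simp add: norm_mult mult_left_mono)
    qed (use B0 in simp)
  qed
qed

lemma set_integrable_powr_decay:
  fixes g :: "real \<Rightarrow> complex"
  assumes cont: "continuous_on {0<..} g" and \<delta>: "\<delta> > 0" "set_integrable lborel {0<..<\<delta>} g"
    and \<alpha>: "\<alpha> > 1" and tail: "\<And>t. t \<ge> T \<Longrightarrow> norm (g t) \<le> K * t powr (- \<alpha>)"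
  shows "set_integrable lborel {0<..} g"
proof -
  define T' where "T' = max \<delta> T"
  have T': "T' > 0" "T' \<ge> T" "T' \<ge> \<delta>" using \<delta> by (auto simp: T'_def)
  have mid: "set_integrable lborel {\<delta>..T'} g"
    by (intro borel_integrable_atLeastAtMost' continuous_on_subset[OF cont]) (use \<delta> in auto)
  have pw: "set_integrable lborel {T'..} (\<lambda>t. t powr (- \<alpha>))"
  proof -
    have "(\<lambda>t. t powr (- \<alpha>)) integrable_on {T'..}"
      using has_integral_powr_to_inf[of "- \<alpha>" T'] \<alpha> T' by (auto simp: integrable_on_def)
    then have "(\<lambda>t. t powr (- \<alpha>)) absolutely_integrable_on {T'..}"
      by (intro nonnegative_absolutely_integrable_1) auto
    then show ?thesis unfolding set_integrable_def by (subst (asm) integrable_completion) auto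
  qed
  have "set_integrable lborel {T'..} g"
  proof (rule set_integrable_bound)
    show "set_integrable lborel {T'..} (\<lambda>t. K * t powr (- \<alpha>))" by (intro set_integrable_mult_right pw)
    show "set_borel_measurable lborel {T'..} g"
      unfolding set_borel_measurable_def measurable_lborel2
      by (intro borel_measurable_continuous_on_indicator continuous_on_subset[OF cont]) (use T' in auto)
    show "AE t in lborel. t \<in> {T'..} \<longrightarrow> norm (g t) \<le> norm (K * t powr (- \<alpha>))"
    proof (intro AE_I2 impI)
      fix t :: real assume "t \<in> {T'..}"
      then have "norm (g t) \<le> K * t powr (- \<alpha>)" using T' by (intro tail) auto
      then show "norm (g t) \<le> norm (K * t powr (- \<alpha>))" using abs_ge_self[of "K * t powr (- \<alpha>)"] unfolding real_norm_def by linarith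
    qed
  qed
  with mid \<delta>(2) have "set_integrable lborel ({0<..<\<delta>} \<union> {\<delta>..T'} \<union> {T'..}) g"
    by (intro set_integrable_Un) auto
  moreover have "{0<..<\<delta>} \<union> {\<delta>..T'} \<union> {T'..} = {0<..}" using T' \<delta> by auto
  ultimately show ?thesis by simp
qed

text \<open>
  Up to the factor 2, the point of a ray on the circle through q is as close to q as any other point.
  This compares the distance to the cut with the distance to the point where the weight vanishes.
\<close>

lemma norm_diff_nonneg_real_ge:
  fixes q :: complex
  assumes "t \<ge> 0"
  shows "norm (q - of_real (norm q)) \<le> 2 * norm (q - of_real t)"
proof -
  have "norm (of_real t - of_real (norm q) :: complex) = \<bar>norm (of_real t :: complex) - norm q\<bar>"
    using assms by (simp flip: of_real_diff)
  also have "\<dots> \<le> norm (of_real t - q)" by (rule norm_triangle_ineq3)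
  finally have "norm (of_real t - of_real (norm q) :: complex) \<le> norm (q - of_real t)"
    by (simp add: norm_minus_commute)
  then show ?thesis using norm_triangle_ineq[of "q - of_real t" "of_real t - of_real (norm q)"] by simp
qed

text \<open>
  With \<open>q = exp z\<close> and \<open>\<rho> = e\<^sup>8\<close> this is \<open>(1 - \<rho>/q)\<^sup>2 (\<surd>q/(\<surd>q + i e))\<^sup>4\<close>. The first factor vanishes to second
  order at \<open>q = \<rho>\<close>, on both sides of the cut, and is at most 1 for real \<open>q \<ge> \<rho>\<close>. The second is
  bounded by 1, since \<open>\<surd>q\<close> lies in the closed upper half plane, and by \<open>\<rho>\<^sup>2/e\<^sup>4\<close> on the circle
  \<open>|q| = \<rho>\<close>. The exponents are chosen such that the contribution of this circle is of order
  \<open>\<rho>\<^sup>-\<^sup>2 \<cdot> \<rho>\<^sup>2/e\<^sup>4 \<cdot> \<rho> = e\<^sup>4\<close>.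
\<close>

definition strip_weight :: "real \<Rightarrow> complex \<Rightarrow> complex" where
  "strip_weight e z = (1 - of_real (e ^ 8) * exp (- z))\<^sup>2 * (exp (z / 2) / (exp (z / 2) + \<i> * of_real e)) ^ 4"

lemma strip_half_exp:
  assumes "0 \<le> Im z" "Im z \<le> 2 * pi" "e > 0"
  shows "norm (exp (z / 2)) \<le> norm (exp (z / 2) + \<i> * of_real e)"
    and "e \<le> norm (exp (z / 2) + \<i> * of_real e)"
    and "exp (z / 2) + \<i> * of_real e \<noteq> 0"
proof -
  define u where "u = exp (z / 2)"
  have "Im u \<ge> 0" unfolding u_def using assms by (auto simp: Im_exp intro!: mult_nonneg_nonneg sin_ge_zero)
  then have Imu: "Im u \<ge> 0" .
  have *: "(norm (u + \<i> * of_real e))\<^sup>2 = (norm u)\<^sup>2 + 2 * e * Im u + e\<^sup>2"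
    unfolding cmod_power2 by (simp add: power2_eq_square algebra_simps)
  have n: "2 * e * Im u \<ge> 0" using Imu assms by simp
  have "(norm u)\<^sup>2 \<le> (norm (u + \<i> * of_real e))\<^sup>2" "e\<^sup>2 \<le> (norm (u + \<i> * of_real e))\<^sup>2"
    unfolding * using n by auto
  then show 1: "norm (exp (z / 2)) \<le> norm (exp (z / 2) + \<i> * of_real e)"
    and 2: "e \<le> norm (exp (z / 2) + \<i> * of_real e)"
    unfolding u_def using assms by (auto intro: power2_le_imp_le)
  show "exp (z / 2) + \<i> * of_real e \<noteq> 0" using 2 assms by auto
qed

lemma norm_strip_weight_le:
  assumes "0 \<le> Im z" "Im z \<le> 2 * pi" "e > 0"
  shows "norm (strip_weight e z) \<le> (norm (1 - of_real (e ^ 8) * exp (- z)))\<^sup>2"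
    and "norm (strip_weight e z) \<le> (norm (1 - of_real (e ^ 8) * exp (- z)))\<^sup>2 * (exp (2 * Re z) / e ^ 4)"
proof -
  note h = strip_half_exp[OF assms]
  let ?r = "norm (exp (z / 2)) / norm (exp (z / 2) + \<i> * of_real e)"
  have eq: "norm (strip_weight e z) = (norm (1 - of_real (e ^ 8) * exp (- z)))\<^sup>2 * ?r ^ 4"
    by (simp only: strip_weight_def norm_mult norm_power norm_divide)
  have "?r \<le> 1" using h by (simp add: divide_simps)
  then have "?r ^ 4 \<le> 1" by (intro power_le_one) auto
  then show "norm (strip_weight e z) \<le> (norm (1 - of_real (e ^ 8) * exp (- z)))\<^sup>2"
    unfolding eq by (intro mult_left_le) auto
  have "?r \<le> norm (exp (z / 2)) / e" using h assms by (intro divide_left_mono) auto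
  then have "?r ^ 4 \<le> (norm (exp (z / 2)) / e) ^ 4" by (intro power_mono) auto
  also have "\<dots> = exp (2 * Re z) / e ^ 4" by (simp add: power_divide flip: exp_of_nat_mult)
  finally show "norm (strip_weight e z) \<le> (norm (1 - of_real (e ^ 8) * exp (- z)))\<^sup>2 * (exp (2 * Re z) / e ^ 4)"
    unfolding eq by (intro mult_left_mono) auto
qed

lemma continuous_on_strip_weight:
  assumes "e > 0" "A \<subseteq> {z. 0 \<le> Im z \<and> Im z \<le> 2 * pi}"
  shows "continuous_on A (strip_weight e)"
  unfolding strip_weight_def[abs_def] using strip_half_exp(3)[OF _ _ assms(1)] assms(2)
  by (intro continuous_intros) auto

lemma holomorphic_on_strip_weight:
  assumes "e > 0" "A \<subseteq> {z. 0 \<le> Im z \<and> Im z \<le> 2 * pi}"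
  shows "strip_weight e holomorphic_on A"
  unfolding strip_weight_def[abs_def] using strip_half_exp(3)[OF _ _ assms(1)] assms(2)
  by (intro holomorphic_intros) auto

lemma strip_weight_tendsto_1:
  assumes "e \<longlonglongrightarrow> 0"
  shows "(\<lambda>n. strip_weight (e n) z) \<longlonglongrightarrow> 1"
proof -
  have "(\<lambda>n. strip_weight (e n) z) \<longlonglongrightarrow>
      (1 - of_real (0 ^ 8) * exp (- z))\<^sup>2 * (exp (z / 2) / (exp (z / 2) + \<i> * of_real 0)) ^ 4"
    unfolding strip_weight_def by (intro tendsto_intros assms) auto
  then show ?thesis by simp
qed

lemma zero_less_two_pi: "0 < 2 * pi"
  by simp

section \<open>The two-sided slit plane as a strip\<close>

lemma pi_not_le_0: "\<not> pi \<le> 0"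
  by (simp add: not_le)

lemma exp_strip_neq_nonneg:
  assumes "0 < Im z" "Im z < 2 * pi" "t \<ge> 0"
  shows "exp z \<noteq> of_real t"
proof
  assume e: "exp z = of_real t"
  then have "t \<noteq> 0" by auto
  with assms have "exp z = exp (of_real (ln t))" using e by (simp add: exp_of_real)
  then obtain n :: int where n: "z = of_real (ln t) + of_int (2 * n) * of_real pi * \<i>" by (auto simp: exp_eq)
  then have "Im z = of_int (2 * n) * pi" by simp
  then have "0 * pi < real_of_int n * pi" "real_of_int n * pi < 1 * pi" using assms by (auto simp: mult.commute)
  then have "0 < real_of_int n" "real_of_int n < 1"
    by (simp_all only: mult_less_cancel_right_pos pi_gt_zero)
  then have "0 < n" "n < 1" by simp_all
  then show False by simp
qed

locale slit_function =
  fixes F :: "complex \<Rightarrow> complex" and \<theta> \<alpha> C :: real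
  assumes branch: "integrable_branch_point F \<theta>"
    and alpha: "\<alpha> > 1"
    and decay: "\<forall>\<^sub>F p in at_infinity. p \<notin> cut_ray \<theta> \<longrightarrow> norm (F p) \<le> C * norm p powr (- \<alpha>)"
    and locally_integrable: "\<And>K. compact K \<Longrightarrow> set_integrable lborel (K - cut_ray \<theta>) F"
    and holomorphic_off_cut: "F holomorphic_on (- cut_ray \<theta>)"
    and continuable: "continuable_through_cut F \<theta>"
begin

text \<open>
  Uniformises the complement of the cut: the open strip \<open>0 < Im z < 2\<pi>\<close> is mapped onto it, the line
  \<open>Im z = 0\<close> is the side of larger argument and \<open>Im z = 2\<pi>\<close> the side of smaller argument.
\<close>

definition sheet :: "complex \<Rightarrow> complex" where
  "sheet z = 1 + cis \<theta> * exp z"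

definition lift :: "complex \<Rightarrow> complex" where
  "lift z = (if Im z \<le> 0 then plus_value F \<theta> (exp (Re z))
     else if Im z \<ge> 2 * pi then minus_value F \<theta> (exp (Re z)) else F (sheet z))"

definition closed_strip :: "complex set" where
  "closed_strip = {z. 0 \<le> Im z \<and> Im z \<le> 2 * pi}"

lemma sheet_rotated: "(sheet z - 1) * cis (- \<theta>) = exp z"
proof -
  have "(sheet z - 1) * cis (- \<theta>) = exp z * (cis \<theta> * cis (- \<theta>))" by (simp add: sheet_def mult_ac)
  then show ?thesis by (simp add: cis_mult)
qed

lemma point_rotated: "(polar_point \<phi> t - 1) * cis (- \<theta>) = of_real t * cis (\<phi> - \<theta>)"
  by (simp add: cis_mult mult.assoc)

lemma sheet_notin_cut:
  assumes "0 < Im z" "Im z < 2 * pi"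
  shows "sheet z \<notin> cut_ray \<theta>"
proof
  assume "sheet z \<in> cut_ray \<theta>"
  then obtain t where t: "t \<ge> 0" "sheet z = polar_point \<theta> t" by (auto simp: cut_ray_def)
  have "exp z = of_real t * cis (\<theta> - \<theta>)"
    using sheet_rotated[of z] point_rotated[of t \<theta>] t(2) by simp
  then show False using exp_strip_neq_nonneg[OF assms t(1)] by simp
qed

lemma notin_cut_obtain_sheet:
  assumes "p \<notin> cut_ray \<theta>"
  obtains z where "0 < Im z" "Im z < 2 * pi" "p = sheet z"
proof -
  define q where "q = (p - 1) * cis (- \<theta>)"
  have "cis \<theta> * q = (p - 1) * (cis \<theta> * cis (- \<theta>))" unfolding q_def by (simp only: mult_ac)
  then have pq: "p = 1 + cis \<theta> * q" by (simp add: cis_mult)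
  have "- q \<notin> \<real>\<^sub>\<le>\<^sub>0"
  proof
    assume "- q \<in> \<real>\<^sub>\<le>\<^sub>0"
    then obtain t where "t \<le> 0" "- q = of_real t" by (auto simp: nonpos_Reals_def)
    then have q: "q = of_real (- t)" by (metis minus_minus of_real_minus)
    then have "p = polar_point \<theta> (- t)" using pq by (simp only: mult.commute)
    moreover have "- t \<ge> 0" using \<open>t \<le> 0\<close> by simp
    ultimately have "p \<in> cut_ray \<theta>" unfolding cut_ray_def by blast
    then show False using assms by simp
  qed
  then have q0: "- q \<noteq> 0" and im: "- pi < Im (Ln (- q))" "Im (Ln (- q)) < pi"
    using mpi_less_Im_Ln[of "- q"] Im_Ln_less_pi[of "- q"] by (auto simp: complex_nonpos_Reals_iff complex_eq_iff)
  have "exp (Ln (- q) + \<i> * of_real pi) = q" using q0 by (simp add: exp_add)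
  then show thesis using im by (intro that[of "Ln (- q) + \<i> * of_real pi"]) (auto simp: sheet_def pq)
qed

lemma open_off_cut: "open (- cut_ray \<theta>)"
proof -
  have "cut_ray \<theta> = (\<lambda>p. (p - 1) * cis (- \<theta>)) -` \<real>\<^sub>\<ge>\<^sub>0"
  proof (intro set_eqI iffI)
    fix p assume "p \<in> cut_ray \<theta>"
    then obtain t where t: "t \<ge> 0" "p = polar_point \<theta> t" by (auto simp: cut_ray_def)
    then have "(p - 1) * cis (- \<theta>) = of_real t" by (simp only: point_rotated diff_self cis_zero mult_1_right)
    with t(1) show "p \<in> (\<lambda>p. (p - 1) * cis (- \<theta>)) -` \<real>\<^sub>\<ge>\<^sub>0"
      by (simp only: vimage_eq nonneg_Reals_of_real_iff)
  next
    fix p assume "p \<in> (\<lambda>p. (p - 1) * cis (- \<theta>)) -` \<real>\<^sub>\<ge>\<^sub>0"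
    then obtain t where t: "t \<ge> 0" "(p - 1) * cis (- \<theta>) = of_real t" by (auto simp: nonneg_Reals_def)
    have "p - 1 = ((p - 1) * cis (- \<theta>)) * cis \<theta>" by (simp add: cis_mult mult.assoc)
    then have "p = polar_point \<theta> t" unfolding t(2) by (simp add: algebra_simps)
    with t(1) show "p \<in> cut_ray \<theta>" by (auto simp: cut_ray_def)
  qed
  moreover have "closed ((\<lambda>p. (p - 1) * cis (- \<theta>)) -` \<real>\<^sub>\<ge>\<^sub>0)"
    by (intro closed_vimage closed_nonneg_Reals_complex continuous_intros)
  ultimately show ?thesis by auto
qed

lemma boundary_extensions:
  assumes "t > 0"
  obtains r G H where "r > 0"
    "continuous_on (ball (polar_point \<theta> t) r) G" "continuous_on (ball (polar_point \<theta> t) r) H"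
    "\<And>p. p \<in> ball (polar_point \<theta> t) r \<Longrightarrow> Im ((p - 1) * cis (- \<theta>)) > 0 \<Longrightarrow> F p = G p"
    "\<And>p. p \<in> ball (polar_point \<theta> t) r \<Longrightarrow> Im ((p - 1) * cis (- \<theta>)) < 0 \<Longrightarrow> F p = H p"
proof -
  let ?B = "\<lambda>r. ball (polar_point \<theta> t) r"
  obtain r G H where r: "r > 0" and hol: "G holomorphic_on ?B r" "H holomorphic_on ?B r"
    and eq: "\<forall>p \<in> ?B r. (Im ((p - 1) * cis (- \<theta>)) > 0 \<longrightarrow> F p = G p) \<and>
       (Im ((p - 1) * cis (- \<theta>)) < 0 \<longrightarrow> F p = H p)"
    using continuable[unfolded continuable_through_cut_def, rule_format, OF assms] by blast
  show thesis
    by (rule that[OF r hol[THEN holomorphic_on_imp_continuous_on]]) (use eq in blast)+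
qed

lemma eventually_angle_right: "\<forall>\<^sub>F \<phi> in at_right \<theta>. \<theta> < \<phi> \<and> \<phi> < \<theta> + pi"
  by (rule eventually_at_rightI[of \<theta> "\<theta> + pi"]) auto

lemma eventually_angle_left: "\<forall>\<^sub>F \<phi> in at_left \<theta>. \<theta> - pi < \<phi> \<and> \<phi> < \<theta>"
  by (rule eventually_at_leftI[of "\<theta> - pi" \<theta>]) auto

lemma side_limit:
  assumes p: "polar_point \<theta> t \<in> ball c r" and G: "continuous_on (ball c r) G"
    and net: "((\<lambda>\<phi>. \<phi>) \<longlongrightarrow> \<theta>) net"
    and eq: "\<forall>\<^sub>F \<phi> in net. polar_point \<phi> t \<in> ball c r \<longrightarrow> G (polar_point \<phi> t) = F (polar_point \<phi> t)"
  shows "((\<lambda>\<phi>. F (polar_point \<phi> t)) \<longlongrightarrow> G (polar_point \<theta> t)) net"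
proof -
  have lim: "((\<lambda>\<phi>. polar_point \<phi> t) \<longlongrightarrow> polar_point \<theta> t) net"
    by (intro tendsto_intros net)
  have "((\<lambda>\<phi>. G (polar_point \<phi> t)) \<longlongrightarrow> G (polar_point \<theta> t)) net"
    using G p lim by (intro isCont_tendsto_compose[of _ G]) (auto simp: continuous_on_eq_continuous_at)
  moreover have "\<forall>\<^sub>F \<phi> in net. G (polar_point \<phi> t) = F (polar_point \<phi> t)"
    using topological_tendstoD[OF lim open_ball p] eq by eventually_elim blast
  ultimately show ?thesis by (rule Lim_transform_eventually)
qed

lemma plus_value_limit:
  assumes t: "t > 0" and p: "polar_point \<theta> t \<in> ball c r" and G: "continuous_on (ball c r) G"
    and eq: "\<And>p. p \<in> ball c r \<Longrightarrow> Im ((p - 1) * cis (- \<theta>)) > 0 \<Longrightarrow> F p = G p"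
  shows "((\<lambda>\<phi>. F (polar_point \<phi> t)) \<longlongrightarrow> G (polar_point \<theta> t)) (at_right \<theta>)"
proof (rule side_limit[OF p G tendsto_ident_at])
  show "\<forall>\<^sub>F \<phi> in at_right \<theta>. polar_point \<phi> t \<in> ball c r \<longrightarrow> G (polar_point \<phi> t) = F (polar_point \<phi> t)"
    using eventually_angle_right
  proof eventually_elim
    case (elim \<phi>)
    then have "sin (\<phi> - \<theta>) > 0" by (intro sin_gt_zero) auto
    then have "Im ((polar_point \<phi> t - 1) * cis (- \<theta>)) > 0" unfolding point_rotated using t by simp
    then show ?case using eq by simp
  qed
qed

lemma minus_value_limit:
  assumes t: "t > 0" and p: "polar_point \<theta> t \<in> ball c r" and H: "continuous_on (ball c r) H"
    and eq: "\<And>p. p \<in> ball c r \<Longrightarrow> Im ((p - 1) * cis (- \<theta>)) < 0 \<Longrightarrow> F p = H p"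
  shows "((\<lambda>\<phi>. F (polar_point \<phi> t)) \<longlongrightarrow> H (polar_point \<theta> t)) (at_left \<theta>)"
proof (rule side_limit[OF p H tendsto_ident_at])
  show "\<forall>\<^sub>F \<phi> in at_left \<theta>. polar_point \<phi> t \<in> ball c r \<longrightarrow> H (polar_point \<phi> t) = F (polar_point \<phi> t)"
    using eventually_angle_left
  proof eventually_elim
    case (elim \<phi>)
    then have "sin (- (\<phi> - \<theta>)) > 0" by (intro sin_gt_zero) auto
    then have "sin (\<phi> - \<theta>) < 0" by (simp only: sin_minus)
    then have "Im ((polar_point \<phi> t - 1) * cis (- \<theta>)) < 0"
      unfolding point_rotated using t by (simp add: mult_pos_neg)
    then show ?case using eq by simp
  qed
qed

lemma isCont_sheet: "isCont sheet z"
  unfolding sheet_def[abs_def] by (intro continuous_intros)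

text \<open>
  Near a boundary point \<open>lift\<close> is the composition of \<open>sheet\<close> with the local continuation of F through the
  corresponding side of the cut.
\<close>

lemma continuous_on_lift: "continuous_on closed_strip lift"
  unfolding continuous_on_def
proof
  fix z assume z: "z \<in> closed_strip"
  have lim_sheet: "(sheet \<longlongrightarrow> sheet z) (at z within closed_strip)"
    using isCont_sheet[of z] continuous_at_imp_continuous_within unfolding continuous_within by blast
  have lim_Im: "(Im \<longlongrightarrow> Im z) (at z within closed_strip)"
    by (intro tendsto_intros tendsto_ident_at)
  have in_strip: "\<forall>\<^sub>F w in at z within closed_strip. w \<in> closed_strip"
    by (auto simp: eventually_at_filter)
  let ?t = "exp (Re z)"
  obtain r G H where r: "r > 0"
    and G: "continuous_on (ball (polar_point \<theta> ?t) r) G"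
      "\<And>p. p \<in> ball (polar_point \<theta> ?t) r \<Longrightarrow> Im ((p - 1) * cis (- \<theta>)) > 0 \<Longrightarrow> F p = G p"
    and H: "continuous_on (ball (polar_point \<theta> ?t) r) H"
      "\<And>p. p \<in> ball (polar_point \<theta> ?t) r \<Longrightarrow> Im ((p - 1) * cis (- \<theta>)) < 0 \<Longrightarrow> F p = H p"
    using boundary_extensions[of ?t] by (metis exp_gt_zero)
  have exp_real: "exp w = of_real (exp (Re w))" if "Im w = 0 \<or> Im w = 2 * pi" for w
    using that by (auto simp: complex_eq_iff Re_exp Im_exp)
  show "(lift \<longlongrightarrow> lift z) (at z within closed_strip)"
  proof (cases "Im z = 0 \<or> Im z = 2 * pi")
    case False
    then have zi: "0 < Im z" "Im z < 2 * pi" using z by (auto simp: closed_strip_def)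
    have "isCont F (sheet z)"
    proof -
      show ?thesis
        using holomorphic_on_imp_continuous_on[OF holomorphic_off_cut] sheet_notin_cut[OF zi] open_off_cut
        by (auto simp: continuous_on_eq_continuous_at)
    qed
    then have "((\<lambda>w. F (sheet w)) \<longlongrightarrow> F (sheet z)) (at z within closed_strip)"
      using lim_sheet by (rule isCont_tendsto_compose)
    moreover have "\<forall>\<^sub>F w in at z within closed_strip. 0 < Im w" "\<forall>\<^sub>F w in at z within closed_strip. Im w < 2 * pi"
      using order_tendstoD[OF lim_Im] zi by auto
    then have "\<forall>\<^sub>F w in at z within closed_strip. F (sheet w) = lift w"
      by eventually_elim (simp add: lift_def)
    ultimately show ?thesis using zi by (auto simp: lift_def intro: Lim_transform_eventually)
  next
    case True
    have sz: "sheet z = polar_point \<theta> ?t" using exp_real[OF True] by (simp add: sheet_def mult.commute)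
    \<comment> \<open>P keeps w away from the opposite side of the strip\<close>
    have by_extension: "(lift \<longlongrightarrow> lift z) (at z within closed_strip)"
      if Q: "continuous_on (ball (polar_point \<theta> ?t) r) Q"
        and near: "\<forall>\<^sub>F w in at z within closed_strip. P w" "P z"
        and eq: "\<And>w. w \<in> closed_strip \<Longrightarrow> P w \<Longrightarrow> sheet w \<in> ball (polar_point \<theta> ?t) r \<Longrightarrow> Q (sheet w) = lift w" for P Q
    proof -
      have "\<forall>\<^sub>F w in at z within closed_strip. sheet w \<in> ball (polar_point \<theta> ?t) r"
        using topological_tendstoD[OF lim_sheet open_ball] r sz by auto
      with near(1) in_strip have "\<forall>\<^sub>F w in at z within closed_strip. Q (sheet w) = lift w"
        by eventually_elim (rule eq)
      moreover have "isCont Q (sheet z)" using Q r sz by (auto simp: continuous_on_eq_continuous_at)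
      then have "((\<lambda>w. Q (sheet w)) \<longlongrightarrow> Q (sheet z)) (at z within closed_strip)"
        using lim_sheet by (rule isCont_tendsto_compose)
      moreover have "Q (sheet z) = lift z" using z near(2) sz r by (intro eq) auto
      ultimately show ?thesis by (auto intro: Lim_transform_eventually)
    qed
    show ?thesis
    proof (cases "Im z = 0")
      case True
      show ?thesis
      proof (rule by_extension[OF G(1), where P = "\<lambda>w. Im w < pi"])
        show "\<forall>\<^sub>F w in at z within closed_strip. Im w < pi" using order_tendstoD[OF lim_Im] True by auto
        fix w assume w: "w \<in> closed_strip" "Im w < pi" "sheet w \<in> ball (polar_point \<theta> ?t) r"
        show "G (sheet w) = lift w"
        proof (cases "Im w = 0")
          case True
          then have sw: "sheet w = polar_point \<theta> (exp (Re w))" using exp_real[of w] by (simp add: sheet_def mult.commute)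
          have "((\<lambda>\<phi>. F (polar_point \<phi> (exp (Re w)))) \<longlongrightarrow> G (polar_point \<theta> (exp (Re w)))) (at_right \<theta>)"
            by (rule plus_value_limit[OF _ _ G]) (use w sw in auto)
          then have "plus_value F \<theta> (exp (Re w)) = G (sheet w)"
            unfolding plus_value_def sw by (subst tendsto_Lim) auto
          then show ?thesis using True by (simp add: lift_def)
        next
          case False
          then have "0 < Im w" using w by (auto simp: closed_strip_def)
          then have "Im (exp w) > 0" using w by (simp add: Im_exp sin_gt_zero)
          then have "F (sheet w) = G (sheet w)" using G(2)[OF w(3)] by (simp add: sheet_rotated)
          then show ?thesis using \<open>0 < Im w\<close> w by (simp add: lift_def)
        qed
      qed (use True in simp)
    next
      case False
      with True have zt: "Im z = 2 * pi" by simp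
      show ?thesis
      proof (rule by_extension[OF H(1), where P = "\<lambda>w. pi < Im w"])
        show "\<forall>\<^sub>F w in at z within closed_strip. pi < Im w" using order_tendstoD[OF lim_Im] zt by auto
        fix w assume w: "w \<in> closed_strip" "pi < Im w" "sheet w \<in> ball (polar_point \<theta> ?t) r"
        then have "Im w > 0" using pi_gt_zero by linarith
        show "H (sheet w) = lift w"
        proof (cases "Im w = 2 * pi")
          case True
          then have sw: "sheet w = polar_point \<theta> (exp (Re w))" using exp_real[of w] by (simp add: sheet_def mult.commute)
          have "((\<lambda>\<phi>. F (polar_point \<phi> (exp (Re w)))) \<longlongrightarrow> H (polar_point \<theta> (exp (Re w)))) (at_left \<theta>)"
            by (rule minus_value_limit[OF _ _ H]) (use w sw in auto)
          then have "minus_value F \<theta> (exp (Re w)) = H (sheet w)"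
            unfolding minus_value_def sw by (subst tendsto_Lim) auto
          then show ?thesis using True by (simp add: lift_def pi_not_le_0)
        next
          case False
          then have "Im w < 2 * pi" using w by (auto simp: closed_strip_def)
          then have "Im (exp w) < 0" using w sin_lt_zero[of "Im w"] by (simp add: Im_exp mult_pos_neg)
          then have "F (sheet w) = H (sheet w)" using H(2)[OF w(3)] by (simp add: sheet_rotated)
          then show ?thesis using \<open>Im w < 2 * pi\<close> \<open>Im w > 0\<close> by (simp add: lift_def)
        qed
      qed (use zt pi_gt_zero in linarith)
    qed
  qed
qed

lemma holomorphic_on_lift: "lift holomorphic_on {z. 0 < Im z \<and> Im z < 2 * pi}"
proof -
  have "(\<lambda>z. F (sheet z)) holomorphic_on {z. 0 < Im z \<and> Im z < 2 * pi}"
  proof (rule holomorphic_on_compose_gen[of sheet _ F "- cut_ray \<theta>", unfolded comp_def])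
    show "sheet holomorphic_on {z. 0 < Im z \<and> Im z < 2 * pi}"
      unfolding sheet_def[abs_def] by (intro holomorphic_intros)
    show "sheet ` {z. 0 < Im z \<and> Im z < 2 * pi} \<subseteq> - cut_ray \<theta>" using sheet_notin_cut by auto
  qed (rule holomorphic_off_cut)
  then show ?thesis by (rule holomorphic_transform) (auto simp: lift_def)
qed

lemma plus_value_eq_lift: "t > 0 \<Longrightarrow> plus_value F \<theta> t = lift (Complex (ln t) 0)"
  and minus_value_eq_lift: "t > 0 \<Longrightarrow> minus_value F \<theta> t = lift (Complex (ln t) (2 * pi))"
  by (simp_all add: lift_def pi_not_le_0)

lemma continuous_on_plus_value: "continuous_on {0<..} (plus_value F \<theta>)"
  and continuous_on_minus_value: "continuous_on {0<..} (minus_value F \<theta>)"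
proof -
  have c: "continuous_on {0<..} (\<lambda>t. Complex (ln t) y)" for y
    by (auto intro!: continuous_intros)
  have "continuous_on {0<..} (\<lambda>t. lift (Complex (ln t) 0))" "continuous_on {0<..} (\<lambda>t. lift (Complex (ln t) (2 * pi)))"
    by (rule continuous_on_compose2[OF continuous_on_lift c]; auto simp: closed_strip_def)+
  then show "continuous_on {0<..} (plus_value F \<theta>)" "continuous_on {0<..} (minus_value F \<theta>)"
    by (auto intro: continuous_on_eq simp: plus_value_eq_lift minus_value_eq_lift)
qed

text \<open>
  The hypothesis concerns the open strip; continuity of lift carries it to both boundary lines.
\<close>

lemma lift_decay:
  obtains T where "T \<ge> 2" "\<And>z. z \<in> closed_strip \<Longrightarrow> exp (Re z) \<ge> T \<Longrightarrow>
    norm (lift z) \<le> \<bar>C\<bar> * (exp (Re z) / 2) powr (- \<alpha>)"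
proof -
  obtain b where b: "\<And>p. norm p \<ge> b \<Longrightarrow> p \<notin> cut_ray \<theta> \<Longrightarrow> norm (F p) \<le> C * norm p powr (- \<alpha>)"
    using decay by (auto simp: eventually_at_infinity)
  show thesis
  proof (rule that[of "max 2 (2 * b)"])
    fix z assume z: "z \<in> closed_strip" "exp (Re z) \<ge> max 2 (2 * b)"
    let ?bound = "\<bar>C\<bar> * (exp (Re z) / 2) powr (- \<alpha>)"
    have "continuous_on (closure {0<..<2 * pi}) (\<lambda>y. lift (Complex (Re z) y))"
      unfolding closure_greaterThanLessThan[OF zero_less_two_pi]
      by (rule continuous_on_compose2[OF continuous_on_lift continuous_on_Complex_line(2)]) (auto simp: closed_strip_def)
    moreover have "norm (lift (Complex (Re z) y)) \<le> ?bound" if y: "y \<in> {0<..<2 * pi}" for y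
    proof -
      define p where "p = sheet (Complex (Re z) y)"
      have p: "p \<notin> cut_ray \<theta>" unfolding p_def using y by (intro sheet_notin_cut) auto
      have "norm (p - 1) = exp (Re z)" by (simp add: p_def sheet_def norm_mult)
      moreover have "norm (p - 1) \<le> norm p + 1" using norm_triangle_ineq4[of p 1] by simp
      ultimately have n: "norm p \<ge> exp (Re z) / 2" using z(2) by simp
      have "norm (F p) \<le> C * norm p powr (- \<alpha>)" using p n z(2) by (intro b) auto
      also have "\<dots> \<le> \<bar>C\<bar> * norm p powr (- \<alpha>)" by (intro mult_right_mono) auto
      also have "\<dots> \<le> ?bound" using n alpha by (intro mult_left_mono powr_mono2') auto
      finally show ?thesis using y by (simp add: lift_def p_def)
    qed
    ultimately have "norm (lift (Complex (Re z) (Im z))) \<le> ?bound"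
      using z(1) by (intro continuous_on_closure_norm_le[where s = "{0<..<2 * pi}"])
        (auto simp: closure_greaterThanLessThan[OF zero_less_two_pi] closed_strip_def)
    then show "norm (lift z) \<le> ?bound" by simp
  qed simp
qed

lemma integrable_plus_value: "set_integrable lborel {0<..} (plus_value F \<theta>)"
  and integrable_minus_value: "set_integrable lborel {0<..} (minus_value F \<theta>)"
proof -
  obtain \<delta> where \<delta>: "\<delta> > 0" "set_integrable lborel {0<..<\<delta>} (plus_value F \<theta>)"
      "set_integrable lborel {0<..<\<delta>} (minus_value F \<theta>)"
    using branch unfolding integrable_branch_point_def by blast
  obtain T where T: "T \<ge> 2" "\<And>z. z \<in> closed_strip \<Longrightarrow> exp (Re z) \<ge> T \<Longrightarrow>
    norm (lift z) \<le> \<bar>C\<bar> * (exp (Re z) / 2) powr (- \<alpha>)" using lift_decay by metis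
  have bd: "norm (lift (Complex (ln t) y)) \<le> (\<bar>C\<bar> * 2 powr \<alpha>) * t powr (- \<alpha>)" if "t \<ge> T" "y = 0 \<or> y = 2 * pi" for t y
  proof -
    have "norm (lift (Complex (ln t) y)) \<le> \<bar>C\<bar> * (t / 2) powr (- \<alpha>)"
      using T(2)[of "Complex (ln t) y"] that T(1) by (auto simp: closed_strip_def)
    also have "(t / 2) powr (- \<alpha>) = 2 powr \<alpha> * t powr (- \<alpha>)"
      using that(1) T(1) by (simp add: powr_divide powr_minus divide_simps)
    finally show ?thesis by (simp add: mult.assoc)
  qed
  show "set_integrable lborel {0<..} (plus_value F \<theta>)"
    by (rule set_integrable_powr_decay[OF continuous_on_plus_value \<delta>(1,2) alpha, of T "\<bar>C\<bar> * 2 powr \<alpha>"])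
       (use bd T(1) in \<open>simp add: plus_value_eq_lift\<close>)
  show "set_integrable lborel {0<..} (minus_value F \<theta>)"
    by (rule set_integrable_powr_decay[OF continuous_on_minus_value \<delta>(1,3) alpha, of T "\<bar>C\<bar> * 2 powr \<alpha>"])
       (use bd T(1) in \<open>simp add: minus_value_eq_lift\<close>)
qed

lemma integrable_jump: "set_integrable lborel {0<..} (jump F \<theta>)"
  unfolding jump_def[abs_def] by (intro set_integral_diff integrable_plus_value integrable_minus_value)

text \<open>
  The disc about \<open>sheet z\<close> whose radius is half the distance between \<open>e\<^sup>z\<close> and \<open>|e\<^sup>z|\<close> avoids the cut by
  \<open>norm_diff_nonneg_real_ge\<close>, so \<open>norm_le_area_integral\<close> applies on it.
\<close>

lemma sheet_bound_near_branch_point: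
  obtains A where "A \<ge> 0" "\<And>z. 0 < Im z \<Longrightarrow> Im z < 2 * pi \<Longrightarrow> Re z \<le> 0 \<Longrightarrow>
    norm (F (sheet z)) * (norm (exp z - of_real (exp (Re z))))\<^sup>2 \<le> A"
proof -
  define K where "K = cball 1 2 - cut_ray \<theta>"
  have FK: "set_integrable lborel K F" unfolding K_def by (rule locally_integrable[OF compact_cball])
  define A where "A = (LINT z:K|lborel. norm (F z))"
  have A0: "A \<ge> 0" unfolding A_def by (rule set_integral_norm_nonneg)
  show thesis
  proof (rule that[of "64 * A"])
    fix z assume z: "0 < Im z" "Im z < 2 * pi" "Re z \<le> 0"
    define D where "D = norm (exp z - of_real (exp (Re z)))"
    define d where "d = D / 2"
    have nz: "norm (exp z) = exp (Re z)" by simp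
    have "exp z \<noteq> of_real (exp (Re z))"
    proof
      assume "exp z = of_real (exp (Re z))"
      then have "sheet z \<in> cut_ray \<theta>" by (auto simp: sheet_def cut_ray_def mult.commute intro!: exI[of _ "exp (Re z)"])
      then show False using sheet_notin_cut z by blast
    qed
    then have D: "D > 0" by (simp add: D_def)
    have "D \<le> exp (Re z) + exp (Re z)" unfolding D_def by (rule order_trans[OF norm_triangle_ineq4]) simp
    moreover have "exp (Re z) \<le> 1" using z by simp
    ultimately have dle: "d \<le> 1" "exp (Re z) \<le> 1" unfolding d_def by linarith+
    have sub: "ball (sheet z) d \<subseteq> K"
    proof
      fix p assume p: "p \<in> ball (sheet z) d"
      have "norm (p - 1) \<le> norm (p - sheet z) + norm (sheet z - 1)"
        using norm_triangle_ineq[of "p - sheet z" "sheet z - 1"] by simp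
      moreover have "norm (sheet z - 1) \<le> 1" using dle by (simp add: sheet_def norm_mult)
      ultimately have "p \<in> cball 1 2" using p dle by (simp add: dist_norm norm_minus_commute)
      moreover have "p \<notin> cut_ray \<theta>"
      proof
        assume "p \<in> cut_ray \<theta>"
        then obtain t where t: "t \<ge> 0" "p = polar_point \<theta> t" by (auto simp: cut_ray_def)
        have "sheet z - p = cis \<theta> * (exp z - of_real t)" unfolding t sheet_def by (simp add: algebra_simps)
        then have "norm (exp z - of_real t) < d" using p by (simp add: dist_norm norm_mult)
        moreover have "D \<le> 2 * norm (exp z - of_real t)"
          using norm_diff_nonneg_real_ge[OF t(1), of "exp z"] unfolding D_def nz .
        ultimately show False by (simp add: d_def)
      qed
      ultimately show "p \<in> K" by (simp add: K_def)
    qed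
    have Fb: "set_integrable lborel (ball (sheet z) d) F" by (rule set_integrable_subset[OF FK _ sub]) simp
    have "norm (F (sheet z)) \<le> 16 / d\<^sup>2 * (LINT p:ball (sheet z) d|lborel. norm (F p))"
    proof (rule norm_le_area_integral[OF _ _ Fb])
      show "F holomorphic_on ball (sheet z) d"
        using sub by (intro holomorphic_on_subset[OF holomorphic_off_cut]) (auto simp: K_def)
    qed (use D in \<open>simp add: d_def\<close>)
    also have "\<dots> \<le> 16 / d\<^sup>2 * A"
    proof (intro mult_left_mono)
      show "(LINT p:ball (sheet z) d|lborel. norm (F p)) \<le> A"
        unfolding A_def set_lebesgue_integral_def
        using set_integrable_norm[OF Fb] set_integrable_norm[OF FK] sub unfolding set_integrable_def
        by (intro integral_mono) (auto simp: indicator_def)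
    qed auto
    also have "\<dots> = 64 * A / D\<^sup>2" by (simp add: d_def power_divide)
    finally have "norm (F (sheet z)) * D\<^sup>2 \<le> 64 * A" using D by (simp add: field_simps)
    then show "norm (F (sheet z)) * (norm (exp z - of_real (exp (Re z))))\<^sup>2 \<le> 64 * A" by (simp add: D_def)
  qed (use A0 in simp)
qed

end

section \<open>Cauchy's formula for the slit plane\<close>

lemma integral_log_substitution:
  fixes g :: "real \<Rightarrow> complex"
  assumes g: "continuous_on {0<..} g" and a: "0 < a" "a \<le> c"
  shows "integral {ln a..ln c} (\<lambda>x. of_real (exp x) * g (exp x)) = (LINT t:{a..c}|lborel. g t)"
proof -
  have gc: "continuous_on {a..c} g" by (rule continuous_on_subset[OF g]) (use a in auto)
  have "((\<lambda>x. exp x *\<^sub>R g (exp x)) has_integral integral {exp (ln a)..exp (ln c)} g) {ln a..ln c}"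
  proof (rule has_integral_substitution[where c = a and d = c])
    have "exp x \<in> {a..c}" if "x \<in> {ln a..ln c}" for x
    proof -
      have "exp (ln a) \<le> exp x" "exp x \<le> exp (ln c)" using that by (auto simp only: exp_le_cancel_iff atLeastAtMost_iff)
      then show ?thesis using a by simp
    qed
    then show "exp ` {ln a..ln c} \<subseteq> {a..c}" by auto
  qed (use a gc in \<open>auto intro!: derivative_eq_intros\<close>)
  then have "((\<lambda>x. of_real (exp x) * g (exp x)) has_integral integral {a..c} g) {ln a..ln c}"
    using a by (simp add: scaleR_conv_of_real)
  moreover have "(LINT t:{a..c}|lborel. g t) = integral {a..c} g"
    by (rule set_borel_integral_eq_integral(2)[OF borel_integrable_atLeastAtMost'[OF gc]])
  ultimately show ?thesis by (simp add: integral_unique)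
qed

lemma norm_integral_le_interior_bound:
  fixes f :: "real \<Rightarrow> complex"
  assumes f: "continuous_on {a..c} f" and le: "a \<le> c"
    and B: "B \<ge> 0" "\<And>y. a < y \<Longrightarrow> y < c \<Longrightarrow> norm (f y) \<le> B"
  shows "norm (integral {a..c} f) \<le> B * (c - a)"
proof -
  have i: "(f has_integral integral {a..c} f) (cbox a c)"
    using f by (auto intro!: integrable_integral integrable_continuous_interval)
  have "norm (integral {a..c} f) \<le> B * measure lborel (cbox a c)"
    by (rule has_integral_bound_spike_finite[OF B(1) _ i, of "{a, c}"]) (use B(2) in auto)
  then show ?thesis using le by simp
qed

context slit_function
begin

definition strip_integrand :: "real \<Rightarrow> complex \<Rightarrow> complex \<Rightarrow> complex" where
  "strip_integrand e z0 z = lift z * strip_weight e z * (exp z / (exp z - exp z0))"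

lemma strip_integrand_continuous:
  assumes e: "e > 0" and z0: "0 < Im z0" "Im z0 < 2 * pi" and x: "x \<noteq> Re z0"
  shows "continuous_on {0..2 * pi} (\<lambda>y. strip_integrand e z0 (Complex x y))"
proof -
  have cy: "continuous_on {0..2 * pi} (\<lambda>y. Complex x y)"
    by (auto intro!: continuous_intros)
  have im: "(\<lambda>y. Complex x y) ` {0..2 * pi} \<subseteq> closed_strip" by (auto simp: closed_strip_def)
  have 1: "continuous_on {0..2 * pi} (\<lambda>y. lift (Complex x y))"
    by (rule continuous_on_compose2[OF continuous_on_lift cy im])
  have 2: "continuous_on {0..2 * pi} (\<lambda>y. strip_weight e (Complex x y))"
    by (rule continuous_on_compose2[OF continuous_on_strip_weight[OF e] cy im]) (simp add: closed_strip_def)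
  have "exp (Complex x y) \<noteq> exp z0" for y
  proof
    assume "exp (Complex x y) = exp z0"
    then have "norm (exp (Complex x y)) = norm (exp z0)" by simp
    then show False using x by simp
  qed
  then show ?thesis unfolding strip_integrand_def
    by (intro continuous_on_mult continuous_on_divide continuous_on_diff continuous_on_exp 1 2 cy continuous_on_const) auto
qed

lemma right_side_bound:
  assumes e: "0 < e" "e \<le> 1" and T: "1 / e \<ge> T" "1 / e \<ge> 2 * norm (exp z0)"
    "\<And>z. z \<in> closed_strip \<Longrightarrow> exp (Re z) \<ge> T \<Longrightarrow> norm (lift z) \<le> \<bar>C\<bar> * (exp (Re z) / 2) powr (- \<alpha>)"
    and z0: "0 < Im z0" "Im z0 < 2 * pi"
  shows "norm (integral {0..2 * pi} (\<lambda>y. strip_integrand e z0 (Complex (ln (1 / e)) y)))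
    \<le> 8 * \<bar>C\<bar> * (1 / e / 2) powr (- \<alpha>) * (2 * pi)"
proof -
  define R where "R = 1 / e"
  have R: "R > 0" "R \<ge> 1" using e by (auto simp: R_def)
  have "exp (Re z0) > 0" by simp
  then have "exp (Re z0) < R" using T(2) unfolding R_def[symmetric] norm_exp_eq_Re by linarith
  then have "exp (Re z0) < exp (ln R)" using R by simp
  then have ne: "ln R \<noteq> Re z0" by auto
  have "norm (integral {0..2 * pi} (\<lambda>y. strip_integrand e z0 (Complex (ln R) y)))
    \<le> (8 * \<bar>C\<bar> * (R / 2) powr (- \<alpha>)) * (2 * pi - 0)"
  proof (rule norm_integral_le_interior_bound[OF strip_integrand_continuous[OF e(1) z0 ne]])
    fix y :: real assume y: "0 < y" "y < 2 * pi"
    define z where "z = Complex (ln R) y"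
    have z: "0 < Im z" "Im z < 2 * pi" "exp (Re z) = R" using y R by (auto simp: z_def)
    have nz: "norm (exp z) = R" using z by simp
    have 1: "norm (lift z) \<le> \<bar>C\<bar> * (R / 2) powr (- \<alpha>)"
      using T(3)[of z] T(1) z by (simp add: closed_strip_def R_def)
    have 2: "norm (strip_weight e z) \<le> 4"
    proof -
      have "norm (strip_weight e z) \<le> (norm (1 - of_real (e ^ 8) * exp (- z)))\<^sup>2"
        using z e by (intro norm_strip_weight_le) auto
      also have "norm (1 - of_real (e ^ 8) * exp (- z)) \<le> 2"
      proof -
        have "norm (of_real (e ^ 8) * exp (- z)) = e ^ 8 * (1 / R)"
          using e z(3) by (simp add: norm_mult norm_power exp_minus norm_inverse divide_inverse)
        also have "\<dots> \<le> 1 * 1" using e R by (intro mult_mono power_le_one) auto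
        finally show ?thesis
          using norm_triangle_ineq4[of 1 "of_real (e ^ 8) * exp (- z)"] by simp
      qed
      then have "(norm (1 - of_real (e ^ 8) * exp (- z)))\<^sup>2 \<le> 2\<^sup>2" by (intro power_mono) auto
      finally show ?thesis by simp
    qed
    have 3: "norm (exp z / (exp z - exp z0)) \<le> 2"
    proof -
      have "norm (exp z - exp z0) \<ge> R - norm (exp z0)" using norm_triangle_ineq2[of "exp z" "exp z0"] nz by simp
      then have "norm (exp z - exp z0) \<ge> R / 2" using T(2) by (simp add: R_def)
      then have "R / norm (exp z - exp z0) \<le> R / (R / 2)" using R by (intro divide_left_mono mult_pos_pos) auto
      then show ?thesis unfolding norm_divide nz using R by simp
    qed
    have "norm (lift z * strip_weight e z * (exp z / (exp z - exp z0))) \<le> (\<bar>C\<bar> * (R / 2) powr (- \<alpha>)) * 4 * 2"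
      unfolding norm_mult using 1 2 3 by (intro mult_mono) auto
    then show "norm (strip_integrand e z0 (Complex (ln R) y)) \<le> 8 * \<bar>C\<bar> * (R / 2) powr (- \<alpha>)"
      by (simp add: z_def strip_integrand_def)
  qed auto
  then show ?thesis by (simp add: R_def)
qed

text \<open>
  The zero of the weight cancels the bound of \<open>sheet_bound_near_branch_point\<close>, which degenerates at both
  ends of the segment: \<open>|1 - \<rho> e\<^sup>-\<^sup>z| = |e\<^sup>z - \<rho>|/\<rho>\<close> when \<open>|e\<^sup>z| = \<rho>\<close>.
\<close>

lemma left_side_bound:
  assumes e: "0 < e" "e \<le> 1" "e ^ 8 \<le> norm (exp z0) / 2"
    and A: "A \<ge> 0" "\<And>z. 0 < Im z \<Longrightarrow> Im z < 2 * pi \<Longrightarrow> Re z \<le> 0 \<Longrightarrow>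
      norm (F (sheet z)) * (norm (exp z - of_real (exp (Re z))))\<^sup>2 \<le> A"
    and z0: "0 < Im z0" "Im z0 < 2 * pi"
  shows "norm (integral {0..2 * pi} (\<lambda>y. strip_integrand e z0 (Complex (ln (e ^ 8)) y)))
    \<le> 2 * A * e ^ 4 / norm (exp z0) * (2 * pi)"
proof -
  define \<rho> where "\<rho> = e ^ 8"
  have \<rho>: "\<rho> > 0" "\<rho> \<le> 1" using e by (auto simp: \<rho>_def power_le_one)
  have q: "norm (exp z0) > 0" by simp
  then have "\<rho> < exp (Re z0)" using e(3) unfolding \<rho>_def[symmetric] norm_exp_eq_Re by linarith
  then have "exp (ln \<rho>) < exp (Re z0)" using \<rho> by simp
  then have ne: "ln \<rho> \<noteq> Re z0" by auto
  have "norm (integral {0..2 * pi} (\<lambda>y. strip_integrand e z0 (Complex (ln \<rho>) y)))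
    \<le> (2 * A * e ^ 4 / norm (exp z0)) * (2 * pi - 0)"
  proof (rule norm_integral_le_interior_bound[OF strip_integrand_continuous[OF e(1) z0 ne]])
    show "0 \<le> 2 * A * e ^ 4 / norm (exp z0)" using A by simp
    fix y :: real assume y: "0 < y" "y < 2 * pi"
    define z where "z = Complex (ln \<rho>) y"
    have z: "0 < Im z" "Im z < 2 * pi" "exp (Re z) = \<rho>" "Re z \<le> 0" using y \<rho> by (auto simp: z_def)
    have nz: "norm (exp z) = \<rho>" using z by simp
    have 1: "norm (lift z) * norm (strip_weight e z) \<le> A / e ^ 4"
    proof -
      have "1 - of_real \<rho> * exp (- z) = (exp z - of_real \<rho>) * exp (- z)"
        by (simp add: algebra_simps flip: exp_add)
      then have n1: "norm (1 - of_real \<rho> * exp (- z)) = norm (exp z - of_real \<rho>) / \<rho>"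
        using z(3) by (simp add: norm_mult exp_minus norm_inverse divide_inverse)
      have e2: "exp (2 * Re z) = \<rho>\<^sup>2" using z(3) by (simp add: exp_double)
      have "norm (strip_weight e z) \<le> (norm (1 - of_real \<rho> * exp (- z)))\<^sup>2 * (exp (2 * Re z) / e ^ 4)"
        unfolding \<rho>_def using z e by (intro norm_strip_weight_le) auto
      also have "\<dots> = (norm (exp z - of_real \<rho>))\<^sup>2 / e ^ 4"
        unfolding n1 e2 using \<rho> by (simp add: power_divide)
      finally have "norm (lift z) * norm (strip_weight e z) \<le> norm (lift z) * ((norm (exp z - of_real \<rho>))\<^sup>2 / e ^ 4)"
        by (intro mult_left_mono) auto
      also have "\<dots> = (norm (F (sheet z)) * (norm (exp z - of_real (exp (Re z))))\<^sup>2) / e ^ 4"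
        using z by (simp add: lift_def)
      also have "\<dots> \<le> A / e ^ 4" using A(2)[OF z(1,2,4)] e by (intro divide_right_mono) auto
      finally show ?thesis .
    qed
    have 2: "norm (exp z / (exp z - exp z0)) \<le> 2 * \<rho> / norm (exp z0)"
    proof -
      have "norm (exp z - exp z0) \<ge> norm (exp z0) - \<rho>"
        using norm_triangle_ineq2[of "exp z0" "exp z"] nz by (simp add: norm_minus_commute)
      then have "norm (exp z - exp z0) \<ge> norm (exp z0) / 2" using e(3) by (simp add: \<rho>_def)
      then have "\<rho> / norm (exp z - exp z0) \<le> \<rho> / (norm (exp z0) / 2)"
        using \<rho> q by (intro divide_left_mono mult_pos_pos) (auto simp del: norm_exp_eq_Re)
      then show ?thesis unfolding norm_divide nz by (simp add: mult.commute)
    qed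
    have "norm (lift z * strip_weight e z * (exp z / (exp z - exp z0))) \<le> (A / e ^ 4) * (2 * \<rho> / norm (exp z0))"
      unfolding norm_mult[of "_ * _"] unfolding norm_mult[of "lift z"] using 1 2 A e \<rho>
      by (intro mult_mono divide_nonneg_nonneg) auto
    also have "\<dots> = 2 * A * e ^ 4 / norm (exp z0)"
    proof -
      have "\<rho> / e ^ 4 = e ^ 4" unfolding \<rho>_def using e by (simp flip: power_diff)
      then show ?thesis by (metis (no_types, opaque_lifting) mult.assoc mult.commute times_divide_eq_left times_divide_eq_right)
    qed
    finally show "norm (strip_integrand e z0 (Complex (ln \<rho>) y)) \<le> 2 * A * e ^ 4 / norm (exp z0)"
      by (simp add: z_def strip_integrand_def)
  qed auto
  then show ?thesis by (simp add: \<rho>_def)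
qed

text \<open>
  The horizontal sides of the rectangle are the two sides of the cut, in the variable \<open>ln t\<close>; the vertical
  sides are the circles of radius \<open>e\<^sup>8\<close> and \<open>1/e\<close> about 1.
\<close>

lemma truncated_cauchy_formula:
  assumes e: "0 < e" "e \<le> 1" and q: "e ^ 8 < norm (exp z0)" "norm (exp z0) < 1 / e"
    and z0: "0 < Im z0" "Im z0 < 2 * pi"
  shows "(LINT t:{e ^ 8..1 / e}|lborel. plus_value F \<theta> t * (strip_weight e (Complex (ln t) 0) * (1 / (of_real t - exp z0))))
     + \<i> * integral {0..2 * pi} (\<lambda>y. strip_integrand e z0 (Complex (ln (1 / e)) y))
     - (LINT t:{e ^ 8..1 / e}|lborel. minus_value F \<theta> t * (strip_weight e (Complex (ln t) (2 * pi)) * (1 / (of_real t - exp z0))))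
     - \<i> * integral {0..2 * pi} (\<lambda>y. strip_integrand e z0 (Complex (ln (e ^ 8)) y))
     = 2 * pi * \<i> * (F (sheet z0) * strip_weight e z0)"
proof -
  have strip: "{z. 0 < Im z \<and> Im z < 2 * pi} \<subseteq> {z. 0 \<le> Im z \<and> Im z \<le> 2 * pi}" by auto
  have ae: "e ^ 8 \<le> 1 / e" "e ^ 8 > 0" using q e by auto
  have "ln (e ^ 8) < Re z0" "Re z0 < ln (1 / e)"
  proof -
    have "ln (e ^ 8) < ln (exp (Re z0))" using q ae by (subst ln_less_cancel_iff) auto
    then show "ln (e ^ 8) < Re z0" by simp
    have "ln (exp (Re z0)) < ln (1 / e)" using q e by (subst ln_less_cancel_iff) auto
    then show "Re z0 < ln (1 / e)" by simp
  qed
  note cf = cauchy_formula_strip[where \<Phi> = "\<lambda>z. lift z * strip_weight e z", OF _ _ this z0]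
  have c: "continuous_on {0<..} (\<lambda>t. strip_weight e (Complex (ln t) y) * (1 / (of_real t - exp z0)))"
    if y: "0 \<le> y" "y \<le> 2 * pi" for y
  proof (intro continuous_on_mult continuous_on_divide continuous_intros)
    have cl: "continuous_on {0<..} (\<lambda>t. Complex (ln t) y)"
      by (auto intro!: continuous_intros)
    show "continuous_on {0<..} (\<lambda>t. strip_weight e (Complex (ln t) y))"
      by (rule continuous_on_compose2[OF continuous_on_strip_weight[OF e(1) order_refl] cl]) (use y in auto)
    show "\<forall>t\<in>{0<..}. complex_of_real t - exp z0 \<noteq> 0"
    proof
      fix t :: real assume "t \<in> {0<..}"
      show "complex_of_real t - exp z0 \<noteq> 0" using exp_strip_neq_nonneg[OF z0, of t] \<open>t \<in> {0<..}\<close> by auto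
    qed
  qed
  have bottom: "strip_integrand e z0 (Complex x 0) = of_real (exp x) * (plus_value F \<theta> (exp x) *
      (strip_weight e (Complex (ln (exp x)) 0) * (1 / (of_real (exp x) - exp z0))))" for x
  proof -
    have "exp (Complex x 0) = of_real (exp x)" by (simp add: complex_eq_iff Re_exp Im_exp)
    then show ?thesis by (simp add: strip_integrand_def lift_def)
  qed
  have top: "strip_integrand e z0 (Complex x (2 * pi)) = of_real (exp x) * (minus_value F \<theta> (exp x) *
      (strip_weight e (Complex (ln (exp x)) (2 * pi)) * (1 / (of_real (exp x) - exp z0))))" for x
  proof -
    have "exp (Complex x (2 * pi)) = of_real (exp x)" by (simp add: complex_eq_iff Re_exp Im_exp)
    then show ?thesis by (simp add: strip_integrand_def lift_def pi_not_le_0)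
  qed
  have "integral {ln (e ^ 8)..ln (1 / e)} (\<lambda>x. strip_integrand e z0 (Complex x 0)) =
      (LINT t:{e ^ 8..1 / e}|lborel. plus_value F \<theta> t * (strip_weight e (Complex (ln t) 0) * (1 / (of_real t - exp z0))))"
    unfolding bottom by (rule integral_log_substitution[OF continuous_on_mult[OF continuous_on_plus_value c] ae(2,1)]) auto
  moreover have "integral {ln (e ^ 8)..ln (1 / e)} (\<lambda>x. strip_integrand e z0 (Complex x (2 * pi))) =
      (LINT t:{e ^ 8..1 / e}|lborel. minus_value F \<theta> t * (strip_weight e (Complex (ln t) (2 * pi)) * (1 / (of_real t - exp z0))))"
    unfolding top by (rule integral_log_substitution[OF continuous_on_mult[OF continuous_on_minus_value c] ae(2,1)]) auto
  moreover have "integral {ln (e ^ 8)..ln (1 / e)} (\<lambda>x. strip_integrand e z0 (Complex x 0))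
     + \<i> * integral {0..2 * pi} (\<lambda>y. strip_integrand e z0 (Complex (ln (1 / e)) y))
     - integral {ln (e ^ 8)..ln (1 / e)} (\<lambda>x. strip_integrand e z0 (Complex x (2 * pi)))
     - \<i> * integral {0..2 * pi} (\<lambda>y. strip_integrand e z0 (Complex (ln (e ^ 8)) y))
     = 2 * pi * \<i> * (lift z0 * strip_weight e z0)"
    unfolding strip_integrand_def
  proof (rule cf)
    show "continuous_on {z. 0 \<le> Im z \<and> Im z \<le> 2 * pi} (\<lambda>z. lift z * strip_weight e z)"
      using continuous_on_lift continuous_on_strip_weight[OF e(1) order_refl]
      by (intro continuous_on_mult) (simp_all add: closed_strip_def)
    show "(\<lambda>z. lift z * strip_weight e z) holomorphic_on {z. 0 < Im z \<and> Im z < 2 * pi}"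
      by (intro holomorphic_on_mult holomorphic_on_lift holomorphic_on_strip_weight e strip)
  qed
  moreover have "lift z0 = F (sheet z0)" using z0 by (simp add: lift_def)
  ultimately show ?thesis by simp
qed

text \<open>
  Let \<open>e \<rightarrow> 0\<close> in \<open>truncated_cauchy_formula\<close>. Both circles disappear, and on the cut the weight is dominated
  by 1 and tends to 1.
\<close>

lemma cauchy_formula_sheet:
  assumes z0: "0 < Im z0" "Im z0 < 2 * pi"
  shows "2 * pi * \<i> * F (sheet z0) = (LINT t:{0<..}|lborel. jump F \<theta> t * (1 / (of_real t - exp z0)))"
proof -
  define q where "q = exp z0"
  have qn: "norm q > 0" by (simp add: q_def)
  define D where "D = norm (q - of_real (norm q))"
  have D: "D > 0" using exp_strip_neq_nonneg[OF z0, of "norm q"] by (auto simp: D_def q_def)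
  define k where "k = (\<lambda>t :: real. 1 / (of_real t - q))"
  have knz: "of_real t - q \<noteq> 0" if "t > 0" for t :: real
    using exp_strip_neq_nonneg[OF z0, of t] that by (auto simp: q_def)
  have kc: "continuous_on {0<..} k" unfolding k_def using knz by (intro continuous_intros) auto
  have kb: "norm (k t) \<le> 2 / D" if "t > 0" for t
  proof -
    have "D \<le> 2 * norm (of_real t - q)"
      using norm_diff_nonneg_real_ge[of t q] that by (simp add: D_def norm_minus_commute)
    then show ?thesis using D knz[OF that] by (simp add: k_def norm_divide divide_simps)
  qed
  define e where "e = (\<lambda>n. inverse (real (Suc n)))"
  have e: "e n > 0" "e n \<le> 1" for n by (auto simp: e_def inverse_le_1_iff)
  have e0: "e \<longlonglongrightarrow> 0" unfolding e_def by (rule LIMSEQ_inverse_real_of_nat)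
  have einf: "filterlim (\<lambda>n. 1 / e n) at_top sequentially"
  proof -
    have "filterlim (\<lambda>n. real (Suc n)) at_top sequentially"
      by (rule filterlim_compose[OF filterlim_real_sequentially filterlim_Suc])
    then show ?thesis by (simp add: e_def inverse_eq_divide)
  qed
  define a where "a = (\<lambda>n. e n ^ 8)"
  have a: "a n > 0" for n unfolding a_def by (intro zero_less_power e)
  have a0: "a \<longlonglongrightarrow> 0"
    unfolding a_def using tendsto_power[OF e0, of 8] by simp
  have lim: "(\<lambda>n. LINT t:{a n..1 / e n}|lborel. g t * (strip_weight (e n) (Complex (ln t) y) * k t))
      \<longlonglongrightarrow> (LINT t:{0<..}|lborel. g t * k t)"
    if g: "set_integrable lborel {0<..} g" and y: "y = 0 \<or> y = 2 * pi" for g y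
  proof (rule tendsto_truncated_integral[OF g kc kb _ _ _ a a0 einf])
    have yy: "0 \<le> y" "y \<le> 2 * pi" using y by auto
    show "continuous_on {0<..} (\<lambda>t. strip_weight (e n) (Complex (ln t) y))" for n
    proof -
      have cl: "continuous_on {0<..} (\<lambda>t. Complex (ln t) y)"
        by (auto intro!: continuous_intros)
      show ?thesis
        by (rule continuous_on_compose2[OF continuous_on_strip_weight[OF e(1) order_refl] cl]) (use yy in auto)
    qed
    show "norm (strip_weight (e n) (Complex (ln t) y)) \<le> 1" if t: "t \<in> {a n..1 / e n}" for n t
    proof -
      have t0: "t > 0" using t a[of n] by auto
      have "exp (- Complex (ln t) y) = of_real (1 / t)"
      proof -
        have "exp (Complex (ln t) y) = of_real t" using y t0 by (auto simp: complex_eq_iff Re_exp Im_exp)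
        then show ?thesis by (simp add: exp_minus inverse_eq_divide)
      qed
      then have "1 - of_real (e n ^ 8) * exp (- Complex (ln t) y) = of_real (1 - a n / t)"
        by (simp add: a_def)
      then have "norm (1 - of_real (e n ^ 8) * exp (- Complex (ln t) y)) = \<bar>1 - a n / t\<bar>"
        by (metis norm_of_real)
      also have "\<dots> \<le> 1"
      proof -
        have "0 \<le> a n / t" "a n / t \<le> 1" using t t0 a[of n] by auto
        then show ?thesis by simp
      qed
      finally have "(norm (1 - of_real (e n ^ 8) * exp (- Complex (ln t) y)))\<^sup>2 \<le> 1" by (simp add: power_le_one)
      then show ?thesis
        using norm_strip_weight_le(1)[of "Complex (ln t) y" "e n"] yy e(1)[of n] by simp
    qed
    show "(\<lambda>n. strip_weight (e n) (Complex (ln t) y)) \<longlonglongrightarrow> 1" for t by (rule strip_weight_tendsto_1[OF e0])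
  qed
  define Rt where "Rt = (\<lambda>n. integral {0..2 * pi} (\<lambda>y. strip_integrand (e n) z0 (Complex (ln (1 / e n)) y)))"
  define Lt where "Lt = (\<lambda>n. integral {0..2 * pi} (\<lambda>y. strip_integrand (e n) z0 (Complex (ln (e n ^ 8)) y)))"
  obtain T where T: "T \<ge> 2" "\<And>z. z \<in> closed_strip \<Longrightarrow> exp (Re z) \<ge> T \<Longrightarrow>
    norm (lift z) \<le> \<bar>C\<bar> * (exp (Re z) / 2) powr (- \<alpha>)" using lift_decay by metis
  obtain A where A: "A \<ge> 0" "\<And>z. 0 < Im z \<Longrightarrow> Im z < 2 * pi \<Longrightarrow> Re z \<le> 0 \<Longrightarrow>
    norm (F (sheet z)) * (norm (exp z - of_real (exp (Re z))))\<^sup>2 \<le> A" using sheet_bound_near_branch_point by metis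
  have big: "\<forall>\<^sub>F n in sequentially. X \<le> 1 / e n" for X using einf by (simp add: filterlim_at_top)
  have small: "\<forall>\<^sub>F n in sequentially. e n ^ 8 < X" if "X > 0" for X
    using order_tendstoD(2)[OF a0 that] by (simp add: a_def)
  have Rt0: "Rt \<longlonglongrightarrow> 0"
  proof (rule tendsto_norm_zero_cancel)
    have "((\<lambda>x. (x / 2) powr (- \<alpha>)) \<longlongrightarrow> 0) at_top"
    proof -
      have "filterlim (\<lambda>x :: real. x / 2) at_top at_top"
        using filterlim_tendsto_pos_mult_at_top[OF tendsto_const[of "1 / 2"] _ filterlim_ident] by simp
      then show ?thesis using alpha by (intro tendsto_neg_powr) auto
    qed
    from tendsto_mult[OF tendsto_mult[OF tendsto_const filterlim_compose[OF this einf]] tendsto_const, of "8 * \<bar>C\<bar>" "2 * pi"]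
    have lim0: "(\<lambda>n. 8 * \<bar>C\<bar> * (1 / e n / 2) powr (- \<alpha>) * (2 * pi)) \<longlonglongrightarrow> 0" by simp
    have bnd: "\<forall>\<^sub>F n in sequentially. norm (Rt n) \<le> 8 * \<bar>C\<bar> * (1 / e n / 2) powr (- \<alpha>) * (2 * pi)"
      using big[of T] big[of "2 * norm (exp z0)"]
      by eventually_elim (unfold Rt_def, rule right_side_bound[OF e _ _ T(2) z0])
    show "(\<lambda>n. norm (Rt n)) \<longlonglongrightarrow> 0"
      by (rule tendsto_sandwich[OF _ bnd tendsto_const lim0]) simp
  qed
  have Lt0: "Lt \<longlonglongrightarrow> 0"
  proof (rule tendsto_norm_zero_cancel)
    have "(\<lambda>n. 2 * A * e n ^ 4 / norm (exp z0) * (2 * pi)) \<longlonglongrightarrow> 2 * A * 0 ^ 4 / norm (exp z0) * (2 * pi)"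
      by (intro tendsto_intros e0) auto
    then have lim0: "(\<lambda>n. 2 * A * e n ^ 4 / norm (exp z0) * (2 * pi)) \<longlonglongrightarrow> 0" by simp
    have "norm (exp z0) / 2 > 0" by simp
    from small[OF this] have bnd: "\<forall>\<^sub>F n in sequentially. norm (Lt n) \<le> 2 * A * e n ^ 4 / norm (exp z0) * (2 * pi)"
      by eventually_elim (unfold Lt_def, rule left_side_bound[OF e _ A z0], simp)
    show "(\<lambda>n. norm (Lt n)) \<longlonglongrightarrow> 0"
      by (rule tendsto_sandwich[OF _ bnd tendsto_const lim0]) simp
  qed
  let ?P = "\<lambda>n. LINT t:{a n..1 / e n}|lborel. plus_value F \<theta> t * (strip_weight (e n) (Complex (ln t) 0) * k t)"
  let ?M = "\<lambda>n. LINT t:{a n..1 / e n}|lborel. minus_value F \<theta> t * (strip_weight (e n) (Complex (ln t) (2 * pi)) * k t)"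
  have "(\<lambda>n. ?P n + \<i> * Rt n - ?M n - \<i> * Lt n) \<longlonglongrightarrow>
      (LINT t:{0<..}|lborel. plus_value F \<theta> t * k t) + \<i> * 0 - (LINT t:{0<..}|lborel. minus_value F \<theta> t * k t) - \<i> * 0"
    by (intro tendsto_add tendsto_diff tendsto_mult tendsto_const Rt0 Lt0 lim integrable_plus_value integrable_minus_value) auto
  moreover have "\<forall>\<^sub>F n in sequentially. ?P n + \<i> * Rt n - ?M n - \<i> * Lt n = 2 * pi * \<i> * (F (sheet z0) * strip_weight (e n) z0)"
    using big[of "2 * norm q"] small[OF qn]
  proof eventually_elim
    case (elim n)
    have "norm (exp z0) < 1 / e n" using elim(1) qn unfolding q_def by linarith
    from truncated_cauchy_formula[OF e _ this z0] elim(2)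
    show ?case unfolding Rt_def Lt_def k_def a_def q_def by simp
  qed
  ultimately have l1: "(\<lambda>n. 2 * pi * \<i> * (F (sheet z0) * strip_weight (e n) z0)) \<longlonglongrightarrow>
      (LINT t:{0<..}|lborel. plus_value F \<theta> t * k t) + \<i> * 0 - (LINT t:{0<..}|lborel. minus_value F \<theta> t * k t) - \<i> * 0"
    by (rule Lim_transform_eventually)
  have l2: "(\<lambda>n. 2 * pi * \<i> * (F (sheet z0) * strip_weight (e n) z0)) \<longlonglongrightarrow> 2 * pi * \<i> * (F (sheet z0) * 1)"
    by (intro tendsto_mult tendsto_const strip_weight_tendsto_1 e0)
  have "2 * pi * \<i> * F (sheet z0) =
      (LINT t:{0<..}|lborel. plus_value F \<theta> t * k t) - (LINT t:{0<..}|lborel. minus_value F \<theta> t * k t)"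
    using LIMSEQ_unique[OF l2 l1] by simp
  also have "\<dots> = (LINT t:{0<..}|lborel. plus_value F \<theta> t * k t - minus_value F \<theta> t * k t)"
  proof -
    note gk = set_integrable_mult_bounded(1)[OF _ set_borel_measurable_continuous_on[OF _ kc], of _ "2 / D"]
    have "set_integrable lborel {0<..} (\<lambda>t. plus_value F \<theta> t * k t)"
      "set_integrable lborel {0<..} (\<lambda>t. minus_value F \<theta> t * k t)"
      using kb by (auto intro!: gk integrable_plus_value integrable_minus_value)
    then show ?thesis by (rule set_integral_diff(2)[symmetric])
  qed
  also have "\<dots> = (LINT t:{0<..}|lborel. jump F \<theta> t * (1 / (of_real t - exp z0)))"
    by (simp only: jump_def k_def q_def left_diff_distrib)
  finally show ?thesis .
qed

lemma cauchy_formula_off_cut: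
  assumes p: "p \<notin> cut_ray \<theta>"
  shows "F p = cis \<theta> / (2 * of_real pi * \<i>) * (LINT t:{0<..}|lborel. jump F \<theta> t / (polar_point \<theta> t - p))"
proof -
  obtain z0 where z0: "0 < Im z0" "Im z0 < 2 * pi" "p = sheet z0" using notin_cut_obtain_sheet[OF p] by blast
  have c: "cis \<theta> \<noteq> 0" by simp
  have "jump F \<theta> t / (polar_point \<theta> t - p) = (jump F \<theta> t * (1 / (of_real t - exp z0))) * (1 / cis \<theta>)" for t
  proof -
    have "polar_point \<theta> t - p = cis \<theta> * (of_real t - exp z0)"
      by (simp add: z0(3) sheet_def algebra_simps)
    then show ?thesis by simp
  qed
  then have "(LINT t:{0<..}|lborel. jump F \<theta> t / (polar_point \<theta> t - p)) =
      (LINT t:{0<..}|lborel. jump F \<theta> t * (1 / (of_real t - exp z0))) * (1 / cis \<theta>)"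
    by (simp only: set_integral_mult_left)
  also have "\<dots> = 2 * pi * \<i> * F p * (1 / cis \<theta>)" using cauchy_formula_sheet[OF z0(1,2)] z0(3) by simp
  finally show ?thesis using c by simp
qed

end

section \<open>The dyadic expansion theorem\<close>

theorem theorem13:
  fixes \<beta> :: complex and b \<theta> \<alpha> C :: real and F :: "complex \<Rightarrow> complex"
  assumes "\<beta> \<noteq> 0" and "\<beta> = of_real (norm \<beta>) * cis b" and "b \<in> {pi / 2 .. 3 * pi / 2}"
    and "norm \<beta> \<le> pi" and "exp (- Re \<beta>) - 2 * cos (Im \<beta>) > 0"
    and "\<theta> \<in> {- pi / 2 .. pi / 2}" and "\<exists>j::int. b + \<theta> = pi + 2 * pi * of_int j"
    and "integrable_branch_point F \<theta>"
    and "\<alpha> > 1"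
    and "\<forall>\<^sub>F p in at_infinity. p \<notin> cut_ray \<theta> \<longrightarrow> norm (F p) \<le> C * norm p powr (- \<alpha>)"
    and "\<And>K. compact K \<Longrightarrow> set_integrable lborel (K - cut_ray \<theta>) F"
    and "F holomorphic_on (- cut_ray \<theta>)"
    and "continuable_through_cut F \<theta>"
  shows "(\<forall>m\<ge>1. \<forall>k z. is_pole (dyadic_term \<beta> \<theta> F m k) z \<longrightarrow> z \<in> pole_ray \<beta>) \<and>
    (\<forall>z. is_pole (dyadic_series \<beta> \<theta> F) z \<longrightarrow> z \<in> pole_ray \<beta>) \<and>
    (\<exists>f. continues_laplace \<beta> b F f) \<and>
    (\<forall>f. continues_laplace \<beta> b F f \<longrightarrow>
       (\<forall>K. compact K \<and> K \<subseteq> - pole_ray \<beta> \<longrightarrow>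
          uniform_limit K (\<lambda>(n, N, l). dyadic_partial_sum \<beta> \<theta> F n N l) f
            (sequentially \<times>\<^sub>F sequentially \<times>\<^sub>F sequentially)))"
proof -
  interpret slit: slit_function F \<theta> \<alpha> C by (unfold_locales; fact assms)
  interpret dir: dyadic_data \<beta> b \<theta> F by (unfold_locales; fact assms slit.integrable_jump)
  let ?S = "dir.dyadic_sum"
  have opn: "open (- pole_ray \<beta>)" by (rule open_slit_plane[OF assms(1)])
  have cauchy: "F (of_real \<tau> * cis (- b)) = cis \<theta> / (2 * of_real pi * \<i>) *
      (LINT t:{0<..}|lborel. jump F \<theta> t / (1 + of_real t * cis \<theta> - of_real \<tau> * cis (- b)))"
    if \<tau>: "\<tau> \<ge> 0" for \<tau>
  proof (rule slit.cauchy_formula_off_cut, rule notI)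
    assume "of_real \<tau> * cis (- b) \<in> cut_ray \<theta>"
    then obtain t where t: "t \<ge> 0" "of_real \<tau> * cis (- b) = 1 + of_real t * cis \<theta>" by (auto simp: cut_ray_def)
    have "cos \<theta> \<ge> 0" using assms(6) by (intro cos_ge_zero) auto
    moreover have "- (\<tau> * cos \<theta>) = 1 + t * cos \<theta>"
      using arg_cong[OF t(2), of Re] unfolding dir.cis_minus_b by simp
    ultimately show False using t(1) \<tau> by (smt (verit) mult_nonneg_nonneg)
  qed
  have hol: "?S holomorphic_on (- pole_ray \<beta>)" by (rule dir.holomorphic_dyadic_sum)
  have on_sector: "rcis r \<phi> / \<beta> = of_real (r / norm \<beta>) * cis (\<phi> - b)" for r \<phi> :: real
    by (subst assms(2)) (simp add: rcis_def flip: cis_divide)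
  have terms: "z \<in> pole_ray \<beta>" if "is_pole (dyadic_term \<beta> \<theta> F m k) z" for m k z
    using not_is_pole_holomorphic[OF opn _ holomorphic_dyadic_term[OF assms(1)]] that by blast
  have series: "z \<in> pole_ray \<beta>" if "is_pole (dyadic_series \<beta> \<theta> F) z" for z
  proof (rule ccontr)
    assume z: "z \<notin> pole_ray \<beta>"
    have "dyadic_series \<beta> \<theta> F holomorphic_on (- pole_ray \<beta>)"
      by (rule holomorphic_transform[OF hol]) (simp add: dir.dyadic_series_eq_dyadic_sum)
    then show False using not_is_pole_holomorphic[OF opn] z that by blast
  qed
  have sum_continues: "continues_laplace \<beta> b F ?S"
    unfolding continues_laplace_def
  proof (intro conjI allI impI hol)
    fix r \<phi> :: real assume r: "r > 0 \<and> b - pi / 2 < \<phi> \<and> \<phi> < b + pi / 2"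
    have "cos (\<phi> - b) > 0" using r by (intro cos_gt_zero_pi) auto
    then have "Re (rcis r \<phi> / \<beta>) > 0" unfolding on_sector using r assms(1) by simp
    then show "?S (rcis r \<phi>) = laplace_ray F b (rcis r \<phi>)"
      using dir.laplace_ray_eq_dyadic_sum[OF cauchy] by simp
  qed
  \<comment> \<open>the two functions agree on the ray through \<beta>, which has limit points in the connected domain\<close>
  have unique: "f x = ?S x" if f: "continues_laplace \<beta> b F f" and x: "x \<in> - pole_ray \<beta>" for f x
  proof -
    define U where "U = {rcis r b | r. r > 0}"
    have mem: "rcis r b \<in> - pole_ray \<beta>" if "r > 0" for r :: real
    proof -
      have "r / norm \<beta> > 0" using that assms(1) by simp
      then show ?thesis
        unfolding Compl_iff pole_ray_iff[OF assms(1)] on_sector by (simp add: complex_nonpos_Reals_iff not_le)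
    qed
    have U: "U \<subseteq> - pole_ray \<beta>" using mem unfolding U_def by auto
    have cb: "cis b \<in> - pole_ray \<beta>" using mem[of 1] by (simp add: rcis_def)
    have lp: "cis b islimpt U"
      unfolding islimpt_approachable
    proof (intro allI impI)
      fix e :: real assume e: "e > 0"
      have "rcis (1 + e / 2) b - cis b = of_real (e / 2) * cis b" by (simp add: rcis_def algebra_simps)
      then have "norm (rcis (1 + e / 2) b - cis b) = norm (of_real (e / 2) * cis b)" by (rule arg_cong)
      then have "norm (rcis (1 + e / 2) b - cis b) = e / 2" using e by (simp only: norm_mult norm_cis norm_of_real)
      then show "\<exists>x'\<in>U. x' \<noteq> cis b \<and> dist x' (cis b) < e"
        using e by (intro bexI[of _ "rcis (1 + e / 2) b"]) (auto simp: dist_norm U_def)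
    qed
    have "f z - ?S z = 0" if "z \<in> U" for z
      using that f sum_continues pi_gt_zero unfolding U_def continues_laplace_def by auto
    moreover have "(\<lambda>z. f z - ?S z) holomorphic_on (- pole_ray \<beta>)"
      using f hol unfolding continues_laplace_def by (intro holomorphic_on_diff) auto
    ultimately have "f x - ?S x = 0"
      using analytic_continuation[OF _ opn connected_slit_plane[OF assms(1)] U cb lp _ x, of "\<lambda>z. f z - ?S z"] by blast
    then show ?thesis by simp
  qed
  have "uniform_limit K (\<lambda>(n, N, l). dyadic_partial_sum \<beta> \<theta> F n N l) f
      (sequentially \<times>\<^sub>F sequentially \<times>\<^sub>F sequentially)"
    if f: "continues_laplace \<beta> b F f" and K: "compact K" "K \<subseteq> - pole_ray \<beta>" for f K
  proof -
    have "uniform_limit K (\<lambda>(n, N, l). dyadic_partial_sum \<beta> \<theta> F n N l) ?S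
        (sequentially \<times>\<^sub>F sequentially \<times>\<^sub>F sequentially)"
      by (rule dir.uniform_limit_dyadic_partial_sum[OF K])
    then show ?thesis
      using unique[OF f] K(2) by (subst uniform_limit_cong'[where g = "\<lambda>(n, N, l). dyadic_partial_sum \<beta> \<theta> F n N l" and i = ?S]) auto
  qed
  with terms series sum_continues show ?thesis by blast
qed

end
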